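(* Let $\tau:I\to I$ be unimodal and transitive, and let $s=\exp h_\tau$. Then $\sqrt2\le s\le2$, and $\tau$ is conjugate to the restricted tent map $T_s$. If in addition the critical point $c$ is not eventually periodic, then: (i) The map $p\mapsto p(\mathcal L_* )I(0,1)$ is a group isomorphism of $\mathbb Z[t,t^{-1}]$ onto $DG(\tau)$. This isomorphism carries the evaluation map $\widehat s:\mathbb Z[t,t^{-1}]\to\mathbb R$, $\widehat s(p)=p(s)$, to the unique scaled state on $DG(\tau)$. (ii) If $s>\sqrt2$, and we give $\mathbb Z[t,t^{-1}]$ the strict order given by evaluation at $s$, then the group isomorphism in (i) is also an order isomorphism. (iii) If $s>\sqrt2$, then the unique state on $DG(\tau)$ induces a group and order isomorphism from $DG(\tau)/DG(\tau)_{\rm inf}$ onto $\mathbb Z[s,s^{-1}]\subset\mathbb R$, with the automorphism of $DG(\tau)/DG(\tau)_{\rm inf}$ induced by $\mathcal L_*$ carried to multiplication by $s$.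
   Context: Let $I=[0,1]$. A unimodal map $\tau:I\to I$ is a continuous map for which there is $c\in(0,1)$ (the critical point) such that $\tau$ is strictly increasing on $[0,c]$ and strictly decreasing on $[c,1]$; its associated partition is $\{0,c,1\}$. $\tau$ is transitive if for all non-empty open $U,V\subset I$ there is $n\ge0$ with $\tau^n(U)\cap V\neq\emptyset$. $h_\tau$ is the topological entropy. Maps are conjugate if intertwined by a homeomorphism of $I$. For $s>1$ the restricted tent map is $T_s(x)=1+s(x-c_s)$ for $x\le c_s$ and $T_s(x)=1-s(x-c_s)$ for $x>c_s$, where $c_s=1-1/s$. The generalized orbit of $x\in I$ is the smallest subset of $I$ containing $x$ that is forward and backward invariant under $\tau$. $I_1$ is the union of the generalized orbits of $0,c,1$, and $I_0=I\setminus I_1$. $X$ is the totally ordered set obtained from $I$ by replacing each $x\in I_1\setminus\{0,1\}$ by two points $x^-<x^+$, with the order topology (homeomorphic to a compact subset of $\mathbb R$); $\pi:X\to I$ is the collapse map ($\pi(x^\pm)=x$), and $X_0=\pi^{-1}(I_0)$. The local homeomorphism associated with $\tau$ is the unique continuous map $\sigma:X\to X$ with $\pi\circ\sigma=\tau\circ\pi$ on $X_0$. Let $(\mathcal L f)(x)=\sum_{\sigma y=x}f(y)$ for $f\in C(X,\mathbb Z)$. $DG(\tau)$ is $C(X,\mathbb Z)$ modulo $f\sim g$ iff $\mathcal L^nf=\mathcal L^ng$ for some $n\ge0$, ordered by $[f]\ge0$ iff $\mathcal L^nf\ge0$ for some $n$, with distinguished order unit $[1]$; $\mathcal L_*[f]=[\mathcal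 Lf]$ is an automorphism when $\tau$ is surjective (as it is when $\tau$ is transitive), so $p(\mathcal L_* )$ makes sense for $p\in\mathbb Z[t,t^{-1}]$. $I(0,1)$ denotes the class in $DG(\tau)$ of the constant function $1$ on $X$. A state on a dimension group $G$ with order unit $e$ is a positive homomorphism $\omega:G\to\mathbb R$ with $\omega(e)=1$; a scaled state on $DG(\tau)$ is a state with $\omega(\mathcal L_*x)=r\,\omega(x)$ for all $x$, for some $r>0$. For such $\tau$ the scaled state is unique, and if $s>\sqrt 2$ there is a unique state on $DG(\tau)$. The strict order on $\mathbb Z[t,t^{-1}]$ given by evaluation at $s$ is: $p\ge0$ iff $p=0$ or $p(s)>0$. $\mathbb Z[s,s^{-1}]$ is the subring of $\mathbb R$ generated by $s,s^{-1}$, with the order inherited from $\mathbb R$. $G_{\rm inf}$ is the subgroup of $x\in G$ with $-e\le nx\le e$ for all integers $n\ge0$; $G/G_{\rm inf}$ has as positive cone the image of $G^+$. *)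

theory Defs
  imports
    "HOL-Analysis.Analysis"
    "HOL-Library.Poly_Mapping"
    "HOL-Algebra.Coset"
    "HOL-Algebra.Generated_Rings"
    "HOL-Algebra.Algebraic_Closure_Type"
begin

section \<open>Unimodal maps\<close>

abbreviation I :: "real set" where
  "I \<equiv> {0..1}"

definition unimodal :: "(real \<Rightarrow> real) \<Rightarrow> real \<Rightarrow> bool" where
  "unimodal \<tau> c \<longleftrightarrow> continuous_on I \<tau> \<and> \<tau> ` I \<subseteq> I \<and> 0 < c \<and> c < 1
     \<and> strict_mono_on {0..c} \<tau> \<and> strict_antimono_on {c..1} \<tau>"

definition transitive :: "'a topology \<Rightarrow> ('a \<Rightarrow> 'a) \<Rightarrow> bool" where
  "transitive T f \<longleftrightarrow> (\<forall>U V. openin T U \<and> openin T V \<and> U \<noteq> {} \<and> V \<noteq> {}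
     \<longrightarrow> (\<exists>n. (f ^^ n) ` U \<inter> V \<noteq> {}))"

definition eventually_periodic :: "('a \<Rightarrow> 'a) \<Rightarrow> 'a \<Rightarrow> bool" where
  "eventually_periodic f x \<longleftrightarrow> (\<exists>n p. p > 0 \<and> (f ^^ (n + p)) x = (f ^^ n) x)"

definition conjugate_on :: "'a::topological_space set \<Rightarrow> ('a \<Rightarrow> 'a) \<Rightarrow> ('a \<Rightarrow> 'a) \<Rightarrow> bool" where
  "conjugate_on S f g \<longleftrightarrow> (\<exists>h k. homeomorphism S S h k \<and> (\<forall>x\<in>S. h (f x) = g (h x)))"

definition restricted_tent :: "real \<Rightarrow> real \<Rightarrow> real" where
  "restricted_tent s x =
     (let c = 1 - 1 / s in if x \<le> c then 1 + s * (x - c) else 1 - s * (x - c))"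

section \<open>Topological entropy\<close>

text \<open>The definition of Adler, Konheim and McAndrew by open covers of a compact space.
  The elements of \<open>iterated_cover T f \<U> n\<close> are the sets
  \<open>A 0 \<inter> f -` A 1 \<inter> \<dots> \<inter> (f ^^ (n - 1)) -` A (n - 1)\<close> with all \<open>A i \<in> \<U>\<close>.
  The sequence in \<open>cover_entropy\<close> converges by subadditivity, so that the
  limit superior is the limit.\<close>

definition iterated_cover :: "'a topology \<Rightarrow> ('a \<Rightarrow> 'a) \<Rightarrow> 'a set set \<Rightarrow> nat \<Rightarrow> 'a set set" where
  "iterated_cover T f \<U> n =
     {{x \<in> topspace T. \<forall>i<n. (f ^^ i) x \<in> A i} | A. \<forall>i<n. A i \<in> \<U>}"

definition min_subcover_card :: "'a topology \<Rightarrow> 'a set set \<Rightarrow> nat" where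
  "min_subcover_card T \<U> = (LEAST k. \<exists>\<V>\<subseteq>\<U>. finite \<V> \<and> card \<V> = k \<and> \<Union>\<V> = topspace T)"

definition cover_entropy :: "'a topology \<Rightarrow> ('a \<Rightarrow> 'a) \<Rightarrow> 'a set set \<Rightarrow> ereal" where
  "cover_entropy T f \<U> =
     limsup (\<lambda>n. ereal (ln (real (min_subcover_card T (iterated_cover T f \<U> n))) / real n))"

definition topological_entropy :: "'a topology \<Rightarrow> ('a \<Rightarrow> 'a) \<Rightarrow> ereal" where
  "topological_entropy T f =
     (SUP \<U> \<in> {\<U>. (\<forall>U\<in>\<U>. openin T U) \<and> \<Union>\<U> = topspace T}. cover_entropy T f \<U>)"

section \<open>The split interval and the local homeomorphism\<close>

definition generalized_orbit :: "(real \<Rightarrow> real) \<Rightarrow> real \<Rightarrow> real set" where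
  "generalized_orbit \<tau> x =
     \<Inter>{A. A \<subseteq> I \<and> x \<in> A \<and> \<tau> ` A \<subseteq> A \<and> {y \<in> I. \<tau> y \<in> A} \<subseteq> A}"

definition I1 :: "(real \<Rightarrow> real) \<Rightarrow> real \<Rightarrow> real set" where
  "I1 \<tau> c = generalized_orbit \<tau> 0 \<union> generalized_orbit \<tau> c \<union> generalized_orbit \<tau> 1"

definition I0 :: "(real \<Rightarrow> real) \<Rightarrow> real \<Rightarrow> real set" where
  "I0 \<tau> c = I - I1 \<tau> c"

text \<open>A point \<open>x\<close> that is not split is encoded as \<open>(x, False)\<close>; a split point gives
  \<open>x\<^sup>- = (x, False)\<close> and \<open>x\<^sup>+ = (x, True)\<close>. The order is lexicographic with
  \<open>False < True\<close>, and the collapse map onto the interval is \<open>fst\<close>.\<close>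

definition split_interval :: "(real \<Rightarrow> real) \<Rightarrow> real \<Rightarrow> (real \<times> bool) set" where
  "split_interval \<tau> c = {(x, b). x \<in> I \<and> (b \<longrightarrow> x \<in> I1 \<tau> c - {0, 1})}"

definition split_less :: "real \<times> bool \<Rightarrow> real \<times> bool \<Rightarrow> bool" where
  "split_less u v \<longleftrightarrow> fst u < fst v \<or> fst u = fst v \<and> \<not> snd u \<and> snd v"

text \<open>The rays are those with end points in \<open>A\<close>: this is the order topology of the ordered set
  \<open>A\<close> itself, in general coarser than the subspace topology from a larger ordered set.\<close>

definition order_topology_on :: "'a set \<Rightarrow> ('a \<Rightarrow> 'a \<Rightarrow> bool) \<Rightarrow> 'a topology" where
  "order_topology_on A lt = topology_generated_by
     ({A} \<union> {{y \<in> A. lt y a} | a. a \<in> A} \<union> {{y \<in> A. lt a y} | a. a \<in> A})"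

definition split_topology :: "(real \<Rightarrow> real) \<Rightarrow> real \<Rightarrow> (real \<times> bool) topology" where
  "split_topology \<tau> c = order_topology_on (split_interval \<tau> c) split_less"

text \<open>Extensionality only fixes the irrelevant values outside the space, so that the description is
  unique.\<close>

definition local_homeo :: "(real \<Rightarrow> real) \<Rightarrow> real \<Rightarrow> real \<times> bool \<Rightarrow> real \<times> bool" where
  "local_homeo \<tau> c = (THE \<sigma>.
     continuous_map (split_topology \<tau> c) (split_topology \<tau> c) \<sigma> \<and>
     \<sigma> \<in> extensional (split_interval \<tau> c) \<and>
     (\<forall>u\<in>split_interval \<tau> c. fst u \<in> I0 \<tau> c \<longrightarrow> fst (\<sigma> u) = \<tau> (fst u)))"

section \<open>Ordered groups, states and infinitesimals\<close>

text \<open>Abelian groups are written multiplicatively, as everywhere in HOL-Algebra: the group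
  operation is \<open>\<otimes>\<close>, the multiple \<open>n x\<close> is \<open>x [^] n\<close>, and \<open>\<one>\<close> is the neutral element. The order is
  given by the positive cone, and \<open>order_unit\<close> is the distinguished order unit.\<close>

record 'a ordered_group = "'a monoid" +
  Pos :: "'a set"

record 'a unital_ordered_group = "'a ordered_group" +
  order_unit :: 'a

definition with_cone :: "('a, 'm) monoid_scheme \<Rightarrow> 'a set \<Rightarrow> 'a ordered_group" where
  "with_cone G P = \<lparr>carrier = carrier G, mult = mult G, one = one G, Pos = P\<rparr>"

definition leq :: "('a, 'm) ordered_group_scheme \<Rightarrow> 'a \<Rightarrow> 'a \<Rightarrow> bool" where
  "leq G x y \<longleftrightarrow> y \<otimes>\<^bsub>G\<^esub> inv\<^bsub>G\<^esub> x \<in> Pos G"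

definition order_iso ::
  "('a, 'm) ordered_group_scheme \<Rightarrow> ('b, 'n) ordered_group_scheme \<Rightarrow> ('a \<Rightarrow> 'b) set" where
  "order_iso G H = {\<phi> \<in> iso G H. \<forall>x\<in>carrier G. x \<in> Pos G \<longleftrightarrow> \<phi> x \<in> Pos H}"

definition infinitesimals :: "('a, 'm) unital_ordered_group_scheme \<Rightarrow> 'a set" where
  "infinitesimals G = {x \<in> carrier G. \<forall>n::nat.
     leq G (inv\<^bsub>G\<^esub> order_unit G) (x [^]\<^bsub>G\<^esub> n) \<and> leq G (x [^]\<^bsub>G\<^esub> n) (order_unit G)}"

definition quotient_group ::
  "('a, 'm) ordered_group_scheme \<Rightarrow> 'a set \<Rightarrow> 'a set ordered_group" where
  "quotient_group G N = with_cone (G Mod N) ((\<lambda>x. N #>\<^bsub>G\<^esub> x) ` Pos G)"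

abbreviation real_group :: "real monoid" where
  "real_group \<equiv> add_monoid (ring_of_type_algebra :: real ring)"

text \<open>Extensionality again only fixes the values outside the carrier, so that a state is determined
  by its restriction to the group.\<close>

definition state :: "('a, 'm) unital_ordered_group_scheme \<Rightarrow> ('a \<Rightarrow> real) \<Rightarrow> bool" where
  "state G \<omega> \<longleftrightarrow> \<omega> \<in> hom G real_group \<and> \<omega> \<in> extensional (carrier G) \<and>
     (\<forall>x\<in>Pos G. 0 \<le> \<omega> x) \<and> \<omega> (order_unit G) = 1"

section \<open>The dimension group of a local homeomorphism\<close>

text \<open>Functions on \<open>T\<close> are represented by functions that vanish outside the space.\<close>

definition cont_int :: "'a topology \<Rightarrow> ('a \<Rightarrow> int) set" where
  "cont_int T = {f. continuous_map T (discrete_topology UNIV) f \<and> (\<forall>x. x \<notin> topspace T \<longrightarrow> f x = 0)}"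

text \<open>Meaningful only if the fibres of \<open>\<sigma>\<close> are finite, which holds for the local homeomorphism of
  a unimodal map.\<close>

definition transfer :: "'a topology \<Rightarrow> ('a \<Rightarrow> 'a) \<Rightarrow> ('a \<Rightarrow> int) \<Rightarrow> 'a \<Rightarrow> int" where
  "transfer T \<sigma> f x = (\<Sum>y | y \<in> topspace T \<and> \<sigma> y = x. f y)"

definition dim_rel :: "'a topology \<Rightarrow> ('a \<Rightarrow> 'a) \<Rightarrow> (('a \<Rightarrow> int) \<times> ('a \<Rightarrow> int)) set" where
  "dim_rel T \<sigma> = {(f, g). f \<in> cont_int T \<and> g \<in> cont_int T \<and>
     (\<exists>n. (transfer T \<sigma> ^^ n) f = (transfer T \<sigma> ^^ n) g)}"

definition dim_class :: "'a topology \<Rightarrow> ('a \<Rightarrow> 'a) \<Rightarrow> ('a \<Rightarrow> int) \<Rightarrow> ('a \<Rightarrow> int) set" where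
  "dim_class T \<sigma> f = dim_rel T \<sigma> `` {f}"

definition dim_group ::
  "'a topology \<Rightarrow> ('a \<Rightarrow> 'a) \<Rightarrow> ('a \<Rightarrow> int) set unital_ordered_group" where
  "dim_group T \<sigma> =
     \<lparr>carrier = cont_int T // dim_rel T \<sigma>,
      mult = (\<lambda>A B. \<Union>f\<in>A. \<Union>g\<in>B. dim_class T \<sigma> (\<lambda>x. f x + g x)),
      one = dim_class T \<sigma> (\<lambda>x. 0),
      Pos = {dim_class T \<sigma> f | f. f \<in> cont_int T \<and> (\<exists>n. \<forall>x. 0 \<le> (transfer T \<sigma> ^^ n) f x)},
      order_unit = dim_class T \<sigma> (indicator (topspace T))\<rparr>"

definition dim_transfer ::
  "'a topology \<Rightarrow> ('a \<Rightarrow> 'a) \<Rightarrow> ('a \<Rightarrow> int) set \<Rightarrow> ('a \<Rightarrow> int) set" where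
  "dim_transfer T \<sigma> A = (\<Union>f\<in>A. dim_class T \<sigma> (transfer T \<sigma> f))"

definition DG :: "(real \<Rightarrow> real) \<Rightarrow> real \<Rightarrow> (real \<times> bool \<Rightarrow> int) set unital_ordered_group" where
  "DG \<tau> c = dim_group (split_topology \<tau> c) (local_homeo \<tau> c)"

definition Lstar ::
  "(real \<Rightarrow> real) \<Rightarrow> real \<Rightarrow> (real \<times> bool \<Rightarrow> int) set \<Rightarrow> (real \<times> bool \<Rightarrow> int) set" where
  "Lstar \<tau> c = dim_transfer (split_topology \<tau> c) (local_homeo \<tau> c)"

text \<open>The class \<open>I(0,1)\<close> of the constant function 1.\<close>

abbreviation I01 :: "(real \<Rightarrow> real) \<Rightarrow> real \<Rightarrow> (real \<times> bool \<Rightarrow> int) set" where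
  "I01 \<tau> c \<equiv> order_unit (DG \<tau> c)"

definition scaled_state ::
  "(real \<Rightarrow> real) \<Rightarrow> real \<Rightarrow> ((real \<times> bool \<Rightarrow> int) set \<Rightarrow> real) \<Rightarrow> bool" where
  "scaled_state \<tau> c \<omega> \<longleftrightarrow> state (DG \<tau> c) \<omega> \<and>
     (\<exists>r>0. \<forall>x\<in>carrier (DG \<tau> c). \<omega> (Lstar \<tau> c x) = r * \<omega> x)"

section \<open>Laurent polynomials\<close>

text \<open>Finitely supported functions from \<open>\<int>\<close> to \<open>\<int>\<close> with the convolution product form the
  integral group ring of \<open>\<int>\<close>, that is \<open>\<int>[t, t\<^sup>-\<^sup>1]\<close>; the coefficient of \<open>t\<^sup>k\<close> is \<open>Poly_Mapping.lookup p k\<close>.\<close>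

type_synonym laurent = "int \<Rightarrow>\<^sub>0 int"

abbreviation laurent_group :: "laurent monoid" where
  "laurent_group \<equiv> add_monoid (ring_of_type_algebra :: laurent ring)"

definition laurent_eval :: "real \<Rightarrow> laurent \<Rightarrow> real" where
  "laurent_eval s p = (\<Sum>k\<in>Poly_Mapping.keys p. of_int (Poly_Mapping.lookup p k) * s powi k)"

definition laurent_strict :: "real \<Rightarrow> laurent ordered_group" where
  "laurent_strict s = with_cone laurent_group {p. p = 0 \<or> laurent_eval s p > 0}"

text \<open>For an automorphism \<open>\<phi>\<close> of an abelian group and \<open>p = \<Sum>k. a k t\<^sup>k\<close>, the element
  \<open>p(\<phi>) x = \<Sum>k. a k \<phi>\<^sup>k(x)\<close>.\<close>

definition aut_power :: "('a, 'm) monoid_scheme \<Rightarrow> ('a \<Rightarrow> 'a) \<Rightarrow> int \<Rightarrow> 'a \<Rightarrow> 'a" where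
  "aut_power G \<phi> k =
     (if 0 \<le> k then \<phi> ^^ nat k else inv_into (carrier G) \<phi> ^^ nat (- k))"

definition laurent_apply :: "('a, 'm) monoid_scheme \<Rightarrow> ('a \<Rightarrow> 'a) \<Rightarrow> laurent \<Rightarrow> 'a \<Rightarrow> 'a" where
  "laurent_apply G \<phi> p x =
     finprod G (\<lambda>k. aut_power G \<phi> k x [^]\<^bsub>G\<^esub> Poly_Mapping.lookup p k) (Poly_Mapping.keys p)"

text \<open>The subring \<open>\<int>[s, s\<^sup>-\<^sup>1]\<close> of the reals, as an ordered group.\<close>

definition Z_adjoin :: "real \<Rightarrow> real ordered_group" where
  "Z_adjoin s =
     (let R = generate_ring (ring_of_type_algebra :: real ring) {s, inverse s}
      in with_cone (real_group\<lparr>carrier := R\<rparr>) {x \<in> R. 0 \<le> x})"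

end

theory Submission
  imports Defs
begin

text \<open>The transfer operator acts on measures, and normalised resolvents at parameters tending to
  the radius of convergence of the preimage counting series cluster at a measure that \<open>\<tau>\<close> multiplies
  by the constant \<open>slope\<close> on each branch. Transitivity makes this measure atomless with full support,
  so its distribution function \<open>F\<close> conjugates \<open>\<tau>\<close> to a tent map; counting itineraries and preimages
  shows that the entropy is \<open>ln slope\<close>.

  Let \<open>c\<close> not be eventually periodic, and for a split point \<open>y\<close> let \<open>g\<^sub>y\<close> be the indicator of the
  points above \<open>y\<close>. The \<open>g\<^sub>y\<close> span \<open>C(X, \<int>)\<close>, and \<open>L g\<^sub>y = 1 \<plusminus> g\<^bsub>\<tau> y\<^esub>\<close>. As every split point has
  an iterate in the orbit of \<open>c\<close> and \<open>g\<^sub>0 = 1\<close>, the class of \<open>1\<close> generates the group under \<open>L\<^sub>*\<close> and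
  its inverse. There is no relation, since \<open>L\<^sup>d 1\<close> is the lowest power that jumps at \<open>\<tau>\<^sup>d 0\<close>.
  Integration with respect to the conjugated Lebesgue measure is a scaled state \<open>\<omega>\<close>. For the
  order it suffices that \<open>\<omega> f > 0\<close> implies \<open>L\<^sup>n f \<ge> 0\<close> for some \<open>n\<close>: the variation of
  \<open>slope\<^bsup>-n\<^esup> L\<^sup>n f\<close> stays bounded because \<open>slope > sqrt 2\<close>, and a function of bounded variation
  with positive integral is large on an interval of definite length, which \<open>L\<^sup>N\<close> spreads over
  everything for some uniform \<open>N\<close>. Hence \<open>f > 0\<close> is decided by \<open>\<omega>\<close> alone, and the states and
  infinitesimals follow.\<close>

section \<open>Transitive unimodal maps\<close>

text \<open>On the interval itself L does not preserve continuity: the number of preimages changes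
  at \<open>\<tau> 0\<close>. An invariant cone of continuous functions is therefore not at hand,
  and the measure is built from resolvents at point masses. Each of them satisfies the scaling
  relation up to one point mass, and division by a total mass that tends to infinity removes this
  error. The constant sqrt 2 has two sources. Transitivity forces the fixed point on the right
  branch to lie above \<open>\<tau> 0\<close>, so that two steps back at least double the number of
  preimages. Later an interval across \<open>c\<close> keeps only its longer half, so that two steps
  expand by \<open>slope\<^sup>2 / 2\<close>, and the variation obeys a recursion with the same
  quotient. For the entropy the obstacle is that every open set around \<open>c\<close> is folded;
  this costs a factor 2 per step unless the covers are adapted to a high iterate.\<close>

locale transitive_unimodal =
  fixes \<tau> :: "real \<Rightarrow> real" and c :: real
  assumes unimodal: "unimodal \<tau> c"
    and transitive: "transitive (top_of_set I) \<tau>"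
begin

section \<open>Elementary properties of unimodal maps\<close>

lemma cont: "continuous_on I \<tau>" and maps_I: "x \<in> I \<Longrightarrow> \<tau> x \<in> I" and c_bounds: "0 < c" "c < 1"
  using unimodal unfolding unimodal_def by blast+

lemma range_\<tau>: "\<lbrakk>0 \<le> x; x \<le> 1\<rbrakk> \<Longrightarrow> 0 \<le> \<tau> x \<and> \<tau> x \<le> 1"
  using maps_I[of x] by auto

lemma incr: "\<lbrakk>0 \<le> x; x < y; y \<le> c\<rbrakk> \<Longrightarrow> \<tau> x < \<tau> y"
  using unimodal unfolding unimodal_def by (auto intro: strict_mono_onD)

lemma decr: "\<lbrakk>c \<le> x; x < y; y \<le> 1\<rbrakk> \<Longrightarrow> \<tau> y < \<tau> x"
  using unimodal unfolding unimodal_def by (auto dest!: monotone_onD[where x = x and y = y])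

lemma incr_le: "\<lbrakk>0 \<le> x; x \<le> y; y \<le> c\<rbrakk> \<Longrightarrow> \<tau> x \<le> \<tau> y"
  using incr[of x y] by (cases "x = y") auto

lemma decr_le: "\<lbrakk>c \<le> x; x \<le> y; y \<le> 1\<rbrakk> \<Longrightarrow> \<tau> y \<le> \<tau> x"
  using decr[of x y] by (cases "x = y") auto

lemma funpow_I: "x \<in> I \<Longrightarrow> (\<tau> ^^ n) x \<in> I"
  by (induction n) (use maps_I in auto)

text \<open>Transitivity as a source of contradictions: the iterates of the interval
  \<open>(p, q)\<close> stay in the forward invariant set \<open>A\<close>, so they never reach the
  gap \<open>(u, v)\<close>.\<close>

lemma no_invariant:
  assumes A: "A \<subseteq> I" "\<And>x. x \<in> A \<Longrightarrow> \<tau> x \<in> A"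
    and pq: "p < q" "\<And>x. \<lbrakk>p < x; x < q\<rbrakk> \<Longrightarrow> x \<in> A"
    and uv: "0 \<le> u" "u < v" "v \<le> 1" "\<And>x. \<lbrakk>u < x; x < v\<rbrakk> \<Longrightarrow> x \<notin> A"
  shows False
proof -
  have "openin (top_of_set I) {p<..<q}" "openin (top_of_set I) {u<..<v}"
    using A(1) pq(2) uv by (auto intro!: open_subset subsetI)
  moreover have "{p<..<q} \<noteq> {}" "{u<..<v} \<noteq> {}" using pq uv by auto
  ultimately obtain n where n: "(\<tau> ^^ n) ` {p<..<q} \<inter> {u<..<v} \<noteq> {}"
    using transitive unfolding transitive_def by meson
  then obtain x where x: "x \<in> {p<..<q}" "(\<tau> ^^ n) x \<in> {u<..<v}" by blast
  have "(\<tau> ^^ n) y \<in> A" if "y \<in> A" for y using that by (induction n) (use A(2) in auto)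
  with x pq(2)[of x] uv(4)[of "(\<tau> ^^ n) x"] show False by auto
qed

text \<open>Every value is at most \<open>\<tau> c\<close>, so a maximum below 1 would make
  \<open>{0..\<tau> c}\<close> forward invariant with a gap above it.\<close>

lemma \<tau>_c [simp]: "\<tau> c = 1"
proof (rule ccontr)
  assume "\<tau> c \<noteq> 1"
  with c_bounds have lt: "\<tau> c < 1" "\<tau> c > 0"
    using range_\<tau>[of c] range_\<tau>[of 0] incr[of 0 c] by auto
  show False
  proof (rule no_invariant[of "{0..\<tau> c}" 0 "\<tau> c" "\<tau> c" 1])
    show "\<tau> x \<in> {0..\<tau> c}" if "x \<in> {0..\<tau> c}" for x
      using that lt c_bounds incr_le[of x c] decr_le[of c x] range_\<tau>[of x] by (smt (verit) atLeastAtMost_iff)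
  qed (use lt in auto)
qed

lemma \<tau>0_lt: "\<tau> 0 < 1" and \<tau>1_lt: "\<tau> 1 < 1"
  using incr[of 0 c] decr[of c 1] c_bounds by auto

lemma \<tau>_lt_1: "\<lbrakk>0 \<le> x; x \<le> 1; x \<noteq> c\<rbrakk> \<Longrightarrow> \<tau> x < 1"
  using incr[of x c] decr[of c x] by (cases "x < c") auto

text \<open>The minimum of \<open>\<tau>\<close> is attained at an end point. If both end values
  were positive, an interval ending at 1 would be invariant. So \<open>\<tau> 1 > 0\<close> forces
  \<open>\<tau> 0 = 0\<close>, and then the position of the graph relative to the diagonal near 0
  yields an invariant interval at one of the two ends.\<close>

lemma \<tau>_1 [simp]: "\<tau> 1 = 0"
proof (rule ccontr)
  assume 1: "\<tau> 1 \<noteq> 0"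
  hence 1: "\<tau> 1 > 0" using range_\<tau>[of 1] by auto
  have lower: "min (\<tau> 0) (\<tau> 1) \<le> \<tau> x" if "0 \<le> x" "x \<le> 1" for x
    using that incr_le[of 0 x] decr_le[of x 1] by (smt (verit))
  have 0: "\<tau> 0 = 0"
  proof (rule ccontr)
    define m where "m = min (\<tau> 0) (\<tau> 1)"
    assume "\<tau> 0 \<noteq> 0"
    hence "0 < m" "m < 1" using range_\<tau>[of 0] 1 \<tau>1_lt by (auto simp: m_def min_def)
    moreover have "\<tau> x \<in> {m..1}" if "x \<in> {m..1}" for x
      using that lower[of x] range_\<tau>[of x] \<open>0 < m\<close> unfolding m_def by (smt (verit) atLeastAtMost_iff)
    ultimately show False
      by (intro no_invariant[of "{m..1}" m 1 0 m]) auto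
  qed
  \<comment> \<open>For \<open>x\<close> below \<open>c\<close> the left branch is increasing up to
    \<open>x\<close>, and for \<open>x\<close> below \<open>\<tau> 1\<close> no point of the right
    branch is sent below \<open>x\<close>; the invariance of \<open>{x..1}\<close> needs
    both.\<close>
  define e where "e = min c (\<tau> 1)"
  have e: "0 < e" "e \<le> c" "e \<le> \<tau> 1" using 1 c_bounds by (auto simp: e_def)
  show False
  proof (cases "\<exists>x. 0 < x \<and> x < e \<and> \<tau> x < x")
    case True
    then obtain x where x: "0 < x" "x < e" "\<tau> x < x" by auto
    show False
    proof (rule no_invariant[of "{0..x}" 0 x x 1])
      show "\<tau> y \<in> {0..x}" if "y \<in> {0..x}" for y
        using that x e c_bounds incr_le[of y x] range_\<tau>[of y] by (smt (verit) atLeastAtMost_iff)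
    qed (use x e c_bounds in auto)
  next
    case False
    define x where "x = e / 2"
    have x: "0 < x" "x < e" using e by (auto simp: x_def)
    hence x: "0 < x" "x < e" "\<tau> x \<ge> x" using False by (simp_all, meson not_less)
    show False
    proof (rule no_invariant[of "{x..1}" x 1 0 x])
      show "\<tau> y \<in> {x..1}" if "y \<in> {x..1}" for y
        using that x e c_bounds incr_le[of x y] decr_le[of y 1] range_\<tau>[of y]
        by (smt (verit) atLeastAtMost_iff)
    qed (use x e c_bounds in auto)
  qed
qed

lemma \<tau>_eq_1_iff: "\<lbrakk>0 \<le> x; x \<le> 1\<rbrakk> \<Longrightarrow> \<tau> x = 1 \<longleftrightarrow> x = c"
  using \<tau>_lt_1[of x] \<tau>_c by (metis less_irrefl)

lemma \<tau>_pos: "\<lbrakk>0 < x; x < 1\<rbrakk> \<Longrightarrow> 0 < \<tau> x"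
  using incr[of 0 x] decr[of x 1] range_\<tau>[of 0] by (smt (verit) c_bounds \<tau>_1)

lemma right_preimage: "\<lbrakk>0 \<le> z; z \<le> 1\<rbrakk> \<Longrightarrow> \<exists>w. c \<le> w \<and> w \<le> 1 \<and> \<tau> w = z"
  using IVT2'[of \<tau> 1 z c] c_bounds continuous_on_subset[OF cont, of "{c..1}"] by simp

lemma left_preimage: "\<lbrakk>\<tau> 0 \<le> z; z \<le> 1\<rbrakk> \<Longrightarrow> \<exists>w. 0 \<le> w \<and> w \<le> c \<and> \<tau> w = z"
  using IVT'[of \<tau> 0 z c] c_bounds continuous_on_subset[OF cont, of "{0..c}"] by auto

text \<open>The inequality \<open>\<tau> 0 \<le> p\<close> is the point, as it gives the points
  above \<open>p\<close> a preimage on the left branch. If \<open>p < \<tau> 0\<close>, the left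
  branch maps above \<open>p\<close>, and either an interval around \<open>p\<close> or the
  complement of one would be invariant.\<close>

lemma ex_fixed_point: "\<exists>p. c < p \<and> p < 1 \<and> \<tau> p = p \<and> \<tau> 0 \<le> p"
proof -
  have "\<exists>p. c \<le> p \<and> p \<le> 1 \<and> (\<lambda>x. \<tau> x - x) p = 0"
    using c_bounds by (intro IVT2') (simp_all, intro continuous_intros continuous_on_subset[OF cont], auto)
  then obtain p where p: "c \<le> p" "p \<le> 1" "\<tau> p = p" by auto
  have p': "c < p" "p < 1" using p c_bounds \<tau>_c \<tau>_1 by (smt (verit))+
  have "\<tau> 0 \<le> p"
  proof (rule ccontr)
    assume "\<not> \<tau> 0 \<le> p"
    hence 0: "p < \<tau> 0" by simp
    \<comment> \<open>For \<open>p < x < x0\<close> the image \<open>\<tau> x\<close> stays on the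
      right branch, so the second iterate is increasing there.\<close>
    obtain x0 where x0: "c \<le> x0" "x0 \<le> 1" "\<tau> x0 = c" using right_preimage[of c] c_bounds by auto
    have x0': "p < x0" "x0 < 1"
      using x0 p p' c_bounds decr_le[of x0 p] \<tau>_1 by (smt (verit))+
    show False
    proof (cases "\<exists>x. p < x \<and> x < x0 \<and> \<tau> (\<tau> x) < x")
      case True
      then obtain x where x: "p < x" "x < x0" "\<tau> (\<tau> x) < x" by auto
      have tx: "c \<le> \<tau> x" "\<tau> x < p"
        using x x0 x0' p p' decr_le[of x x0] decr[of p x] by (smt (verit))+
      show False
      proof (rule no_invariant[of "{\<tau> x..x}" p x x 1])
        show "\<tau> y \<in> {\<tau> x..x}" if y: "y \<in> {\<tau> x..x}" for y
        proof (cases "y \<le> p")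
          case True
          thus ?thesis using y tx x p p' decr_le[of "\<tau> x" y] decr_le[of y p]
            by (smt (verit) atLeastAtMost_iff)
        next
          case False
          thus ?thesis using y tx x x0 x0' p p' decr_le[of p y] decr_le[of y x]
            by (smt (verit) atLeastAtMost_iff)
        qed
      qed (use x x0' tx p' c_bounds in auto)
    next
      case False
      \<comment> \<open>Being at most \<open>\<tau> 0\<close> makes the left branch map into
        \<open>{x..1}\<close>, and being below \<open>x0\<close> keeps \<open>\<tau> x\<close> on
        the right branch. The set used below omits only an interval around \<open>p\<close>.\<close>
      define x where "x = min ((p + x0) / 2) (\<tau> 0)"
      have x: "p < x" "x < x0" "x \<le> \<tau> 0" using 0 x0' by (auto simp: x_def min_less_iff_disj)
      hence ttx: "x \<le> \<tau> (\<tau> x)" using False by (meson not_less)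
      have tx: "c \<le> \<tau> x" "\<tau> x < p"
        using x x0 x0' p p' decr_le[of x x0] decr[of p x] by (smt (verit))+
      show False
      proof (rule no_invariant[of "{0..\<tau> x} \<union> {x..1}" x 1 "\<tau> x" x])
        show "\<tau> y \<in> {0..\<tau> x} \<union> {x..1}" if y: "y \<in> {0..\<tau> x} \<union> {x..1}" for y
        proof -
          have "x \<le> y \<and> y \<le> 1 \<or> 0 \<le> y \<and> y \<le> c \<or> c \<le> y \<and> y \<le> \<tau> x"
            using y by auto
          thus ?thesis
          proof (elim disjE conjE)
            assume 1: "x \<le> y" "y \<le> 1"
            have "0 \<le> y" "c \<le> x" using 1 x p p' c_bounds by linarith+
            thus ?thesis using 1 decr_le[of x y] range_\<tau>[of y] by auto
          next
            assume 2: "0 \<le> y" "y \<le> c"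
            thus ?thesis using x c_bounds incr_le[of 0 y] range_\<tau>[of y] by (smt (verit) Un_iff atLeastAtMost_iff)
          next
            assume 3: "c \<le> y" "y \<le> \<tau> x"
            thus ?thesis using tx ttx p p' decr_le[of y "\<tau> x"] range_\<tau>[of y] c_bounds
              by (smt (verit) Un_iff atLeastAtMost_iff)
          qed
        qed
      qed (use x x0' tx p' c_bounds in auto)
    qed
  qed
  thus ?thesis using p' p by blast
qed

subsection \<open>Counting preimages\<close>

definition fib :: "nat \<Rightarrow> real \<Rightarrow> real set" where
  "fib n z = {y \<in> I. (\<tau> ^^ n) y = z}"

lemma fib_0: "z \<in> I \<Longrightarrow> fib 0 z = {z}"
  by (auto simp: fib_def)

lemma fib_1: "fib (Suc 0) z = {y \<in> I. \<tau> y = z}"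
  by (simp add: fib_def)

lemma fib_subset: "fib n z \<subseteq> I"
  by (auto simp: fib_def)

lemma fib_Suc: "fib (Suc n) z = (\<Union>w\<in>fib (Suc 0) z. fib n w)"
  by (auto simp: fib_def funpow_I simp del: atLeastAtMost_iff)

lemma fib_add: "fib (m + n) z = (\<Union>w\<in>fib m z. fib n w)"
  by (auto simp: fib_def funpow_I funpow_add simp del: atLeastAtMost_iff)

lemma fib_disjoint: "w \<noteq> w' \<Longrightarrow> fib n w \<inter> fib n w' = {}"
  by (auto simp: fib_def)

lemma \<tau>_inj_left: "inj_on \<tau> {0..c}"
  by (rule linorder_inj_onI) (use incr in fastforce)+

lemma \<tau>_inj_right: "inj_on \<tau> {c..1}"
  by (rule linorder_inj_onI) (use decr in fastforce)+

lemma card_at_most_one: "(\<And>x y. \<lbrakk>x \<in> A; y \<in> A\<rbrakk> \<Longrightarrow> x = y) \<Longrightarrow> finite A \<and> card A \<le> 1"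
  by (metis card.empty card_le_Suc0_iff_eq finite.emptyI finite_insert insertI1 is_singletonI'
      One_nat_def is_singleton_def zero_le)

lemma fib_1_card: "finite (fib (Suc 0) z) \<and> card (fib (Suc 0) z) \<le> 2"
proof -
  let ?A = "{y \<in> {0..c}. \<tau> y = z}" and ?B = "{y \<in> {c..1}. \<tau> y = z}"
  have "fib (Suc 0) z \<subseteq> ?A \<union> ?B" by (auto simp: fib_1)
  moreover have "finite ?A \<and> card ?A \<le> 1"
    by (rule card_at_most_one) (use \<tau>_inj_left in \<open>auto dest: inj_onD\<close>)
  moreover have "finite ?B \<and> card ?B \<le> 1"
    by (rule card_at_most_one) (use \<tau>_inj_right in \<open>auto dest: inj_onD\<close>)
  moreover have "card (?A \<union> ?B) \<le> card ?A + card ?B" by (rule card_Un_le)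
  ultimately show ?thesis
    using card_mono[of "?A \<union> ?B" "fib (Suc 0) z"] finite_subset[of "fib (Suc 0) z" "?A \<union> ?B"]
    by simp
qed

lemma fib_card: "finite (fib n z) \<and> card (fib n z) \<le> 2 ^ n"
proof (induction n arbitrary: z)
  case 0
  have "fib 0 z \<subseteq> {z}" by (auto simp: fib_def)
  thus ?case by (metis card.empty card_mono finite.emptyI finite_insert finite_subset is_singletonI
      is_singleton_altdef power_0)
next
  case (Suc n)
  have fin: "finite (fib (Suc n) z)" using fib_1_card Suc by (subst fib_Suc) auto
  have "card (fib (Suc n) z) \<le> (\<Sum>w\<in>fib (Suc 0) z. card (fib n w))"
    using fib_1_card by (subst fib_Suc) (intro card_UN_le, auto)
  also have "\<dots> \<le> of_nat (card (fib (Suc 0) z)) * 2 ^ n"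
    using Suc by (intro sum_bounded_above) auto
  also have "\<dots> \<le> 2 * 2 ^ n" using fib_1_card[of z] by (intro mult_right_mono) auto
  finally show ?case using fin by simp
qed

lemma fib_finite [simp]: "finite (fib n z)"
  using fib_card by blast

lemma card_fib_add: "card (fib (m + n) z) = (\<Sum>w\<in>fib m z. card (fib n w))"
  unfolding fib_add by (subst card_UN_disjoint) (use fib_disjoint in auto)

text \<open>A point of \<open>(p, 1)\<close> has one preimage on each branch, both inside
  \<open>(0, p)\<close>, and each of these has a preimage in \<open>(p, 1)\<close> again. So two
  steps back at least double the count.\<close>

lemma card_fib_lower: "\<exists>z\<in>I. 2 ^ n \<le> card (fib (2 * n) z)"
proof -
  obtain p where p: "c < p" "p < 1" "\<tau> p = p" "\<tau> 0 \<le> p" using ex_fixed_point by auto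
  have R: "\<exists>w. c \<le> w \<and> w \<le> p \<and> \<tau> w = z" if "p < z" "z < 1" for z
  proof -
    have "0 \<le> z" "z \<le> 1" using that p c_bounds by linarith+
    then obtain w where w: "c \<le> w" "w \<le> 1" "\<tau> w = z" using right_preimage by blast
    hence "w \<le> p" using that p decr_le[of p w] by linarith
    thus ?thesis using w by blast
  qed
  have R': "\<exists>w. p < w \<and> w < 1 \<and> \<tau> w = z" if "0 < z" "z < p" for z
  proof -
    have "0 \<le> z" "z \<le> 1" using that p c_bounds by linarith+
    then obtain w where w: "c \<le> w" "w \<le> 1" "\<tau> w = z" using right_preimage by blast
    have "p < w" using w that p decr_le[of w p] by linarith
    moreover have "w \<noteq> 1" using w that by auto
    ultimately show ?thesis using w by (intro exI[of _ w]) auto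
  qed
  have *: "2 ^ n \<le> card (fib (2 * n) z)" if "p < z" "z < 1" for z
    using that
  proof (induction n arbitrary: z)
    case 0
    thus ?case using p c_bounds by (simp add: fib_0)
  next
    case (Suc n)
    have z: "p < z" "z < 1" using Suc by auto
    obtain l where l: "0 \<le> l" "l \<le> c" "\<tau> l = z" using left_preimage[of z] z p by force
    have l': "0 < l" using l z p by (cases "l = 0") auto
    obtain r where r: "c \<le> r" "r \<le> p" "\<tau> r = z" using R[OF z] by auto
    have r': "r < p" using r z p by (cases "r = p") auto
    have lr: "l \<noteq> r" using l r z by (cases "l = c") auto
    obtain l2 where l2: "p < l2" "l2 < 1" "\<tau> l2 = l" using R'[of l] l l' p by auto
    obtain r2 where r2: "p < r2" "r2 < 1" "\<tau> r2 = r" using R'[of r] r r' c_bounds by auto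
    have sub: "{l2, r2} \<subseteq> fib 2 z" using l2 r2 l r p c_bounds
      by (auto simp: fib_def numeral_2_eq_2)
    have "2 ^ Suc n \<le> card (fib (2 * n) l2) + card (fib (2 * n) r2)"
      using Suc.IH[OF l2(1,2)] Suc.IH[OF r2(1,2)] by simp
    also have "\<dots> = (\<Sum>w\<in>{l2, r2}. card (fib (2 * n) w))"
      using lr l2(3) r2(3) by (subst sum.insert) auto
    also have "\<dots> \<le> (\<Sum>w\<in>fib 2 z. card (fib (2 * n) w))"
      by (rule sum_mono2) (use sub in auto)
    also have "\<dots> = card (fib (2 * Suc n) z)" using card_fib_add[of 2 "2 * n" z]
      by (metis add.commute mult.commute mult_Suc)
    finally show ?case .
  qed
  obtain z where z: "p < z" "z < 1" using p dense by blast
  hence "z \<in> I" using p c_bounds by simp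
  thus ?thesis using *[OF z] by blast
qed

end

section \<open>The eigenmeasure of the transfer operator\<close>

text \<open>The product of intervals is compact, but for an uncountable index set this gives no
  convergent subsequence. A filter finer than \<open>sequentially\<close> takes its place.\<close>

lemma pointwise_cluster_point:
  fixes f :: "nat \<Rightarrow> 'a \<Rightarrow> real"
  assumes f: "\<And>k x. f k x \<in> {0..1}"
  obtains F \<G> where "\<G> \<noteq> bot" "\<G> \<le> sequentially" "\<And>x. ((\<lambda>k. f k x) \<longlongrightarrow> F x) \<G>"
proof -
  let ?K = "PiE UNIV (\<lambda>_. {0..1}) :: ('a \<Rightarrow> real) set"
  have "compactin (product_topology (\<lambda>_::'a. euclidean) UNIV) ?K"
    by (subst compactin_PiE) (simp add: compactin_euclidean_iff)
  hence K: "compact ?K"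
    by (simp only: euclidean_product_topology compactin_euclidean_iff)
  have "filtermap f sequentially \<noteq> bot" by (simp add: filtermap_bot_iff)
  moreover have "eventually (\<lambda>g. g \<in> ?K) (filtermap f sequentially)"
    using f by (simp add: eventually_filtermap PiE_def)
  ultimately obtain F where F: "inf (nhds F) (filtermap f sequentially) \<noteq> bot"
    using K unfolding compact_filter by meson
  define \<G> where "\<G> = inf (filtercomap f (nhds F)) sequentially"
  have "\<G> \<noteq> bot"
  proof
    assume "\<G> = bot"
    hence "eventually (\<lambda>_. False) \<G>" by simp
    then obtain P Q where P: "eventually P (nhds F)" and Q: "eventually Q sequentially"
      and PQ: "\<And>k. P (f k) \<Longrightarrow> Q k \<Longrightarrow> False"
      unfolding \<G>_def eventually_inf eventually_filtercomap by blast
    have "eventually (\<lambda>g. \<not> P g) (filtermap f sequentially)"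
      unfolding eventually_filtermap using Q by eventually_elim (use PQ in blast)
    with P have "eventually (\<lambda>_. False) (inf (nhds F) (filtermap f sequentially))"
      unfolding eventually_inf by blast
    with F show False by (simp add: eventually_False)
  qed
  moreover have "\<G> \<le> sequentially" by (simp add: \<G>_def)
  moreover have "((\<lambda>k. f k x) \<longlongrightarrow> F x) \<G>" for x
  proof -
    have lim: "filterlim f (nhds F) \<G>"
      unfolding \<G>_def by (intro filterlim_mono[OF filterlim_filtercomap order_refl]) simp
    have "continuous_on UNIV (\<lambda>g :: 'a \<Rightarrow> real. g x)"
      by (rule continuous_on_product_coordinates)
    from continuous_on_tendsto_compose[OF this lim] show ?thesis by simp
  qed
  ultimately show ?thesis using that by blast
qed

context transitive_unimodal
begin

section \<open>Growth rate of the preimage counts\<close>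

definition bounded_growth :: "real \<Rightarrow> bool" where
  "bounded_growth t \<longleftrightarrow> 0 \<le> t \<and> (\<exists>C. \<forall>n z. t ^ n * card (fib n z) \<le> C)"

text \<open>A radius of convergence, uniform in \<open>z\<close>, of the series with coefficients
  \<open>card (fib n z)\<close>; its inverse will be the slope of the tent map.\<close>

definition radius :: real where
  "radius = Sup (Collect bounded_growth)"

lemma bounded_growth_half: "bounded_growth (1/2)"
proof -
  have "(1/2) ^ n * real (card (fib n z)) \<le> 1" for n z
  proof -
    have "real (card (fib n z)) \<le> 2 ^ n" using fib_card[of n z] by (metis of_nat_le_iff of_nat_numeral of_nat_power)
    hence "(1/2) ^ n * real (card (fib n z)) \<le> (1/2) ^ n * 2 ^ n" by (intro mult_left_mono) auto
    thus ?thesis by (simp add: power_mult_distrib[symmetric])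
  qed
  thus ?thesis unfolding bounded_growth_def by (intro conjI exI[of _ 1]) auto
qed

text \<open>Along even iterates \<open>card_fib_lower\<close> makes the powers of
  \<open>2 * t\<^sup>2\<close> bounded.\<close>

lemma bounded_growth_le: "bounded_growth t \<Longrightarrow> t \<le> 1 / sqrt 2"
proof -
  assume "bounded_growth t"
  then obtain C where t: "0 \<le> t" and C: "\<And>n z. t ^ n * card (fib n z) \<le> C"
    unfolding bounded_growth_def by auto
  have "(2 * t\<^sup>2) ^ n \<le> C" for n
  proof -
    obtain z where z: "2 ^ n \<le> card (fib (2 * n) z)" using card_fib_lower by blast
    hence "2 ^ n \<le> real (card (fib (2 * n) z))" by (metis of_nat_le_iff of_nat_numeral of_nat_power)
    hence "t ^ (2 * n) * 2 ^ n \<le> t ^ (2 * n) * real (card (fib (2 * n) z))"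
      using t by (intro mult_left_mono) auto
    also have "\<dots> \<le> C" by (rule C)
    finally have "t ^ (2 * n) * 2 ^ n \<le> C" .
    moreover have "t ^ (2 * n) * 2 ^ n = (2 * t\<^sup>2) ^ n"
      unfolding power_mult power_mult_distrib by (rule mult.commute)
    ultimately show ?thesis by simp
  qed
  hence "2 * t\<^sup>2 \<le> 1" using real_arch_pow[of "2 * t\<^sup>2" C] by (meson not_less)
  hence "t\<^sup>2 \<le> (1 / sqrt 2)\<^sup>2" by (simp add: power_divide)
  thus ?thesis by (rule power2_le_imp_le) simp
qed

lemma bdd_growth: "bdd_above (Collect bounded_growth)"
  using bounded_growth_le by (intro bdd_aboveI) auto

lemma radius_ge: "1/2 \<le> radius"
  unfolding radius_def using bounded_growth_half bdd_growth by (intro cSup_upper) auto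

lemma radius_le: "radius \<le> 1 / sqrt 2"
  unfolding radius_def using bounded_growth_half bounded_growth_le by (intro cSup_least) auto

lemma radius_pos: "0 < radius" and radius_lt_1: "radius < 1"
proof -
  show "0 < radius" using radius_ge by linarith
  have "1 / sqrt 2 < 1" by simp
  thus "radius < 1" using radius_le by linarith
qed

lemma bounded_growth_below:
  assumes "0 \<le> t" "t < radius"
  shows "bounded_growth t"
proof -
  obtain t' where t': "bounded_growth t'" "t < t'"
    using assms bounded_growth_half bdd_growth unfolding radius_def
    by (metis emptyE less_cSup_iff mem_Collect_eq)
  then obtain C where C: "\<And>n z. t' ^ n * card (fib n z) \<le> C"
    unfolding bounded_growth_def by auto
  have "t ^ n * card (fib n z) \<le> C" for n z
    using t' assms by (intro order_trans[OF mult_right_mono C] power_mono) auto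
  thus ?thesis using assms unfolding bounded_growth_def by auto
qed

lemma bounded_growth_above: "radius < t \<Longrightarrow> \<not> bounded_growth t"
  unfolding radius_def using bdd_growth by (meson cSup_upper mem_Collect_eq not_less)

section \<open>Resolvents of the dual transfer operator at point masses\<close>

definition res :: "real \<Rightarrow> real \<Rightarrow> real set \<Rightarrow> real" where
  "res t z E = (suminf (\<lambda>n. t ^ n * card (E \<inter> fib n z)))"

lemma res_summable:
  assumes "0 \<le> t" "t < radius"
  shows "summable (\<lambda>n. t ^ n * card (E \<inter> fib n z))"
proof -
  obtain t' where t': "t < t'" "t' < radius" using assms dense by blast
  then obtain C where C: "\<And>n z. t' ^ n * card (fib n z) \<le> C"
    using bounded_growth_below[of t'] assms unfolding bounded_growth_def by auto
  show ?thesis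
  proof (rule summable_comparison_test)
    show "summable (\<lambda>n. C * (t / t') ^ n)"
      using assms t' by (intro summable_mult summable_geometric) auto
    have "norm (t ^ n * card (E \<inter> fib n z)) \<le> C * (t / t') ^ n" for n
    proof -
      have "norm (t ^ n * card (E \<inter> fib n z)) = t ^ n * card (E \<inter> fib n z)" using assms by simp
      also have "\<dots> \<le> t ^ n * card (fib n z)"
        using assms by (intro mult_left_mono) (auto intro!: card_mono)
      also have "\<dots> = (t' ^ n * card (fib n z)) * (t / t') ^ n"
        using assms t' by (simp add: power_divide)
      also have "\<dots> \<le> C * (t / t') ^ n" using assms t' by (intro mult_right_mono C) auto
      finally show ?thesis .
    qed
    thus "\<exists>N. \<forall>n\<ge>N. norm (t ^ n * card (E \<inter> fib n z)) \<le> C * (t / t') ^ n" by blast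
  qed
qed

lemma res_nonneg: "\<lbrakk>0 \<le> t; t < radius\<rbrakk> \<Longrightarrow> 0 \<le> res t z E"
  unfolding res_def by (intro suminf_nonneg res_summable) auto

lemma res_mono: "\<lbrakk>0 \<le> t; t < radius; E \<subseteq> E'\<rbrakk> \<Longrightarrow> res t z E \<le> res t z E'"
  unfolding res_def
  by (intro suminf_le res_summable mult_left_mono) (auto intro!: card_mono)

lemma res_Un:
  assumes "0 \<le> t" "t < radius" "E \<inter> E' = {}"
  shows "res t z (E \<union> E') = res t z E + res t z E'"
proof -
  have "real (card ((E \<union> E') \<inter> fib n z)) = card (E \<inter> fib n z) + card (E' \<inter> fib n z)" for n
  proof -
    have "(E \<inter> fib n z) \<inter> (E' \<inter> fib n z) = {}" using assms(3) by blast
    from card_Un_disjoint[OF _ _ this] show ?thesis by (simp add: Int_Un_distrib2)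
  qed
  thus ?thesis unfolding res_def using suminf_add[OF res_summable res_summable] assms
    by (simp add: distrib_left)
qed

lemma fib_Suc_inter: "E \<inter> fib (Suc n) z = {y \<in> E \<inter> I. \<tau> y \<in> fib n z}"
  using maps_I by (auto simp: fib_def funpow_swap1 simp del: atLeastAtMost_iff)

text \<open>The resolvent identity on one branch: the term of index 0 is the point mass at
  \<open>z\<close>, and injectivity of \<open>\<tau>\<close> on \<open>E\<close> shifts the
  remaining terms.\<close>

lemma res_scale:
  assumes "0 \<le> t" "t < radius" "E \<subseteq> I" "inj_on \<tau> E" "z \<in> I"
  shows "res t z E = of_bool (z \<in> E) + t * res t z (\<tau> ` E)"
proof -
  have card: "card (E \<inter> fib (Suc n) z) = card (\<tau> ` E \<inter> fib n z)" for n
  proof -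
    have "\<tau> ` (E \<inter> fib (Suc n) z) = \<tau> ` E \<inter> fib n z"
      using assms(3) unfolding fib_Suc_inter by auto
    thus ?thesis using card_image[of \<tau> "E \<inter> fib (Suc n) z"] assms(4)
      by (metis inf_le1 inj_on_subset)
  qed
  have "res t z E = (suminf (\<lambda>n. t ^ Suc n * card (E \<inter> fib (Suc n) z))) + card (E \<inter> fib 0 z)"
    using suminf_split_head[OF res_summable[OF assms(1,2), of E z]] by (simp add: res_def)
  also have "(suminf (\<lambda>n. t ^ Suc n * card (E \<inter> fib (Suc n) z))) = t * res t z (\<tau> ` E)"
    unfolding card res_def using suminf_mult[OF res_summable[OF assms(1,2)]] by (simp add: mult.assoc)
  also have "real (card (E \<inter> fib 0 z)) = of_bool (z \<in> E)" using assms(5) by (simp add: fib_0)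
  finally show ?thesis by simp
qed

text \<open>Along the orbit of \<open>x\<close> every step adds at most 1 and contracts by
  \<open>t < radius\<close>. After division by an unbounded total mass a suitable \<open>n\<close>
  makes both terms small, so the limit has no atoms.\<close>

lemma res_point:
  assumes t: "0 \<le> t" "t < radius" and z: "z \<in> I" and x: "x \<in> I"
  shows "res t z {x} \<le> n + radius ^ n * res t z I"
  using x
proof (induction n arbitrary: x)
  case 0
  thus ?case using res_mono[of t "{x}" I z] t by auto
next
  case (Suc n)
  have "res t z {x} = of_bool (z \<in> {x}) + t * res t z {\<tau> x}"
    using res_scale[of t "{x}" z] t z Suc.prems by simp
  also have "\<dots> \<le> 1 + t * res t z {\<tau> x}" by simp
  also have "t * res t z {\<tau> x} \<le> t * (n + radius ^ n * res t z I)"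
    using Suc.IH[OF maps_I[OF Suc.prems]] t by (intro mult_left_mono) auto
  also have "\<dots> = t * n + t * (radius ^ n * res t z I)" by (simp add: distrib_left)
  also have "t * real n \<le> 1 * real n"
    using t radius_lt_1 by (intro mult_right_mono) auto
  also have "t * (radius ^ n * res t z I) \<le> radius * (radius ^ n * res t z I)"
    using t radius_pos res_nonneg[OF t] by (intro mult_right_mono) auto
  finally show ?case by (simp add: algebra_simps)
qed

lemma fib_I: "w \<in> fib n z \<Longrightarrow> w \<in> I"
  using fib_subset by blast

lemma sum_fib_add: "(\<Sum>y\<in>fib (m + n) z. f y) = (\<Sum>w\<in>fib m z. \<Sum>y\<in>fib n w. f y)"
  unfolding fib_add by (subst sum.UNION_disjoint) (use fib_disjoint in auto)

text \<open>A uniform bound on the resolvents up to the critical parameter would make the resolvent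
  at the critical parameter a strict supersolution and hence push the critical parameter up.\<close>

lemma resolvent_blows_up:
  assumes "\<epsilon> > 0"
  shows "\<exists>t z. radius - \<epsilon> < t \<and> 0 < t \<and> t < radius \<and> z \<in> I \<and> K \<le> res t z I"
proof (rule ccontr)
  assume neg: "\<not> ?thesis"
  have inter: "I \<inter> fib n z = fib n z" for n z using fib_subset by blast
  \<comment> \<open>At least 2, so that the contraction factor \<open>q = 1 - 1 / C\<close> below is
    positive.\<close>
  define C where "C = max K 2"
  have C: "2 \<le> C" "K \<le> C" by (auto simp: C_def)
  define a where "a n z = real (card (fib n z))" for n z
  have a0: "0 \<le> a n z" for n z by (simp add: a_def)
  have partial: "(\<Sum>n<N. radius ^ n * a n z) \<le> C" for N z
  proof (cases "z \<in> I")
    case True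
    have "((\<lambda>t. \<Sum>n<N. t ^ n * a n z) \<longlongrightarrow> (\<Sum>n<N. radius ^ n * a n z)) (at_left radius)"
      by (intro tendsto_intros)
    moreover have "eventually (\<lambda>t. t \<in> {max 0 (radius - \<epsilon>)<..<radius}) (at_left radius)"
      using assms radius_pos by (intro eventually_at_left_real) auto
    hence "eventually (\<lambda>t. (\<Sum>n<N. t ^ n * a n z) \<le> C) (at_left radius)"
    proof eventually_elim
      case (elim t)
      hence t: "0 \<le> t" "t < radius" by auto
      have "(\<Sum>n<N. t ^ n * a n z) \<le> res t z I"
        unfolding res_def a_def inter using res_summable[OF t, of I z] t
        by (intro sum_le_suminf) (auto simp: inter)
      also have "\<dots> \<le> K" using neg elim True by (metis greaterThanLessThan_iff max_less_iff_conj linear)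
      also have "K \<le> C" by (rule C)
      finally show ?case .
    qed
    ultimately show ?thesis by (rule tendsto_upperbound) simp
  next
    case False
    hence "fib n z = {}" for n using funpow_I by (auto simp: fib_def)
    thus ?thesis using C by (simp add: a_def)
  qed
  define G where "G z = (suminf (\<lambda>n. radius ^ n * a n z))" for z
  have sm: "summable (\<lambda>n. radius ^ n * a n z)" for z
    using radius_pos a0 partial by (intro summableI_nonneg_bounded[of _ C]) auto
  have G_le: "G z \<le> C" for z unfolding G_def using sm partial by (intro suminf_le_const) auto
  have head: "(suminf (\<lambda>n. radius ^ Suc n * a (Suc n) z)) = G z - 1" if "z \<in> I" for z
    using suminf_split_head[OF sm[of z]] that by (simp add: G_def a_def fib_0)
  have step: "radius * (\<Sum>w\<in>fib (Suc 0) z. G w) = (suminf (\<lambda>n. radius ^ Suc n * a (Suc n) z))" for z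
  proof -
    have "(\<Sum>w\<in>fib (Suc 0) z. G w) = (suminf (\<lambda>n. \<Sum>w\<in>fib (Suc 0) z. radius ^ n * a n w))"
      unfolding G_def by (rule suminf_sum[symmetric]) (rule sm)
    also have "(\<lambda>n. \<Sum>w\<in>fib (Suc 0) z. radius ^ n * a n w) = (\<lambda>n. radius ^ n * a (Suc n) z)"
      using card_fib_add[of "Suc 0" _ z] by (auto simp: a_def sum_distrib_left[symmetric])
    finally have *: "(\<Sum>w\<in>fib (Suc 0) z. G w) = (suminf (\<lambda>n. radius ^ n * a (Suc n) z))" .
    have "summable (\<lambda>n. radius ^ Suc n * a (Suc n) z)" using sm[of z] by (subst summable_Suc_iff)
    hence "summable (\<lambda>n. radius * (radius ^ n * a (Suc n) z))" by (simp add: mult.assoc)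
    hence "summable (\<lambda>n. radius ^ n * a (Suc n) z)"
      using radius_pos by (subst (asm) summable_cmult_iff) auto
    from suminf_mult[OF this, of radius] show ?thesis unfolding * by (simp add: mult.assoc)
  qed
  define q where "q = 1 - 1 / C"
  have q: "0 < q" "q < 1" using C by (auto simp: q_def)
  have G_ge: "1 \<le> G z" if "z \<in> I" for z
  proof -
    have "0 \<le> (suminf (\<lambda>n. radius ^ Suc n * a (Suc n) z))"
      using sm[of z] a0 radius_pos by (intro suminf_nonneg) (subst summable_Suc_iff, auto)
    thus ?thesis using head[OF that] by simp
  qed
  \<comment> \<open>\<open>G\<close> satisfies \<open>radius * L G = G - 1\<close> on the interval,
    and \<open>G \<le> C\<close> turns the subtracted 1 into the fixed proportion
    \<open>G / C\<close>.\<close>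
  have contract: "radius * (\<Sum>w\<in>fib (Suc 0) z. G w) \<le> q * G z" if "z \<in> I" for z
  proof -
    have "G z / C \<le> 1" using G_le[of z] C by simp
    thus ?thesis unfolding step head[OF that] q_def by (simp add: algebra_simps)
  qed
  have iter: "radius ^ n * (\<Sum>w\<in>fib n z. G w) \<le> q ^ n * G z" if "z \<in> I" for n z
  proof (induction n)
    case 0
    thus ?case using that by (simp add: fib_0)
  next
    case (Suc n)
    have "radius ^ Suc n * (\<Sum>w\<in>fib (Suc n) z. G w)
        = radius ^ n * (\<Sum>w\<in>fib n z. radius * (\<Sum>v\<in>fib (Suc 0) w. G v))"
      using sum_fib_add[of G n "Suc 0" z] by (simp add: sum_distrib_left mult_ac)
    also have "\<dots> \<le> radius ^ n * (\<Sum>w\<in>fib n z. q * G w)"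
      using radius_pos by (intro mult_left_mono sum_mono contract) (erule fib_I, simp)
    also have "\<dots> = q * (radius ^ n * (\<Sum>w\<in>fib n z. G w))" by (simp add: sum_distrib_left mult_ac)
    also have "\<dots> \<le> q * (q ^ n * G z)" using Suc q by (intro mult_left_mono) auto
    finally show ?case by simp
  qed
  \<comment> \<open>Since \<open>1 \<le> G \<le> C\<close>, the factor \<open>q ^ n\<close> gained
    by iteration can be moved to the other side, which bounds the growth at a parameter beyond the
    supremum.\<close>
  have "(radius / q) ^ n * card (fib n z) \<le> C" for n z
  proof (cases "z \<in> I")
    case True
    have "radius ^ n * card (fib n z) = radius ^ n * (\<Sum>w\<in>fib n z. 1)" by simp
    also have "\<dots> \<le> radius ^ n * (\<Sum>w\<in>fib n z. G w)"
      using radius_pos by (intro mult_left_mono sum_mono G_ge) (erule fib_I, simp)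
    also have "\<dots> \<le> q ^ n * G z" by (rule iter[OF True])
    also have "\<dots> \<le> q ^ n * C" using q G_le by (intro mult_left_mono) auto
    finally show ?thesis using q by (simp add: power_divide field_simps)
  next
    case False
    hence "fib n z = {}" using funpow_I by (auto simp: fib_def)
    thus ?thesis using C by simp
  qed
  hence "bounded_growth (radius / q)"
    unfolding bounded_growth_def using radius_pos q by (intro conjI exI[of _ C]) auto
  moreover have "radius < radius / q" using q radius_pos by (simp add: field_simps)
  ultimately show False using bounded_growth_above by blast
qed

text \<open>\<open>F\<close> is the distribution function of a cluster point of the normalised
  resolvent measures. Division by the total mass removes the point mass from
  \<open>res_scale\<close>, and what remains says that each branch multiplies the measure by
  \<open>1 / radius\<close>.\<close>

lemma ex_scaling_function:
  "\<exists>F. F 0 = 0 \<and> F 1 = 1 \<and> (\<forall>x y. 0 \<le> x \<and> x \<le> y \<and> y \<le> 1 \<longrightarrow> F x \<le> F y)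
     \<and> (\<forall>x y. 0 \<le> x \<and> x \<le> y \<and> y \<le> c \<longrightarrow> F y - F x = radius * (F (\<tau> y) - F (\<tau> x)))
     \<and> (\<forall>x y. c \<le> x \<and> x \<le> y \<and> y \<le> 1 \<longrightarrow> F y - F x = radius * (F (\<tau> x) - F (\<tau> y)))"
proof -
  have "\<forall>k. \<exists>t z. radius - 1 / (real k + 1) < t \<and> 0 < t \<and> t < radius \<and> z \<in> I \<and> real k + 1 \<le> res t z I"
    by (intro allI resolvent_blows_up) auto
  then obtain t z where tz: "\<And>k. radius - 1 / (real k + 1) < t k" "\<And>k. 0 < t k" "\<And>k. t k < radius"
      "\<And>k. z k \<in> I" "\<And>k. real k + 1 \<le> res (t k) (z k) I"
    by metis
  have t0: "0 \<le> t k" for k using tz(2)[of k] by simp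
  note tr = t0 tz(3)
  define R where "R k = res (t k) (z k) I" for k
  have R: "real k + 1 \<le> R k" "0 < R k" for k
    using tz(5)[of k] by (auto simp: R_def intro: less_le_trans[of 0 "real k + 1"])
  define \<mu> where "\<mu> k E = res (t k) (z k) E / R k" for k E
  have \<mu>_mono: "\<mu> k E \<le> \<mu> k E'" if "E \<subseteq> E'" for k E E'
    unfolding \<mu>_def using that R(2)[of k] by (intro divide_right_mono res_mono tr) auto
  have \<mu>_nonneg: "0 \<le> \<mu> k E" for k E
    unfolding \<mu>_def using R(2)[of k] res_nonneg[OF tr] by auto
  have \<mu>_I: "\<mu> k I = 1" for k using R(2)[of k] by (simp add: \<mu>_def R_def)
  have \<mu>_Un: "\<mu> k (E \<union> E') = \<mu> k E + \<mu> k E'" if "E \<inter> E' = {}" for k E E'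
    unfolding \<mu>_def res_Un[OF tr that] by (simp add: add_divide_distrib)
  have \<mu>_scale: "\<bar>\<mu> k E - t k * \<mu> k (\<tau> ` E)\<bar> \<le> 1 / R k" if "E \<subseteq> I" "inj_on \<tau> E" for k E
    unfolding \<mu>_def res_scale[OF tr that tz(4)] using R(2)[of k] by (simp add: add_divide_distrib)
  define f where "f k x = \<mu> k ({0..x} \<inter> I)" for k x
  have "f k x \<in> {0..1}" for k x
    using \<mu>_nonneg \<mu>_mono[of "{0..x} \<inter> I" I k] \<mu>_I unfolding f_def by auto
  then obtain \<G> F where \<G>: "\<G> \<noteq> bot" "\<G> \<le> sequentially" and F: "\<And>x. ((\<lambda>k. f k x) \<longlongrightarrow> F x) \<G>"
    by (rule pointwise_cluster_point[of f]) blast+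
  have inv0: "(\<lambda>k. 1 / (real k + 1)) \<longlonglongrightarrow> 0"
    using LIMSEQ_inverse_real_of_nat by (simp add: inverse_eq_divide add.commute)
  have Rinv: "((\<lambda>k. 1 / R k) \<longlongrightarrow> 0) sequentially"
  proof (rule tendsto_sandwich[of "\<lambda>_. 0" _ _ "\<lambda>k. 1 / (real k + 1)"])
    show "(\<lambda>k. 1 / (real k + 1)) \<longlonglongrightarrow> 0" by (rule inv0)
    show "\<forall>\<^sub>F k in sequentially. 1 / R k \<le> 1 / (real k + 1)"
      using R by (intro always_eventually allI divide_left_mono) (auto intro!: mult_pos_pos add_nonneg_pos)
    show "\<forall>\<^sub>F k in sequentially. 0 \<le> 1 / R k" using R(2) by (intro always_eventually) (auto intro: less_imp_le)
  qed simp
  have tlim: "t \<longlonglongrightarrow> radius"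
  proof (rule tendsto_sandwich[of "\<lambda>k. radius - 1 / (real k + 1)" _ _ "\<lambda>_. radius"])
    have "(\<lambda>k. radius - 1 / (real k + 1)) \<longlonglongrightarrow> radius - 0"
      by (intro tendsto_diff tendsto_const inv0)
    thus "(\<lambda>k. radius - 1 / (real k + 1)) \<longlonglongrightarrow> radius" by simp
  qed (use tz(1,3) in \<open>auto intro!: always_eventually less_imp_le\<close>)
  \<comment> \<open>First \<open>n\<close> makes \<open>radius ^ n\<close> small, then large
    \<open>k\<close> makes \<open>n / R k\<close> small.\<close>
  have point: "(\<lambda>k. \<mu> k {x}) \<longlonglongrightarrow> 0" if x: "x \<in> I" for x
  proof (rule LIMSEQ_I)
    fix e :: real assume e: "0 < e"
    obtain n where n: "radius ^ n < e / 2"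
      using real_arch_pow_inv[of "e / 2" radius] e radius_lt_1 by auto
    have "(\<lambda>k. real n * (1 / R k)) \<longlonglongrightarrow> real n * 0" by (intro tendsto_mult tendsto_const Rinv)
    hence "eventually (\<lambda>k. n * (1 / R k) < e / 2) sequentially"
      using e by (intro order_tendstoD(2)) auto
    then obtain N where N: "\<And>k. k \<ge> N \<Longrightarrow> n * (1 / R k) < e / 2"
      unfolding eventually_sequentially by blast
    have "norm (\<mu> k {x} - 0) < e" if "k \<ge> N" for k
    proof -
      have "\<mu> k {x} \<le> (n + radius ^ n * R k) / R k"
      proof -
        have "res (t k) (z k) {x} \<le> n + radius ^ n * R k"
          unfolding R_def by (rule res_point[OF tr tz(4) x])
        thus ?thesis unfolding \<mu>_def by (rule divide_right_mono[OF _ less_imp_le[OF R(2)]])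
      qed
      also have "\<dots> = n * (1 / R k) + radius ^ n" using R(2)[of k] by (simp add: add_divide_distrib)
      also have "\<dots> < e" using N[OF that] n by linarith
      finally show ?thesis using \<mu>_nonneg[of k "{x}"] by simp
    qed
    thus "\<exists>N. \<forall>k\<ge>N. norm (\<mu> k {x} - 0) < e" by blast
  qed
  have lim: "(g \<longlongrightarrow> l) \<G>" if "g \<longlonglongrightarrow> l" for g :: "nat \<Rightarrow> real" and l
    using filterlim_mono[OF that order_refl \<G>(2)] .
  have diff: "f k y - f k x = \<mu> k {x<..y}" if "0 \<le> x" "x \<le> y" "y \<le> 1" for k x y
  proof -
    have "{0..y} \<inter> I = ({0..x} \<inter> I) \<union> {x<..y}" using that by auto
    moreover have "\<mu> k (({0..x} \<inter> I) \<union> {x<..y}) = \<mu> k ({0..x} \<inter> I) + \<mu> k {x<..y}"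
      by (rule \<mu>_Un) auto
    ultimately show ?thesis unfolding f_def by simp
  qed
  \<comment> \<open>For the decreasing branch: it turns \<open>{x..<y}\<close> into an interval open
    on the left and closed on the right, the kind measured by \<open>diff\<close>. The two
    correcting atoms vanish in the limit.\<close>
  have diff': "f k y - f k x = \<mu> k {x..<y} + \<mu> k {y} - \<mu> k {x}" if "0 \<le> x" "x \<le> y" "y \<le> 1" for k x y
  proof -
    have "\<mu> k {x} + \<mu> k {x<..y} = \<mu> k ({x} \<union> {x<..y})" by (rule \<mu>_Un[symmetric]) auto
    also have "{x} \<union> {x<..y} = {x..<y} \<union> {y}" using that by auto
    also have "\<mu> k \<dots> = \<mu> k {x..<y} + \<mu> k {y}" by (rule \<mu>_Un) auto
    finally show ?thesis using diff[OF that, of k] by simp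
  qed
  have image1: "\<tau> ` {x<..y} = {\<tau> x<..\<tau> y}" if "0 \<le> x" "x \<le> y" "y \<le> c" for x y
  proof (intro equalityI subsetI)
    fix v assume "v \<in> \<tau> ` {x<..y}"
    thus "v \<in> {\<tau> x<..\<tau> y}" using that incr incr_le by auto
  next
    fix v assume v: "v \<in> {\<tau> x<..\<tau> y}"
    have "continuous_on {x..y} \<tau>" using that c_bounds by (intro continuous_on_subset[OF cont]) auto
    hence "\<exists>w\<ge>x. w \<le> y \<and> \<tau> w = v" by (intro IVT') (use v that in auto)
    then obtain w where w: "x \<le> w" "w \<le> y" "\<tau> w = v" by blast
    thus "v \<in> \<tau> ` {x<..y}" using v by (cases "w = x") auto
  qed
  have image2: "\<tau> ` {x..<y} = {\<tau> y<..\<tau> x}" if "c \<le> x" "x \<le> y" "y \<le> 1" for x y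
  proof (intro equalityI subsetI)
    fix v assume "v \<in> \<tau> ` {x..<y}"
    thus "v \<in> {\<tau> y<..\<tau> x}" using that decr decr_le by auto
  next
    fix v assume v: "v \<in> {\<tau> y<..\<tau> x}"
    have "continuous_on {x..y} \<tau>" using that c_bounds by (intro continuous_on_subset[OF cont]) auto
    hence "\<exists>w\<ge>x. w \<le> y \<and> \<tau> w = v" by (intro IVT2') (use v that in auto)
    then obtain w where w: "x \<le> w" "w \<le> y" "\<tau> w = v" by blast
    thus "v \<in> \<tau> ` {x..<y}" using v by (cases "w = y") auto
  qed
  have scale_lim: "((\<lambda>k. \<mu> k E - t k * \<mu> k (\<tau> ` E)) \<longlongrightarrow> 0) \<G>" if "E \<subseteq> I" "inj_on \<tau> E" for E
    using \<mu>_scale[OF that] by (intro Lim_null_comparison[OF _ lim[OF Rinv]] always_eventually) auto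
  show ?thesis
  proof (intro exI[of _ F] conjI allI impI)
    have "F 0 = 0"
    proof (rule tendsto_unique[OF \<G>(1) F])
      have "(\<lambda>k. f k 0) = (\<lambda>k. \<mu> k {0})" by (simp add: f_def)
      thus "((\<lambda>k. f k 0) \<longlongrightarrow> 0) \<G>" using lim[OF point[of 0]] by simp
    qed
    thus "F 0 = 0" .
    show "F 1 = 1"
    proof (rule tendsto_unique[OF \<G>(1) F])
      show "((\<lambda>k. f k 1) \<longlongrightarrow> 1) \<G>" by (simp add: f_def \<mu>_I)
    qed
  next
    fix x y :: real assume xy: "0 \<le> x \<and> x \<le> y \<and> y \<le> 1"
    show "F x \<le> F y"
      by (rule tendsto_le[OF \<G>(1) F F]) (use xy in \<open>auto simp: f_def intro!: always_eventually \<mu>_mono\<close>)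
  next
    fix x y :: real assume xy: "0 \<le> x \<and> x \<le> y \<and> y \<le> c"
    hence E: "{x<..y} \<subseteq> I" "inj_on \<tau> {x<..y}"
      using c_bounds by (auto intro: inj_on_subset[OF \<tau>_inj_left])
    have tt: "0 \<le> \<tau> x" "\<tau> x \<le> \<tau> y" "\<tau> y \<le> 1"
      using xy c_bounds incr_le[of x y] range_\<tau>[of x] range_\<tau>[of y] by auto
    have "((\<lambda>k. (f k y - f k x) - t k * (f k (\<tau> y) - f k (\<tau> x)))
        \<longlongrightarrow> (F y - F x) - radius * (F (\<tau> y) - F (\<tau> x))) \<G>"
      by (intro tendsto_intros F lim[OF tlim])
    moreover have "(\<lambda>k. (f k y - f k x) - t k * (f k (\<tau> y) - f k (\<tau> x)))
        = (\<lambda>k. \<mu> k {x<..y} - t k * \<mu> k (\<tau> ` {x<..y}))"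
      using xy c_bounds tt by (simp add: diff image1)
    ultimately have "(F y - F x) - radius * (F (\<tau> y) - F (\<tau> x)) = 0"
      using tendsto_unique[OF \<G>(1) _ scale_lim[OF E]] by (simp only: diff_0_right add_0_right)
    thus "F y - F x = radius * (F (\<tau> y) - F (\<tau> x))" by simp
  next
    fix x y :: real assume xy: "c \<le> x \<and> x \<le> y \<and> y \<le> 1"
    hence E: "{x..<y} \<subseteq> I" "inj_on \<tau> {x..<y}"
      using c_bounds by (auto intro: inj_on_subset[OF \<tau>_inj_right])
    have tt: "0 \<le> \<tau> y" "\<tau> y \<le> \<tau> x" "\<tau> x \<le> 1"
      using xy c_bounds decr_le[of x y] range_\<tau>[of x] range_\<tau>[of y] by auto
    have xyI: "0 \<le> x" "x \<le> y" "y \<le> 1" "x \<in> I" "y \<in> I" using xy c_bounds by auto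
    have "((\<lambda>k. ((f k y - f k x) - \<mu> k {y} + \<mu> k {x}) - t k * (f k (\<tau> x) - f k (\<tau> y)))
        \<longlongrightarrow> ((F y - F x) - 0 + 0) - radius * (F (\<tau> x) - F (\<tau> y))) \<G>"
      by (intro tendsto_intros F lim[OF tlim] lim[OF point] xyI)
    moreover have "(\<lambda>k. ((f k y - f k x) - \<mu> k {y} + \<mu> k {x}) - t k * (f k (\<tau> x) - f k (\<tau> y)))
        = (\<lambda>k. \<mu> k {x..<y} - t k * \<mu> k (\<tau> ` {x..<y}))"
      using xy xyI tt by (simp add: diff'[OF xyI(1,2,3)] diff[OF tt] image2)
    ultimately have "(F y - F x) - radius * (F (\<tau> x) - F (\<tau> y)) = 0"
      using tendsto_unique[OF \<G>(1) _ scale_lim[OF E]] by (simp only: diff_0_right add_0_right)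
    thus "F y - F x = radius * (F (\<tau> x) - F (\<tau> y))" by simp
  qed
qed

end

section \<open>Conjugacy with the tent map\<close>

context transitive_unimodal
begin

definition slope :: real where
  "slope = 1 / radius"

lemma radius_slope: "radius = 1 / slope" "radius * slope = 1" "slope * radius = 1"
  using radius_pos by (auto simp: slope_def)

lemma slope_bounds: "sqrt 2 \<le> slope" "slope \<le> 2" "1 < slope"
proof -
  have "1 / (1 / sqrt 2) \<le> 1 / radius" using radius_pos radius_le by (intro divide_left_mono) auto
  thus "sqrt 2 \<le> slope" by (simp add: slope_def)
  show "slope \<le> 2" using radius_pos radius_ge by (simp add: slope_def field_simps)
  show "1 < slope" using radius_pos radius_lt_1 by (simp add: slope_def)
qed

definition F :: "real \<Rightarrow> real" where
  "F = (SOME F. F 0 = 0 \<and> F 1 = 1 \<and> (\<forall>x y. 0 \<le> x \<and> x \<le> y \<and> y \<le> 1 \<longrightarrow> F x \<le> F y)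
     \<and> (\<forall>x y. 0 \<le> x \<and> x \<le> y \<and> y \<le> c \<longrightarrow> F y - F x = radius * (F (\<tau> y) - F (\<tau> x)))
     \<and> (\<forall>x y. c \<le> x \<and> x \<le> y \<and> y \<le> 1 \<longrightarrow> F y - F x = radius * (F (\<tau> x) - F (\<tau> y))))"

lemma F_0 [simp]: "F 0 = 0" and F_1 [simp]: "F 1 = 1"
  and F_mono: "\<lbrakk>0 \<le> x; x \<le> y; y \<le> 1\<rbrakk> \<Longrightarrow> F x \<le> F y"
  and F_left: "\<lbrakk>0 \<le> x; x \<le> y; y \<le> c\<rbrakk> \<Longrightarrow> F y - F x = radius * (F (\<tau> y) - F (\<tau> x))"
  and F_right: "\<lbrakk>c \<le> x; x \<le> y; y \<le> 1\<rbrakk> \<Longrightarrow> F y - F x = radius * (F (\<tau> x) - F (\<tau> y))"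
  using someI_ex[OF ex_scaling_function] unfolding F_def[symmetric] by auto

lemma F_c: "F c = 1 - 1 / slope"
  using F_right[of c 1] c_bounds by (simp add: radius_slope)

lemma F_\<tau>: "x \<in> I \<Longrightarrow> F (\<tau> x) = 1 - slope * \<bar>F x - F c\<bar>"
proof (cases "x \<le> c")
  case True
  assume "x \<in> I"
  hence "F c - F x = radius * (1 - F (\<tau> x))" "F x \<le> F c"
    using True F_left[of x c] F_mono[of x c] c_bounds by auto
  hence "slope * \<bar>F x - F c\<bar> = (slope * radius) * (1 - F (\<tau> x))" by (simp add: mult.assoc)
  thus ?thesis unfolding radius_slope(3) by simp
next
  case False
  assume "x \<in> I"
  hence "F x - F c = radius * (1 - F (\<tau> x))" "F c \<le> F x"
    using False F_right[of c x] F_mono[of c x] c_bounds by auto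
  hence "slope * \<bar>F x - F c\<bar> = (slope * radius) * (1 - F (\<tau> x))" by (simp add: mult.assoc)
  thus ?thesis unfolding radius_slope(3) by simp
qed

lemma F_same_side:
  assumes "x \<in> I" "y \<in> I" "x \<le> c \<and> y \<le> c \<or> c \<le> x \<and> c \<le> y"
  shows "\<bar>F y - F x\<bar> = radius * \<bar>F (\<tau> y) - F (\<tau> x)\<bar>"
proof -
  have "\<bar>F y - F x\<bar> = radius * \<bar>F (\<tau> y) - F (\<tau> x)\<bar>"
    if "x \<in> I" "y \<in> I" "x \<le> c \<and> y \<le> c \<or> c \<le> x \<and> c \<le> y" "x \<le> y" for x y
  proof (cases "y \<le> c")
    case True
    hence "F y - F x = radius * (F (\<tau> y) - F (\<tau> x))" using that F_left[of x y] by auto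
    thus ?thesis using radius_pos by (simp add: abs_mult)
  next
    case False
    hence "F y - F x = radius * (F (\<tau> x) - F (\<tau> y))" using that F_right[of x y] by auto
    thus ?thesis using radius_pos by (simp add: abs_mult abs_minus_commute)
  qed
  from this[of x y] this[of y x] assms show ?thesis
    by (cases "x \<le> y") (auto simp: abs_minus_commute)
qed

text \<open>Differences of \<open>F\<close> are at most 1, and each step back along the orbit of
  \<open>x\<close> contracts them by \<open>radius\<close>, provided that the nearby point shares a
  branch with \<open>x\<close>. As \<open>n\<close> is arbitrary, this gives continuity.\<close>

lemma F_oscillation:
  "x \<in> I \<Longrightarrow> \<exists>\<delta>>0. \<forall>y\<in>I. \<bar>y - x\<bar> < \<delta> \<longrightarrow> \<bar>F y - F x\<bar> \<le> radius ^ n"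
proof (induction n arbitrary: x)
  case 0
  have "\<bar>F y - F x\<bar> \<le> 1" if "y \<in> I" for y
    using that 0 F_mono[of 0 x] F_mono[of x 1] F_mono[of 0 y] F_mono[of y 1] by auto
  thus ?case by (intro exI[of _ 1]) auto
next
  case (Suc n)
  obtain \<delta> where \<delta>: "\<delta> > 0" "\<And>y. y \<in> I \<Longrightarrow> \<bar>y - \<tau> x\<bar> < \<delta> \<Longrightarrow> \<bar>F y - F (\<tau> x)\<bar> \<le> radius ^ n"
    using Suc.IH[OF maps_I[OF Suc.prems]] by blast
  obtain d where d: "d > 0" "\<And>y. y \<in> I \<Longrightarrow> \<bar>y - x\<bar> < d \<Longrightarrow> \<bar>\<tau> y - \<tau> x\<bar> < \<delta>"
    using cont \<delta>(1) Suc.prems unfolding continuous_on_iff dist_real_def by metis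
  \<comment> \<open>A small neighbourhood of \<open>x \<noteq> c\<close> stays on one side of
    \<open>c\<close>; for \<open>x = c\<close> every point shares a branch with \<open>x\<close>, so
    any positive value works.\<close>
  define e where "e = (if x = c then 1 else \<bar>x - c\<bar>)"
  have e: "e > 0" by (auto simp: e_def)
  have side: "x \<le> c \<and> y \<le> c \<or> c \<le> x \<and> c \<le> y" if "\<bar>y - x\<bar> < e" for y
    using that by (cases "x = c") (auto simp: e_def split: if_splits)
  have "\<bar>F y - F x\<bar> \<le> radius ^ Suc n" if "y \<in> I" "\<bar>y - x\<bar> < min d e" for y
  proof -
    have "\<bar>F y - F x\<bar> = radius * \<bar>F (\<tau> y) - F (\<tau> x)\<bar>"
      using that Suc.prems side[of y] by (intro F_same_side) auto
    also have "\<dots> \<le> radius * radius ^ n"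
      using that radius_pos d \<delta>(2)[OF maps_I[OF that(1)]] by (intro mult_left_mono) auto
    finally show ?thesis by simp
  qed
  thus ?case using d e by (intro exI[of _ "min d e"]) auto
qed

lemma F_continuous: "continuous_on I F"
  unfolding continuous_on_iff dist_real_def
proof (intro ballI allI impI)
  fix x e :: real assume x: "x \<in> I" and e: "0 < e"
  obtain n where "radius ^ n < e" using real_arch_pow_inv[OF e radius_lt_1] by blast
  with F_oscillation[OF x, of n] show "\<exists>d>0. \<forall>y\<in>I. \<bar>y - x\<bar> < d \<longrightarrow> \<bar>F y - F x\<bar> < e"
    by (meson le_less_trans)
qed

lemma F_surj: "u \<in> I \<Longrightarrow> \<exists>x\<in>I. F x = u"
  using IVT'[of F 0 u 1] F_continuous by auto

lemma F_funpow: "x \<in> I \<Longrightarrow> F ((\<tau> ^^ n) x) = ((\<lambda>u. 1 - slope * \<bar>u - F c\<bar>) ^^ n) (F x)"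
  by (induction n) (use F_\<tau> funpow_I in auto)

text \<open>If \<open>F\<close> were constant on an interval, the value would be periodic under the
  tent map, because the interval meets itself again. All images of the interval would then take only
  finitely many values under \<open>F\<close>, against transitivity and surjectivity of
  \<open>F\<close>.\<close>

lemma F_strict:
  assumes "0 \<le> x" "x < y" "y \<le> 1"
  shows "F x < F y"
proof (rule ccontr)
  assume "\<not> F x < F y"
  hence eq: "F y = F x" using F_mono[of x y] assms by auto
  define v where "v = F x"
  define T where "T = (\<lambda>u. 1 - slope * \<bar>u - F c\<bar>)"
  have const: "F w = v" if "x \<le> w" "w \<le> y" for w
    using that assms eq F_mono[of x w] F_mono[of w y] by (auto simp: v_def)
  \<comment> \<open>Passing from the left half to the right half excludes the return time 0.\<close>
  define m where "m = (x + y) / 2"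
  have m: "x < m" "m < y" using assms by (auto simp: m_def)
  have U: "openin (top_of_set I) {x<..<m}" "{x<..<m} \<noteq> {}"
    and V: "openin (top_of_set I) {m<..<y}" "{m<..<y} \<noteq> {}"
    using m assms by (auto intro!: open_subset subsetI)
  obtain n where "(\<tau> ^^ n) ` {x<..<m} \<inter> {m<..<y} \<noteq> {}"
    using transitive U V unfolding transitive_def by meson
  then obtain w where w: "w \<in> {x<..<m}" "(\<tau> ^^ n) w \<in> {m<..<y}" by blast
  have n: "n > 0" using w by (cases n) auto
  have wI: "w \<in> I" using w m assms by auto
  have per: "(T ^^ n) v = v"
    using F_funpow[OF wI, of n] const[of w] const[of "(\<tau> ^^ n) w"] w m by (simp add: T_def)
  define Q where "Q = (\<lambda>k. (T ^^ k) v) ` {..<n}"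
  have Q: "(T ^^ k) v \<in> Q" for k
    using funpow_mod_eq[OF per, of k] n unfolding Q_def by (metis imageI lessThan_iff mod_less_divisor)
  have "finite Q" by (simp add: Q_def)
  moreover have "infinite I" by (simp add: infinite_Icc)
  ultimately obtain u where u: "u \<in> I" "u \<notin> Q" by (meson finite_subset subsetI)
  then obtain z where z: "z \<in> I" "F z = u" using F_surj by blast
  have "openin (top_of_set I) (I \<inter> F -` (- Q))"
    using \<open>finite Q\<close> by (intro continuous_openin_preimage_gen F_continuous) (simp add: open_Compl finite_imp_closed)
  moreover have "I \<inter> F -` (- Q) \<noteq> {}" using z u by auto
  ultimately obtain k where "(\<tau> ^^ k) ` {x<..<m} \<inter> (I \<inter> F -` (- Q)) \<noteq> {}"
    using transitive U unfolding transitive_def by meson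
  then obtain w where w: "w \<in> {x<..<m}" "F ((\<tau> ^^ k) w) \<notin> Q" by blast
  have "w \<in> I" using w m assms by auto
  from F_funpow[OF this, of k] const[of w] w m have "F ((\<tau> ^^ k) w) = (T ^^ k) v" by (simp add: T_def)
  with Q[of k] w show False by simp
qed

lemma F_less_iff: "\<lbrakk>x \<in> I; y \<in> I\<rbrakk> \<Longrightarrow> F x < F y \<longleftrightarrow> x < y"
  using F_strict[of x y] F_mono[of y x] by (cases "x < y") auto

lemma F_eq_iff: "\<lbrakk>x \<in> I; y \<in> I\<rbrakk> \<Longrightarrow> F x = F y \<longleftrightarrow> x = y"
  using F_less_iff[of x y] F_less_iff[of y x] by (cases x y rule: linorder_cases) auto

lemma F_I: "x \<in> I \<Longrightarrow> F x \<in> I"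
  using F_mono[of 0 x] F_mono[of x 1] by auto

lemma F_homeomorphism: "\<exists>k. homeomorphism I I F k"
proof (rule homeomorphism_compact)
  show "F ` I = I" using F_I F_surj by blast
  show "inj_on F I" by (rule inj_onI) (use F_eq_iff in blast)
qed (use F_continuous in auto)

lemma conjugate_tent: "conjugate_on I \<tau> (restricted_tent slope)"
proof -
  have "F (\<tau> x) = restricted_tent slope (F x)" if "x \<in> I" for x
  proof -
    have "1 - s * \<bar>u - a\<bar> = (if u \<le> a then 1 + s * (u - a) else 1 - s * (u - a))" for s u a :: real
      by (auto simp: abs_if algebra_simps)
    thus ?thesis unfolding F_\<tau>[OF that] restricted_tent_def Let_def F_c by simp
  qed
  thus ?thesis using F_homeomorphism unfolding conjugate_on_def by blast
qed

end

section \<open>Topological entropy\<close>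

lemma card_image_factor:
  assumes "\<And>x y. \<lbrakk>x \<in> A; y \<in> A; g x = g y\<rbrakk> \<Longrightarrow> f x = f y" "finite (g ` A)"
  shows "finite (f ` A)" "card (f ` A) \<le> card (g ` A)"
proof -
  have "f x = f (SOME y. y \<in> A \<and> g y = g x)" if "x \<in> A" for x
  proof -
    have "(SOME y. y \<in> A \<and> g y = g x) \<in> A \<and> g (SOME y. y \<in> A \<and> g y = g x) = g x"
      by (rule someI[of _ x]) (use that in simp)
    thus ?thesis using assms(1) that by metis
  qed
  hence "f ` A = (\<lambda>u. f (SOME y. y \<in> A \<and> g y = u)) ` g ` A" by (force simp: image_image)
  thus "finite (f ` A)" "card (f ` A) \<le> card (g ` A)"
    using assms(2) by (auto intro: card_image_le)
qed

lemma ereal_le_if_all_above: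
  fixes h :: ereal
  assumes "\<And>q. a < q \<Longrightarrow> h \<le> ereal q"
  shows "h \<le> ereal a"
proof (rule ccontr)
  assume "\<not> h \<le> ereal a"
  then obtain q where "ereal a < ereal q" "ereal q < h"
    by (meson ereal_dense2 not_le)
  with assms[of q] show False by auto
qed

lemma ereal_ge_if_all_below:
  fixes h :: ereal
  assumes "\<And>q. q < a \<Longrightarrow> ereal q \<le> h"
  shows "ereal a \<le> h"
proof (rule ccontr)
  assume "\<not> ereal a \<le> h"
  then obtain q where "h < ereal q" "ereal q < ereal a"
    by (meson ereal_dense2 not_le)
  with assms[of q] show False by auto
qed

context transitive_unimodal
begin

section \<open>Upper bound of the entropy by counting cuts\<close>

lemma continuous_funpow: "continuous_on I (\<tau> ^^ n)"
proof (induction n)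
  case (Suc n)
  have "(\<tau> ^^ n) ` I \<subseteq> I" using funpow_I by blast
  hence "continuous_on I (\<tau> \<circ> (\<tau> ^^ n))"
    using Suc by (intro continuous_on_compose continuous_on_subset[OF cont]) auto
  thus ?case by simp
qed (simp add: id_def)

definition cuts :: "nat \<Rightarrow> nat \<Rightarrow> real set" where
  "cuts K n = (\<Union>i<n. \<Union>j\<le>K. fib i (real j / real K))"

lemma finite_cuts: "finite (cuts K n)"
  by (simp add: cuts_def)

text \<open>By the intermediate value theorem the floor can change only across a preimage of a grid
  point, and \<open>cuts K n\<close> contains all of these.\<close>

lemma floor_funpow_eq:
  assumes "K > 0" "i < n" "0 \<le> x" "x \<le> y" "y \<le> 1" "cuts K n \<inter> {x..y} = {}"
  shows "\<lfloor>K * (\<tau> ^^ i) x\<rfloor> = \<lfloor>K * (\<tau> ^^ i) y\<rfloor>"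
proof -
  have False if uv: "u \<in> {x..y}" "v \<in> {x..y}"
    and less: "\<lfloor>K * (\<tau> ^^ i) u\<rfloor> < \<lfloor>K * (\<tau> ^^ i) v\<rfloor>" for u v
  proof -
    define j where "j = nat \<lfloor>K * (\<tau> ^^ i) v\<rfloor>"
    have I: "0 \<le> (\<tau> ^^ i) u" "(\<tau> ^^ i) v \<le> 1" "0 \<le> (\<tau> ^^ i) v"
      using funpow_I[of u i] funpow_I[of v i] uv assms by auto
    have j: "real j = of_int \<lfloor>K * (\<tau> ^^ i) v\<rfloor>" using I by (simp add: j_def)
    have "K * (\<tau> ^^ i) u \<le> real j" "real j \<le> K * (\<tau> ^^ i) v"
      using less unfolding j by linarith+
    note uv_j = this
    have "K * (\<tau> ^^ i) v \<le> real K * 1" using I by (intro mult_left_mono) auto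
    hence jK1: "j \<le> K" using uv_j by linarith
    have jK2: "real j / K \<in> {(\<tau> ^^ i) u..(\<tau> ^^ i) v}"
      using assms(1) uv_j by (simp add: pos_le_divide_eq pos_divide_le_eq mult.commute)
    note jK = jK1 jK2
    have "connected ((\<tau> ^^ i) ` {x..y})"
      using assms by (intro connected_continuous_image continuous_on_subset[OF continuous_funpow]) auto
    hence "real j / K \<in> (\<tau> ^^ i) ` {x..y}"
      using connected_contains_Icc[of "(\<tau> ^^ i) ` {x..y}" "(\<tau> ^^ i) u" "(\<tau> ^^ i) v"] uv jK(2) by blast
    then obtain w where w: "w \<in> {x..y}" "(\<tau> ^^ i) w = real j / K" by auto
    hence "w \<in> cuts K n" using assms jK(1) by (auto simp: cuts_def fib_def)
    with w assms(6) show False by blast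
  qed
  from this[of x y] this[of y x] assms(4) show ?thesis
    by (cases "\<lfloor>K * (\<tau> ^^ i) x\<rfloor>" "\<lfloor>K * (\<tau> ^^ i) y\<rfloor>" rule: linorder_cases) auto
qed

text \<open>With a mesh below the Lebesgue number each grid cell lies in one member of the cover, so
  the itineraries through the cells index a subcover. Itineraries change only at cuts.\<close>

lemma ex_small_subcover:
  assumes "\<And>U. U \<in> \<U> \<Longrightarrow> openin (top_of_set I) U" "\<Union>\<U> = I"
  shows "\<exists>K>0. \<forall>n. \<exists>\<V>\<subseteq>iterated_cover (top_of_set I) \<tau> \<U> n.
    finite \<V> \<and> \<Union>\<V> = I \<and> card \<V> \<le> 2 * (card (cuts K n) + 1)"
proof -
  define C where "C = {B. open B \<and> I \<inter> B \<in> \<U>}"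
  have ex: "\<exists>B\<in>C. x \<in> B" if "x \<in> I" for x
  proof -
    have "x \<in> \<Union>\<U>" unfolding assms(2) by (rule that)
    then obtain U where U: "U \<in> \<U>" "x \<in> U" by blast
    then obtain B where "open B" "U = I \<inter> B" using assms(1) by (auto simp: openin_open)
    thus ?thesis using U unfolding C_def by blast
  qed
  have C: "I \<subseteq> \<Union>C" "C \<noteq> {}" "\<And>B. B \<in> C \<Longrightarrow> open B"
  proof -
    show "I \<subseteq> \<Union>C" using ex by blast
    show "C \<noteq> {}" using ex[of 0] by auto
    show "open B" if "B \<in> C" for B using that by (simp add: C_def)
  qed
  have "compact I" by simp
  from Lebesgue_number_lemma[OF this C(2,1,3)] obtain \<delta>
    where \<delta>: "0 < \<delta>" "\<And>T. T \<subseteq> I \<Longrightarrow> diameter T < \<delta> \<Longrightarrow> \<exists>B\<in>C. T \<subseteq> B"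
    by metis
  obtain K0 where K0: "inverse (real (Suc K0)) < \<delta>" using reals_Archimedean[OF \<delta>(1)] by blast
  define K where "K = Suc K0"
  have K: "K > 0" "1 / real K < \<delta>" using K0 by (auto simp: K_def inverse_eq_divide)
  have "\<exists>V\<in>\<U>. {x \<in> I. \<lfloor>K * x\<rfloor> = j} \<subseteq> V" for j
  proof -
    have "norm (x - y) \<le> 1 / real K" if "\<lfloor>K * x\<rfloor> = j" "\<lfloor>K * y\<rfloor> = j" for x y :: real
    proof -
      have "\<bar>K * x - K * y\<bar> \<le> 1" using that by linarith
      hence "real K * \<bar>x - y\<bar> \<le> 1" using K(1) by (simp add: abs_mult right_diff_distrib[symmetric])
      thus ?thesis using K(1) by (simp add: field_simps)
    qed
    hence "diameter {x \<in> I. \<lfloor>K * x\<rfloor> = j} \<le> 1 / real K" by (intro diameter_le) auto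
    hence "diameter {x \<in> I. \<lfloor>K * x\<rfloor> = j} < \<delta>" using K by linarith
    then obtain B where "B \<in> C" "{x \<in> I. \<lfloor>K * x\<rfloor> = j} \<subseteq> B"
      using \<delta>(2)[of "{x \<in> I. \<lfloor>K * x\<rfloor> = j}"] by blast
    thus ?thesis unfolding C_def by blast
  qed
  hence "\<forall>j. \<exists>V. V \<in> \<U> \<and> {x \<in> I. \<lfloor>K * x\<rfloor> = j} \<subseteq> V" by blast
  from choice[OF this] obtain V
    where V: "\<And>j. V j \<in> \<U>" "\<And>j. {x \<in> I. \<lfloor>K * x\<rfloor> = j} \<subseteq> V j" by blast
  have "\<exists>\<V>\<subseteq>iterated_cover (top_of_set I) \<tau> \<U> n. finite \<V> \<and> \<Union>\<V> = I \<and> card \<V> \<le> 2 * (card (cuts K n) + 1)" for n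
  proof -
    \<comment> \<open>The default 0 beyond \<open>n\<close> makes equality of itineraries a
      condition on the first \<open>n\<close> iterates only.\<close>
    define itin where "itin x = (\<lambda>i. if i < n then \<lfloor>K * (\<tau> ^^ i) x\<rfloor> else 0)" for x
    define E where "E w = {x \<in> I. \<forall>i<n. (\<tau> ^^ i) x \<in> V (w i)}" for w
    \<comment> \<open>The flag separates a cut from the gap just below it, where the same number of
      cuts is counted; this is the factor 2 of the bound.\<close>
    define code where "code x = (card {d \<in> cuts K n. d < x}, x \<in> cuts K n)" for x
    have code_sub: "code ` I \<subseteq> {0..card (cuts K n)} \<times> UNIV"
      by (auto simp: code_def intro!: card_mono finite_cuts)
    have same: "itin x = itin y" if "x \<in> I" "y \<in> I" "x < y" "code x = code y" for x y
    proof -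
      have sub: "{d \<in> cuts K n. d < x} \<subseteq> {d \<in> cuts K n. d < y}" using that by auto
      have eq: "{d \<in> cuts K n. d < x} = {d \<in> cuts K n. d < y}"
        using that sub finite_cuts by (intro card_subset_eq) (auto simp: code_def)
      have "x \<notin> cuts K n" using eq that by blast
      hence y: "y \<notin> cuts K n" using that by (simp add: code_def)
      have "False" if d: "d \<in> cuts K n" "x \<le> d" "d \<le> y" for d
      proof -
        have "d \<noteq> y" using d y by blast
        hence "d \<in> {d \<in> cuts K n. d < y}" using d by simp
        hence "d < x" using eq by blast
        thus False using d by simp
      qed
      hence "cuts K n \<inter> {x..y} = {}" by fastforce
      thus ?thesis using floor_funpow_eq[OF K(1)] that by (auto simp: itin_def)
    qed
    have itin: "itin x = itin y" if "x \<in> I" "y \<in> I" "code x = code y" for x y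
      using same[of x y] same[of y x] that by (metis linorder_cases)
    have fin: "finite (code ` I)" using code_sub by (rule finite_subset) simp
    note im = card_image_factor[of I code itin, OF itin fin]
    have "card (itin ` I) \<le> card (code ` I)" by (rule im(2))
    also have "\<dots> \<le> card ({0..card (cuts K n)} \<times> (UNIV :: bool set))"
      by (rule card_mono[OF _ code_sub]) simp
    also have "\<dots> = 2 * (card (cuts K n) + 1)" by (simp add: card_cartesian_product)
    finally have card: "card (itin ` I) \<le> 2 * (card (cuts K n) + 1)" .
    have mem: "x \<in> E (itin x)" if "x \<in> I" for x
      unfolding E_def itin_def using that V(2) funpow_I by fastforce
    show ?thesis
    proof (intro exI[of _ "E ` itin ` I"] conjI)
      show "E ` itin ` I \<subseteq> iterated_cover (top_of_set I) \<tau> \<U> n"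
      proof -
        have "E w \<in> iterated_cover (top_of_set I) \<tau> \<U> n" for w
          unfolding iterated_cover_def E_def using V(1)
          by (intro CollectI exI[of _ "\<lambda>i. V (w i)"]) simp
        thus ?thesis by blast
      qed
      show "finite (E ` itin ` I)" using im(1) by (rule finite_imageI)
      show "\<Union> (E ` itin ` I) = I"
      proof (intro equalityI subsetI)
        fix x assume "x \<in> \<Union> (E ` itin ` I)"
        thus "x \<in> I" unfolding E_def by blast
      next
        fix x assume "x \<in> I"
        thus "x \<in> \<Union> (E ` itin ` I)" using mem by blast
      qed
      show "card (E ` itin ` I) \<le> 2 * (card (cuts K n) + 1)"
        using card_image_le[OF im(1), of E] card by linarith
    qed
  qed
  thus ?thesis using K(1) by blast
qed

lemma min_subcover:
  assumes "\<And>U. U \<in> \<U> \<Longrightarrow> openin (top_of_set I) U" "\<Union>\<U> = I"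
  shows "\<exists>\<V>\<subseteq>iterated_cover (top_of_set I) \<tau> \<U> n. finite \<V> \<and> \<Union>\<V> = I
    \<and> card \<V> = min_subcover_card (top_of_set I) (iterated_cover (top_of_set I) \<tau> \<U> n)"
proof -
  obtain \<V> where "\<V> \<subseteq> iterated_cover (top_of_set I) \<tau> \<U> n" "finite \<V>" "\<Union>\<V> = I"
    using ex_small_subcover[OF assms] by meson
  hence "\<exists>k. \<exists>\<V>\<subseteq>iterated_cover (top_of_set I) \<tau> \<U> n. finite \<V> \<and> card \<V> = k \<and> \<Union>\<V> = topspace (top_of_set I)"
    by auto
  from LeastI_ex[OF this] show ?thesis unfolding min_subcover_card_def by auto
qed

text \<open>For \<open>t = exp (- q) < radius\<close> bounded growth allows, up to a constant, at
  most \<open>n * exp (q * n)\<close> cuts; the factor \<open>n\<close> disappears after taking the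
  logarithm and dividing by \<open>n\<close>.\<close>

lemma cover_entropy_le:
  assumes \<U>: "\<And>U. U \<in> \<U> \<Longrightarrow> openin (top_of_set I) U" "\<Union>\<U> = I" and q: "ln slope < q"
  shows "cover_entropy (top_of_set I) \<tau> \<U> \<le> ereal q"
proof -
  define t where "t = exp (- q)"
  have "0 < q" using q slope_bounds ln_gt_zero[of slope] by linarith
  hence t: "0 < t" "t < 1" by (auto simp: t_def)
  have "exp (- q) < exp (- ln slope)" using q by simp
  also have "exp (- ln slope) = radius" using slope_bounds by (simp add: exp_minus inverse_eq_divide radius_slope)
  finally obtain C where C: "\<And>n z. t ^ n * card (fib n z) \<le> C"
    using bounded_growth_below[of t] t unfolding bounded_growth_def by (auto simp: t_def)
  have C0: "0 \<le> C" using C[of 0 0] by (meson order_trans mult_nonneg_nonneg zero_le_power t(1) less_imp_le of_nat_0_le_iff)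
  obtain K where K: "K > 0" and cov: "\<And>n. \<exists>\<V>\<subseteq>iterated_cover (top_of_set I) \<tau> \<U> n.
      finite \<V> \<and> \<Union>\<V> = I \<and> card \<V> \<le> 2 * (card (cuts K n) + 1)"
    using ex_small_subcover[OF \<U>] by blast
  define N where "N n = min_subcover_card (top_of_set I) (iterated_cover (top_of_set I) \<tau> \<U> n)" for n
  define A where "A = 2 * ((real K + 1) * C + 1)"
  have A: "A \<ge> 1" using C0 by (simp add: A_def add_increasing)
  have N1: "1 \<le> N n" for n
  proof -
    obtain \<V> where "finite \<V>" "\<Union>\<V> = I" "card \<V> = N n"
      using min_subcover[OF \<U>, of n] unfolding N_def by blast
    moreover have "0 \<in> I" by simp
    ultimately have "\<V> \<noteq> {}" by (metis Union_iff empty_iff)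
    thus ?thesis using \<open>finite \<V>\<close> \<open>card \<V> = N n\<close> by (metis One_nat_def Suc_leI card_gt_0_iff)
  qed
  have N_le: "real (N n) \<le> A * (n * (1 / t) ^ n)" if n: "n \<ge> 1" for n
  proof -
    have fib_le: "real (card (fib i z)) \<le> C * (1 / t) ^ n" if "i < n" for i z
    proof -
      have "real (card (fib i z)) = (t ^ i * card (fib i z)) * (1 / t) ^ i"
        using t by (simp add: power_divide)
      also have "\<dots> \<le> C * (1 / t) ^ i" using C t by (intro mult_right_mono) auto
      also have "\<dots> \<le> C * (1 / t) ^ n" using C0 t that by (intro mult_left_mono power_increasing) auto
      finally show ?thesis .
    qed
    have "card (cuts K n) \<le> (\<Sum>i<n. card (\<Union>j\<le>K. fib i (real j / K)))"
      unfolding cuts_def by (rule card_UN_le) simp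
    also have "\<dots> \<le> (\<Sum>i<n. \<Sum>j\<le>K. card (fib i (real j / K)))"
      by (intro sum_mono card_UN_le) simp
    finally have "real (card (cuts K n)) \<le> real (\<Sum>i<n. \<Sum>j\<le>K. card (fib i (real j / K)))"
      by (rule of_nat_mono)
    also have "\<dots> = (\<Sum>i<n. \<Sum>j\<le>K. real (card (fib i (real j / K))))" by (simp only: of_nat_sum)
    also have "\<dots> \<le> (\<Sum>i<n. \<Sum>j\<le>K. C * (1 / t) ^ n)" using fib_le by (intro sum_mono) auto
    also have "\<dots> = (real K + 1) * C * (n * (1 / t) ^ n)" by (simp add: algebra_simps)
    finally have cuts: "real (card (cuts K n)) \<le> (real K + 1) * C * (n * (1 / t) ^ n)" .
    obtain \<V> where \<V>: "\<V> \<subseteq> iterated_cover (top_of_set I) \<tau> \<U> n"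
      "finite \<V>" "\<Union>\<V> = I" "card \<V> \<le> 2 * (card (cuts K n) + 1)" using cov[of n] by meson
    have "N n \<le> card \<V>"
      unfolding N_def min_subcover_card_def by (rule Least_le) (use \<V> in auto)
    hence "real (N n) \<le> real (2 * (card (cuts K n) + 1))" using \<V>(4) by linarith
    also have "\<dots> = 2 * (real (card (cuts K n)) + 1)" by simp
    also have "\<dots> \<le> 2 * ((real K + 1) * C * (n * (1 / t) ^ n) + 1 * (n * (1 / t) ^ n))"
    proof -
      have "1 \<le> (1 / t) ^ n" using t by (intro one_le_power) auto
      hence "1 * 1 \<le> real n * (1 / t) ^ n" using n by (intro mult_mono) auto
      thus ?thesis by (intro mult_left_mono add_mono cuts) auto
    qed
    also have "\<dots> = A * (n * (1 / t) ^ n)" by (simp add: A_def algebra_simps)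
    finally show ?thesis .
  qed
  have bound: "ln (real (N n)) / n \<le> ln A / n + ln n / n + q" if n: "n \<ge> 1" for n
  proof -
    have pos: "0 < (1 / t) ^ n" "0 < real n" "0 < A" using t n A by auto
    have "ln (real (N n)) \<le> ln (A * (n * (1 / t) ^ n))" using N1[of n] N_le[OF n] by (intro ln_mono) auto
    also have "\<dots> = ln A + (ln n + ln ((1 / t) ^ n))"
      unfolding ln_mult_pos[OF pos(3) mult_pos_pos[OF pos(2,1)]] ln_mult_pos[OF pos(2,1)] ..
    also have "ln ((1 / t) ^ n) = n * q" using t by (simp add: ln_realpow ln_div t_def)
    finally show ?thesis using n by (simp add: field_simps)
  qed
  have "(\<lambda>n. ln A / real n + ln (real n) / real n + q) \<longlonglongrightarrow> 0 + 0 + q"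
    by (intro tendsto_add lim_const_over_n lim_ln_over_n tendsto_const)
  hence lim: "(\<lambda>n. ereal (ln A / real n + ln (real n) / real n + q)) \<longlonglongrightarrow> ereal q" by simp
  have "cover_entropy (top_of_set I) \<tau> \<U> \<le> limsup (\<lambda>n. ereal (ln A / real n + ln (real n) / real n + q))"
    unfolding cover_entropy_def N_def[symmetric]
    by (rule Limsup_mono) (use bound in \<open>auto intro!: eventually_sequentiallyI[of 1]\<close>)
  also have "\<dots> = ereal q" using lim by (intro lim_imp_Limsup) auto
  finally show ?thesis .
qed

section \<open>Lower bound of the entropy by counting folds\<close>

lemma locally_injective_germs:
  "x \<in> I \<Longrightarrow> \<exists>\<delta>>0. inj_on (\<tau> ^^ m) ({x..x + \<delta>} \<inter> I) \<and> inj_on (\<tau> ^^ m) ({x - \<delta>..x} \<inter> I)"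
proof (induction m arbitrary: x)
  case 0
  show ?case by (intro exI[of _ 1]) (auto simp: inj_on_def)
next
  case (Suc m)
  obtain \<delta> where \<delta>: "0 < \<delta>" "inj_on (\<tau> ^^ m) ({\<tau> x..\<tau> x + \<delta>} \<inter> I)"
      "inj_on (\<tau> ^^ m) ({\<tau> x - \<delta>..\<tau> x} \<inter> I)"
    using Suc.IH[OF maps_I[OF Suc.prems]] by blast
  obtain d where d: "d > 0" "\<And>y. y \<in> I \<Longrightarrow> \<bar>y - x\<bar> < d \<Longrightarrow> \<bar>\<tau> y - \<tau> x\<bar> < \<delta>"
    using cont \<delta>(1) Suc.prems unfolding continuous_on_iff dist_real_def by metis
  define e where "e = (if x = c then 1 else \<bar>x - c\<bar>)"
  have e: "e > 0" by (auto simp: e_def)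
  define \<epsilon> where "\<epsilon> = min d e / 2"
  have \<epsilon>: "0 < \<epsilon>" "\<epsilon> < d" "\<epsilon> < e" using d e by (auto simp: \<epsilon>_def min_def)
  \<comment> \<open>\<open>\<tau>\<close> sends a one-sided neighbourhood of \<open>x\<close> into a
    one-sided neighbourhood of \<open>\<tau> x\<close>, possibly on the opposite side; at
    \<open>c\<close> both sides go to the left. So the induction hypothesis applies to the
    image.\<close>
  have step: "inj_on (\<tau> ^^ Suc m) J"
    if J: "J \<subseteq> I" "\<And>y. y \<in> J \<Longrightarrow> \<bar>y - x\<bar> \<le> \<epsilon>" "inj_on \<tau> J"
      and side: "(\<forall>y\<in>J. \<tau> x \<le> \<tau> y) \<or> (\<forall>y\<in>J. \<tau> y \<le> \<tau> x)" for J
  proof -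
    have near: "\<bar>\<tau> y - \<tau> x\<bar> < \<delta>" "\<tau> y \<in> I" if "y \<in> J" for y
      using d(2)[of y] J(1) J(2)[OF that] \<epsilon> that maps_I[of y] by fastforce+
    have "inj_on (\<tau> ^^ m) (\<tau> ` J)"
      using side
    proof
      assume a: "\<forall>y\<in>J. \<tau> x \<le> \<tau> y"
      show ?thesis
      proof (intro inj_on_subset[OF \<delta>(2)] subsetI)
        fix v assume "v \<in> \<tau> ` J"
        then obtain y where y: "y \<in> J" "v = \<tau> y" by blast
        hence "\<tau> x \<le> \<tau> y" "\<bar>\<tau> y - \<tau> x\<bar> < \<delta>" using a near(1) by auto
        with near(2)[OF y(1)] y show "v \<in> {\<tau> x..\<tau> x + \<delta>} \<inter> I" by auto
      qed
    next
      assume a: "\<forall>y\<in>J. \<tau> y \<le> \<tau> x"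
      show ?thesis
      proof (intro inj_on_subset[OF \<delta>(3)] subsetI)
        fix v assume "v \<in> \<tau> ` J"
        then obtain y where y: "y \<in> J" "v = \<tau> y" by blast
        hence "\<tau> y \<le> \<tau> x" "\<bar>\<tau> y - \<tau> x\<bar> < \<delta>" using a near(1) by auto
        with near(2)[OF y(1)] y show "v \<in> {\<tau> x - \<delta>..\<tau> x} \<inter> I" by auto
      qed
    qed
    from comp_inj_on[OF J(3) this] show ?thesis by (simp add: funpow_Suc_right del: funpow.simps)
  qed
  have R: "inj_on (\<tau> ^^ Suc m) ({x..x + \<epsilon>} \<inter> I)"
  proof (cases "x < c")
    case True
    hence "{x..x + \<epsilon>} \<inter> I \<subseteq> {0..c}" using \<epsilon>(3) by (auto simp: e_def)
    thus ?thesis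
      by (intro step inj_on_subset[OF \<tau>_inj_left] disjI1) (use Suc.prems in \<open>auto intro!: incr_le\<close>)
  next
    case False
    hence "{x..x + \<epsilon>} \<inter> I \<subseteq> {c..1}" by auto
    thus ?thesis
      by (intro step inj_on_subset[OF \<tau>_inj_right] disjI2) (use Suc.prems False in \<open>auto intro!: decr_le\<close>)
  qed
  have L: "inj_on (\<tau> ^^ Suc m) ({x - \<epsilon>..x} \<inter> I)"
  proof (cases "x \<le> c")
    case True
    hence "{x - \<epsilon>..x} \<inter> I \<subseteq> {0..c}" by auto
    thus ?thesis
      by (intro step inj_on_subset[OF \<tau>_inj_left] disjI2) (use Suc.prems True in \<open>auto intro!: incr_le\<close>)
  next
    case False
    hence "{x - \<epsilon>..x} \<inter> I \<subseteq> {c..1}" using \<epsilon>(3) by (auto simp: e_def)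
    thus ?thesis
      by (intro step inj_on_subset[OF \<tau>_inj_right] disjI1) (use Suc.prems in \<open>auto intro!: decr_le\<close>)
  qed
  from R L \<epsilon>(1) show ?case by blast
qed

text \<open>Every open set around \<open>c\<close> is folded by \<open>\<tau>\<close>, so counting
  step by step would lose a factor 2 each time. Sets on which the whole iterate
  \<open>\<tau> ^^ m\<close> is at most two-to-one lose a factor 2 per \<open>m\<close>
  steps.\<close>

definition folding_cover :: "nat \<Rightarrow> real set set" where
  "folding_cover m = {V. openin (top_of_set I) V \<and> (\<forall>z. card (V \<inter> fib m z) \<le> 2)}"

lemma folding_cover: "\<And>U. U \<in> folding_cover m \<Longrightarrow> openin (top_of_set I) U" "\<Union>(folding_cover m) = I"
proof -
  show "openin (top_of_set I) U" if "U \<in> folding_cover m" for U using that by (simp add: folding_cover_def)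
  show "\<Union>(folding_cover m) = I"
  proof (intro equalityI subsetI)
    fix x assume "x \<in> \<Union>(folding_cover m)"
    then obtain V where "openin (top_of_set I) V" "x \<in> V" unfolding folding_cover_def by blast
    thus "x \<in> I" using openin_imp_subset by blast
  next
    fix x assume x: "x \<in> I"
    obtain \<delta> where \<delta>: "0 < \<delta>" and inj: "inj_on (\<tau> ^^ m) ({x..x + \<delta>} \<inter> I)" "inj_on (\<tau> ^^ m) ({x - \<delta>..x} \<inter> I)"
      using locally_injective_germs[OF x] by blast
    have "card (({x - \<delta><..<x + \<delta>} \<inter> I) \<inter> fib m z) \<le> 2" for z
    proof -
      let ?R = "({x..x + \<delta>} \<inter> I) \<inter> fib m z" and ?L = "({x - \<delta>..x} \<inter> I) \<inter> fib m z"
      have "finite ?R \<and> card ?R \<le> 1"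
        by (rule card_at_most_one) (use inj(1) in \<open>auto simp: fib_def dest: inj_onD\<close>)
      moreover have "finite ?L \<and> card ?L \<le> 1"
        by (rule card_at_most_one) (use inj(2) in \<open>auto simp: fib_def dest: inj_onD\<close>)
      moreover have "card (({x - \<delta><..<x + \<delta>} \<inter> I) \<inter> fib m z) \<le> card (?L \<union> ?R)"
        by (rule card_mono) auto
      moreover have "card (?L \<union> ?R) \<le> card ?L + card ?R" by (rule card_Un_le)
      ultimately show ?thesis by linarith
    qed
    moreover have "openin (top_of_set I) ({x - \<delta><..<x + \<delta>} \<inter> I)"
      by (metis Int_commute open_greaterThanLessThan openin_open_Int)
    ultimately have "{x - \<delta><..<x + \<delta>} \<inter> I \<in> folding_cover m" by (simp add: folding_cover_def)
    moreover have "x \<in> {x - \<delta><..<x + \<delta>} \<inter> I" using x \<delta> by simp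
    ultimately show "x \<in> \<Union>(folding_cover m)" by blast
  qed
qed

text \<open>Only the times divisible by \<open>m\<close> are inspected: going back \<open>m\<close>
  steps inside a member of the cover leaves at most two candidates.\<close>

lemma folding_count:
  assumes A: "\<And>i. i < n \<Longrightarrow> A i \<in> folding_cover m"
  shows "k * m \<le> n \<Longrightarrow> 0 < m \<Longrightarrow> card {x \<in> fib (k * m) w. \<forall>i<k. (\<tau> ^^ (i * m)) x \<in> A (i * m)} \<le> 2 ^ k"
proof (induction k arbitrary: w)
  case 0
  have "card {x \<in> fib 0 w. True} \<le> card {w}"
    by (rule card_mono) (auto simp: fib_def)
  thus ?case by simp
next
  case (Suc k)
  let ?E = "\<lambda>k w. {x \<in> fib (k * m) w. \<forall>i<k. (\<tau> ^^ (i * m)) x \<in> A (i * m)}"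
  have lt: "k * m < n" using Suc.prems by simp
  have "?E (Suc k) w \<subseteq> (\<Union>v\<in>A (k * m) \<inter> fib m w. ?E k v)"
  proof
    fix x assume x: "x \<in> ?E (Suc k) w"
    hence I: "x \<in> I" "(\<tau> ^^ m) ((\<tau> ^^ (k * m)) x) = w"
      by (auto simp: fib_def funpow_add simp del: atLeastAtMost_iff)
    have "(\<tau> ^^ (k * m)) x \<in> A (k * m) \<inter> fib m w"
      using x I funpow_I[OF I(1), of "k * m"] by (simp add: fib_def del: atLeastAtMost_iff)
    moreover have "x \<in> ?E k ((\<tau> ^^ (k * m)) x)"
      using x I by (simp add: fib_def del: atLeastAtMost_iff)
    ultimately show "x \<in> (\<Union>v\<in>A (k * m) \<inter> fib m w. ?E k v)" by blast
  qed
  moreover have fin: "finite (?E k v)" for v by simp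
  ultimately have "card (?E (Suc k) w) \<le> card (\<Union>v\<in>A (k * m) \<inter> fib m w. ?E k v)"
    by (intro card_mono) auto
  also have "\<dots> \<le> (\<Sum>v\<in>A (k * m) \<inter> fib m w. card (?E k v))" by (rule card_UN_le) simp
  also have "\<dots> \<le> of_nat (card (A (k * m) \<inter> fib m w)) * 2 ^ k"
    using Suc by (intro sum_bounded_above) auto
  also have "\<dots> \<le> 2 * 2 ^ k"
    using A[OF lt] by (intro mult_right_mono) (auto simp: folding_cover_def)
  finally show ?case by simp
qed

text \<open>Within one member of the iterated cover the \<open>n div m\<close> blocks cost a factor
  2 each, and the remaining \<open>n mod m\<close> steps are bounded by the trivial count, at most
  \<open>2 ^ m\<close>.\<close>

lemma card_fib_le_subcover:
  assumes "0 < m" and \<V>: "\<V> \<subseteq> iterated_cover (top_of_set I) \<tau> (folding_cover m) n" "finite \<V>" "\<Union>\<V> = I"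
  shows "card (fib n z) \<le> card \<V> * (2 ^ m * 2 ^ (n div m))"
proof -
  have each: "card (fib n z \<inter> V) \<le> 2 ^ m * 2 ^ (n div m)" if "V \<in> \<V>" for V
  proof -
    obtain A where A: "V = {x \<in> I. \<forall>i<n. (\<tau> ^^ i) x \<in> A i}" "\<And>i. i < n \<Longrightarrow> A i \<in> folding_cover m"
      using \<V>(1) \<open>V \<in> \<V>\<close> unfolding iterated_cover_def by auto
    define k j where "k = n div m" and "j = n mod m"
    have n: "n = j + k * m" by (simp add: k_def j_def)
    let ?E = "\<lambda>w. {x \<in> fib (k * m) w. \<forall>i<k. (\<tau> ^^ (i * m)) x \<in> A (i * m)}"
    have im: "i * m < n" if "i < k" for i
    proof -
      have "i * m < k * m" using that assms(1) by simp
      thus ?thesis using n by linarith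
    qed
    have "fib n z \<inter> V \<subseteq> (\<Union>w\<in>fib j z. ?E w)"
      using im unfolding A(1) by (auto simp: n fib_add[of j "k * m"])
    hence "card (fib n z \<inter> V) \<le> card (\<Union>w\<in>fib j z. ?E w)"
      by (intro card_mono) auto
    also have "\<dots> \<le> (\<Sum>w\<in>fib j z. card (?E w))" by (rule card_UN_le) simp
    also have "\<dots> \<le> of_nat (card (fib j z)) * 2 ^ k"
      using folding_count[of n A m k, OF A(2)] n assms(1) by (intro sum_bounded_above) auto
    also have "\<dots> \<le> 2 ^ j * 2 ^ k" using fib_card[of j z] by (intro mult_right_mono) auto
    also have "\<dots> \<le> 2 ^ m * 2 ^ k"
      using assms(1) by (intro mult_right_mono power_increasing) (auto simp: j_def less_imp_le)
    finally show ?thesis by (simp add: k_def)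
  qed
  have "fib n z \<subseteq> \<Union>\<V>" unfolding \<V>(3) by (rule fib_subset)
  hence "fib n z = (\<Union>V\<in>\<V>. fib n z \<inter> V)" by blast
  hence "card (fib n z) \<le> (\<Sum>V\<in>\<V>. card (fib n z \<inter> V))" using card_UN_le[OF \<V>(2)] by metis
  also have "\<dots> \<le> of_nat (card \<V>) * (2 ^ m * 2 ^ (n div m))" using each by (intro sum_bounded_above) auto
  finally show ?thesis by simp
qed

text \<open>For \<open>n \<le> N\<close> the quantity is at most \<open>2 ^ n \<le> 2 ^ N\<close>,
  so values above \<open>2 ^ N\<close> occur only at later times.\<close>

lemma growth_frequently:
  assumes "radius < t" "t \<le> 1"
  shows "\<exists>n\<ge>N. \<exists>z. B < t ^ n * card (fib n z)"
proof -
  have "\<not> bounded_growth t" by (rule bounded_growth_above[OF assms(1)])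
  then obtain n z where nz: "max B (2 ^ N) < t ^ n * card (fib n z)"
    using assms radius_pos unfolding bounded_growth_def by (meson less_imp_le less_trans not_less)
  have "t ^ n * card (fib n z) \<le> 1 * 2 ^ n"
    using fib_card[of n z] assms radius_pos
    by (intro mult_mono power_le_one) (auto simp flip: of_nat_le_iff)
  moreover have "2 ^ N < t ^ n * card (fib n z)" using nz by simp
  ultimately have "(2::real) ^ N < 2 ^ n" by linarith
  hence "N < n" by (simp add: power_strict_increasing_iff)
  with nz show ?thesis by (intro exI[of _ n]) auto
qed

lemma topological_entropy_ge:
  assumes "q < ln slope"
  shows "ereal q \<le> topological_entropy (top_of_set I) \<tau>"
proof -
  have "0 < ln slope" using slope_bounds by simp
  \<comment> \<open>The gap \<open>p - q\<close> makes room for the loss \<open>ln 2 / m\<close>,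
    and \<open>p > 0\<close> gives \<open>t \<le> 1\<close>.\<close>
  then obtain p where p: "max q 0 < p" "p < ln slope" using dense assms by (metis max_less_iff_conj)
  define t where "t = exp (- p)"
  have "exp (- ln slope) = radius" using slope_bounds by (simp add: exp_minus inverse_eq_divide radius_slope)
  moreover have "exp (- ln slope) < t" using p by (simp add: t_def)
  ultimately have t: "radius < t" "t \<le> 1" "0 < t" using p by (auto simp: t_def)
  obtain m0 where m0: "ln 2 / (p - q) < real m0" using reals_Archimedean2 by blast
  define m where "m = Suc m0"
  have m: "0 < m" "ln 2 / real m < p - q" using p m0 by (auto simp: m_def field_simps)
  define N where "N n = min_subcover_card (top_of_set I) (iterated_cover (top_of_set I) \<tau> (folding_cover m) n)" for n
  have "\<exists>n\<ge>n0. ereal q \<le> ereal (ln (real (N n)) / real n)" for n0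
  proof -
    \<comment> \<open>The threshold \<open>2 ^ m\<close> absorbs the constant factor of
      \<open>card_fib_le_subcover\<close>.\<close>
    obtain n z where n: "max n0 1 \<le> n" and nz: "2 ^ m < t ^ n * card (fib n z)"
      using growth_frequently[OF t(1,2), of "max n0 1" "2 ^ m"] by blast
    obtain \<V> where \<V>: "\<V> \<subseteq> iterated_cover (top_of_set I) \<tau> (folding_cover m) n" "finite \<V>" "\<Union>\<V> = I" "card \<V> = N n"
      using min_subcover[OF folding_cover[where m = m], where n = n] unfolding N_def by blast
    have "card (fib n z) \<le> N n * (2 ^ m * 2 ^ (n div m))"
      using card_fib_le_subcover[OF m(1) \<V>(1-3)] \<V>(4) by simp
    hence "real (card (fib n z)) \<le> real (N n * (2 ^ m * 2 ^ (n div m)))" by (rule of_nat_mono)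
    also have "\<dots> = 2 ^ m * (real (N n) * 2 ^ (n div m))" by simp
    finally have "t ^ n * card (fib n z) \<le> t ^ n * (2 ^ m * (real (N n) * 2 ^ (n div m)))"
      using t by (intro mult_left_mono) auto
    also have "\<dots> = 2 ^ m * (t ^ n * (real (N n) * 2 ^ (n div m)))" by (simp only: mult_ac)
    finally have "2 ^ m * 1 < 2 ^ m * (t ^ n * (real (N n) * 2 ^ (n div m)))" using nz by linarith
    hence *: "1 < t ^ n * (real (N n) * 2 ^ (n div m))" by (subst (asm) mult_less_cancel_left_pos) auto
    have Npos: "0 < N n" using * by (cases "N n = 0") auto
    have "0 < ln (t ^ n * (real (N n) * 2 ^ (n div m)))" using * by simp
    also have "\<dots> = - (n * p) + (ln (N n) + (n div m) * ln 2)"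
      using t Npos by (simp add: ln_mult ln_realpow t_def)
    finally have "n * p - (n div m) * ln 2 < ln (N n)" by simp
    moreover have "real (n div m) * ln 2 \<le> (real n / real m) * ln 2"
    proof (intro mult_right_mono)
      have "real ((n div m) * m) \<le> real n" by (intro of_nat_mono) simp
      thus "real (n div m) \<le> real n / real m" using m by (simp add: pos_le_divide_eq)
    qed simp
    ultimately have "n * p - (real n / real m) * ln 2 < ln (N n)" by linarith
    moreover have "real n * (ln 2 / real m) \<le> real n * (p - q)" using m by (intro mult_left_mono) auto
    ultimately have "real n * q \<le> ln (N n)" by (simp add: algebra_simps)
    hence "q \<le> ln (N n) / n" using n by (simp add: field_simps)
    thus ?thesis using n by auto
  qed
  note freq = this
  have "ereal q \<le> cover_entropy (top_of_set I) \<tau> (folding_cover m)"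
  proof (rule ccontr)
    assume "\<not> ?thesis"
    hence "limsup (\<lambda>n. ereal (ln (real (N n)) / real n)) < ereal q"
      unfolding cover_entropy_def N_def[symmetric] by simp
    hence "eventually (\<lambda>n. ereal (ln (real (N n)) / real n) < ereal q) sequentially"
      by (rule Limsup_lessD)
    then obtain n0 where "\<And>n. n \<ge> n0 \<Longrightarrow> ereal (ln (real (N n)) / real n) < ereal q"
      unfolding eventually_sequentially by blast
    with freq[of n0] show False by (meson not_less)
  qed
  also have "\<dots> \<le> topological_entropy (top_of_set I) \<tau>"
    unfolding topological_entropy_def using folding_cover[where m = m] by (intro SUP_upper) auto
  finally show ?thesis .
qed

theorem topological_entropy_eq: "topological_entropy (top_of_set I) \<tau> = ereal (ln slope)"
proof (rule antisym)
  show "topological_entropy (top_of_set I) \<tau> \<le> ereal (ln slope)"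
    unfolding topological_entropy_def
  proof (rule SUP_least)
    fix \<U> assume "\<U> \<in> {\<U>. (\<forall>U\<in>\<U>. openin (top_of_set I) U) \<and> \<Union>\<U> = topspace (top_of_set I)}"
    hence \<U>: "\<And>U. U \<in> \<U> \<Longrightarrow> openin (top_of_set I) U" "\<Union>\<U> = I" by simp_all
    show "cover_entropy (top_of_set I) \<tau> \<U> \<le> ereal (ln slope)"
      by (rule ereal_le_if_all_above) (rule cover_entropy_le[OF \<U>])
  qed
  show "ereal (ln slope) \<le> topological_entropy (top_of_set I) \<tau>"
    by (rule ereal_ge_if_all_below) (rule topological_entropy_ge)
qed

end

section \<open>The split interval\<close>

lemma openin_order_topology_iff:
  "openin (order_topology_on A lt) U \<longleftrightarrow>
    generate_topology_on ({A} \<union> {{y \<in> A. lt y a} | a. a \<in> A} \<union> {{y \<in> A. lt a y} | a. a \<in> A}) U"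
  unfolding order_topology_on_def openin_topology_generated_by_iff ..

locale nonperiodic_unimodal = transitive_unimodal +
  assumes nonperiodic: "\<not> eventually_periodic \<tau> c"
begin

abbreviation J :: "real set" where "J \<equiv> I1 \<tau> c"
abbreviation \<X> :: "(real \<times> bool) set" where "\<X> \<equiv> split_interval \<tau> c"

section \<open>The critical orbit and the set of split points\<close>

lemma c_I: "c \<in> I"
  using c_bounds by simp

lemma orbit_inj: "(\<tau> ^^ m) c = (\<tau> ^^ n) c \<Longrightarrow> m = n"
proof -
  have "False" if "m < n" "(\<tau> ^^ m) c = (\<tau> ^^ n) c" for m n
  proof -
    have "(\<tau> ^^ (m + (n - m))) c = (\<tau> ^^ m) c" "0 < n - m" using that by auto
    thus False using nonperiodic unfolding eventually_periodic_def by blast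
  qed
  thus "(\<tau> ^^ m) c = (\<tau> ^^ n) c \<Longrightarrow> m = n" by (metis linorder_neqE_nat)
qed

lemma orbit_2: "(\<tau> ^^ 2) c = 0"
  by (simp add: numeral_2_eq_2)

lemma orbit_0: "(\<tau> ^^ n) 0 = (\<tau> ^^ (n + 2)) c"
  unfolding funpow_add by (simp add: numeral_2_eq_2)

lemma orbit_0_inj: "(\<tau> ^^ m) 0 = (\<tau> ^^ n) 0 \<Longrightarrow> m = n"
  using orbit_inj[of "m + 2" "n + 2"] unfolding orbit_0 by simp

lemma orbit_0_neq_1: "(\<tau> ^^ n) 0 \<noteq> 1"
  using orbit_inj[of "n + 2" 1] unfolding orbit_0 by (auto simp del: funpow.simps) (simp_all)

lemma orbit_0_neq_0: "0 < n \<Longrightarrow> (\<tau> ^^ n) 0 \<noteq> 0"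
  using orbit_0_inj[of n 0] by auto

lemma \<tau>0_pos: "0 < \<tau> 0"
  using orbit_0_neq_0[of 1] range_\<tau>[of 0] by auto

lemma \<tau>_pos': "\<lbrakk>0 \<le> x; x < 1\<rbrakk> \<Longrightarrow> 0 < \<tau> x"
  using \<tau>_pos[of x] \<tau>0_pos by (cases "x = 0") auto

lemma generalized_orbit_eq:
  assumes "x \<in> I"
  shows "generalized_orbit \<tau> x = {y \<in> I. \<exists>m n. (\<tau> ^^ m) y = (\<tau> ^^ n) x}" (is "_ = ?A")
proof (intro equalityI)
  have "\<tau> y \<in> ?A" if y: "y \<in> ?A" for y
  proof -
    obtain m n where "(\<tau> ^^ m) y = (\<tau> ^^ n) x" using y by blast
    hence "(\<tau> ^^ m) (\<tau> y) = (\<tau> ^^ Suc n) x" by (simp add: funpow_swap1[symmetric])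
    thus ?thesis using y maps_I[of y] by blast
  qed
  moreover have "y \<in> ?A" if y: "y \<in> I" "\<tau> y \<in> ?A" for y
  proof -
    obtain m n where "(\<tau> ^^ m) (\<tau> y) = (\<tau> ^^ n) x" using y by blast
    hence "(\<tau> ^^ Suc m) y = (\<tau> ^^ n) x" by (simp add: funpow_swap1)
    thus ?thesis using y by blast
  qed
  moreover have "x \<in> ?A" using assms by blast
  ultimately have "?A \<in> {A. A \<subseteq> I \<and> x \<in> A \<and> \<tau> ` A \<subseteq> A \<and> {y \<in> I. \<tau> y \<in> A} \<subseteq> A}" by blast
  thus "generalized_orbit \<tau> x \<subseteq> ?A" unfolding generalized_orbit_def by (rule Inter_lower)
  have "y \<in> A" if A: "x \<in> A" "\<tau> ` A \<subseteq> A" "{y \<in> I. \<tau> y \<in> A} \<subseteq> A" and y: "y \<in> ?A" for A y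
  proof -
    obtain m n where mn: "(\<tau> ^^ m) y = (\<tau> ^^ n) x" using y by blast
    have "(\<tau> ^^ n) x \<in> A" by (induction n) (use A in auto)
    hence "(\<tau> ^^ m) y \<in> A" by (simp add: mn)
    moreover have "y \<in> I" using y by blast
    ultimately show ?thesis
    proof (induction m arbitrary: y)
      case (Suc m)
      hence "\<tau> y \<in> A" using maps_I[of y] by (simp add: funpow_swap1)
      thus ?case using A Suc.prems by blast
    qed simp
  qed
  thus "?A \<subseteq> generalized_orbit \<tau> x" unfolding generalized_orbit_def by blast
qed

text \<open>The critical orbit runs through 1 and 0, so the generalized orbits of these points add
  nothing to that of \<open>c\<close>.\<close>

lemma J_eq: "J = {y \<in> I. \<exists>m n. (\<tau> ^^ m) y = (\<tau> ^^ n) c}"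
proof -
  have "generalized_orbit \<tau> ((\<tau> ^^ k) c) \<subseteq> {y \<in> I. \<exists>m n. (\<tau> ^^ m) y = (\<tau> ^^ n) c}" for k
  proof -
    have "(\<tau> ^^ n) ((\<tau> ^^ k) c) = (\<tau> ^^ (n + k)) c" for n by (simp add: funpow_add)
    thus ?thesis unfolding generalized_orbit_eq[OF funpow_I[OF c_I]] by auto
  qed
  from this[of 1] this[of 2] show ?thesis
    unfolding I1_def orbit_2 generalized_orbit_eq[OF c_I] by auto
qed

lemma J_subset: "x \<in> J \<Longrightarrow> 0 \<le> x \<and> x \<le> 1"
  unfolding J_eq by simp

lemma orbit_in_J: "(\<tau> ^^ n) c \<in> J"
proof -
  have "(\<tau> ^^ 0) ((\<tau> ^^ n) c) = (\<tau> ^^ n) c" by simp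
  thus ?thesis using funpow_I[OF c_I, of n] unfolding J_eq by blast
qed

lemma J_members [simp]: "c \<in> J" "0 \<in> J" "1 \<in> J" "(\<tau> ^^ n) 0 \<in> J"
  using orbit_in_J[of 0] orbit_in_J[of 1] orbit_in_J[of 2] orbit_in_J[of "n + 2"] orbit_2 orbit_0 by auto

lemma J_iff: "x \<in> I \<Longrightarrow> \<tau> x \<in> J \<longleftrightarrow> x \<in> J"
proof
  assume x: "x \<in> I"
  show "x \<in> J" if "\<tau> x \<in> J"
  proof -
    obtain m n where "(\<tau> ^^ m) (\<tau> x) = (\<tau> ^^ n) c" using \<open>\<tau> x \<in> J\<close> unfolding J_eq by blast
    hence "(\<tau> ^^ Suc m) x = (\<tau> ^^ n) c" by (simp add: funpow_swap1)
    thus ?thesis using x unfolding J_eq by blast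
  qed
  show "\<tau> x \<in> J" if "x \<in> J"
  proof -
    obtain m n where "(\<tau> ^^ m) x = (\<tau> ^^ n) c" using \<open>x \<in> J\<close> unfolding J_eq by blast
    hence "(\<tau> ^^ m) (\<tau> x) = (\<tau> ^^ Suc n) c" by (simp add: funpow_swap1[symmetric])
    thus ?thesis using maps_I[OF x] unfolding J_eq by blast
  qed
qed

lemma J_\<tau>: "x \<in> J \<Longrightarrow> \<tau> x \<in> J"
  using J_iff[of x] J_subset[of x] by simp

lemma countable_J: "countable J"
proof -
  have "J \<subseteq> (\<Union>m n. fib m ((\<tau> ^^ n) c))" unfolding J_eq fib_def by blast
  moreover have "countable (\<Union>m n. fib m ((\<tau> ^^ n) c))"
    by (intro countable_UN countableI_type countable_finite) simp
  ultimately show ?thesis by (rule countable_subset)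
qed

lemma ex_not_in_J:
  assumes "a < b"
  shows "\<exists>y. a < y \<and> y < b \<and> y \<notin> J"
proof -
  have "uncountable {a<..<b}" using assms by (simp add: uncountable_open_interval)
  hence "\<not> {a<..<b} \<subseteq> J" using countable_J countable_subset by blast
  thus ?thesis by auto
qed

lemma in_X_iff: "(x, b) \<in> \<X> \<longleftrightarrow> 0 \<le> x \<and> x \<le> 1 \<and> (b \<longrightarrow> x \<in> J \<and> x \<noteq> 0 \<and> x \<noteq> 1)"
  by (auto simp: split_interval_def)

lemma X_fst: "v \<in> \<X> \<Longrightarrow> 0 \<le> fst v \<and> fst v \<le> 1"
  by (cases v) (auto simp: in_X_iff)

subsection \<open>One-sided neighbourhoods\<close>

text \<open>Only points with first coordinate different from \<open>x\<close> are tested, so the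
  other copy of a split point does not interfere.\<close>

definition near_left :: "real \<Rightarrow> (real \<times> bool \<Rightarrow> bool) \<Rightarrow> bool" where
  "near_left x P \<longleftrightarrow> (\<exists>\<delta>>0. \<forall>v\<in>\<X>. x - \<delta> < fst v \<and> fst v < x \<longrightarrow> P v)"

definition near_right :: "real \<Rightarrow> (real \<times> bool \<Rightarrow> bool) \<Rightarrow> bool" where
  "near_right x P \<longleftrightarrow> (\<exists>\<delta>>0. \<forall>v\<in>\<X>. x < fst v \<and> fst v < x + \<delta> \<longrightarrow> P v)"

lemma near_left_mono: "near_left x P \<Longrightarrow> (\<And>v. v \<in> \<X> \<Longrightarrow> fst v < x \<Longrightarrow> P v \<Longrightarrow> Q v) \<Longrightarrow> near_left x Q"
  unfolding near_left_def by blast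

lemma near_right_mono: "near_right x P \<Longrightarrow> (\<And>v. v \<in> \<X> \<Longrightarrow> x < fst v \<Longrightarrow> P v \<Longrightarrow> Q v) \<Longrightarrow> near_right x Q"
  unfolding near_right_def by blast

lemma near_left_conj: "near_left x P \<Longrightarrow> near_left x Q \<Longrightarrow> near_left x (\<lambda>v. P v \<and> Q v)"
proof -
  assume "near_left x P" "near_left x Q"
  then obtain d e where "d > 0" "e > 0" "\<forall>v\<in>\<X>. x - d < fst v \<and> fst v < x \<longrightarrow> P v"
    "\<forall>v\<in>\<X>. x - e < fst v \<and> fst v < x \<longrightarrow> Q v" unfolding near_left_def by blast
  thus ?thesis unfolding near_left_def by (intro exI[of _ "min d e"]) auto
qed

lemma near_right_conj: "near_right x P \<Longrightarrow> near_right x Q \<Longrightarrow> near_right x (\<lambda>v. P v \<and> Q v)"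
proof -
  assume "near_right x P" "near_right x Q"
  then obtain d e where "d > 0" "e > 0" "\<forall>v\<in>\<X>. x < fst v \<and> fst v < x + d \<longrightarrow> P v"
    "\<forall>v\<in>\<X>. x < fst v \<and> fst v < x + e \<longrightarrow> Q v" unfolding near_right_def by blast
  thus ?thesis unfolding near_right_def by (intro exI[of _ "min d e"]) auto
qed

lemma near_left_gt: "a < x \<Longrightarrow> near_left x (\<lambda>v. a < fst v)"
  unfolding near_left_def by (intro exI[of _ "x - a"]) auto

lemma near_right_lt: "x < a \<Longrightarrow> near_right x (\<lambda>v. fst v < a)"
  unfolding near_right_def by (intro exI[of _ "a - x"]) auto

lemma near_left_0: "near_left 0 P"
  unfolding near_left_def by (intro exI[of _ 1]) (auto dest: X_fst)

lemma near_right_1: "near_right 1 P"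
  unfolding near_right_def by (intro exI[of _ 1]) (auto dest: X_fst)

lemma near_left_True: "(\<And>v. v \<in> \<X> \<Longrightarrow> fst v < x \<Longrightarrow> P v) \<Longrightarrow> near_left x P"
  unfolding near_left_def by (intro exI[of _ 1]) auto

lemma near_right_True: "(\<And>v. v \<in> \<X> \<Longrightarrow> x < fst v \<Longrightarrow> P v) \<Longrightarrow> near_right x P"
  unfolding near_right_def by (intro exI[of _ 1]) auto

text \<open>The points of the split interval that are limits from the left are those of the form
  \<open>(x, False)\<close>; the limits from the right are those \<open>(x, b)\<close> with \<open>right_end x b\<close>. At the
  end points of the interval the one-sided conditions are void.\<close>

definition right_end :: "real \<Rightarrow> bool \<Rightarrow> bool" where
  "right_end x b \<longleftrightarrow> b \<or> x \<notin> J \<or> x = 0"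

definition locally_in :: "(real \<times> bool) \<Rightarrow> (real \<times> bool \<Rightarrow> bool) \<Rightarrow> bool" where
  "locally_in u P \<longleftrightarrow> (\<not> snd u \<longrightarrow> near_left (fst u) P) \<and> (right_end (fst u) (snd u) \<longrightarrow> near_right (fst u) P)"

lemma locally_in_mono: "locally_in u P \<Longrightarrow> (\<And>v. v \<in> \<X> \<Longrightarrow> P v \<Longrightarrow> Q v) \<Longrightarrow> locally_in u Q"
  unfolding locally_in_def using near_left_mono near_right_mono by meson

lemma locally_in_conj: "locally_in u P \<Longrightarrow> locally_in u Q \<Longrightarrow> locally_in u (\<lambda>v. P v \<and> Q v)"
  unfolding locally_in_def using near_left_conj near_right_conj by meson

lemma topspace_split [simp]: "topspace (split_topology \<tau> c) = \<X>"
proof -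
  have "\<Union>{{y \<in> \<X>. split_less y a} | a. a \<in> \<X>} \<subseteq> \<X>" "\<Union>{{y \<in> \<X>. split_less a y} | a. a \<in> \<X>} \<subseteq> \<X>"
    by auto
  thus ?thesis
    unfolding split_topology_def order_topology_on_def topology_generated_by_topspace Union_Un_distrib
    by auto
qed

lemma open_rays:
  assumes "a \<in> \<X>"
  shows "openin (split_topology \<tau> c) {v \<in> \<X>. split_less v a}"
    "openin (split_topology \<tau> c) {v \<in> \<X>. split_less a v}"
proof -
  let ?S = "{\<X>} \<union> {{y \<in> \<X>. split_less y a} | a. a \<in> \<X>} \<union> {{y \<in> \<X>. split_less a y} | a. a \<in> \<X>}"
  have "{v \<in> \<X>. split_less v a} \<in> ?S" "{v \<in> \<X>. split_less a v} \<in> ?S" using assms by blast+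
  from this[THEN topology_generated_by_Basis]
  show "openin (split_topology \<tau> c) {v \<in> \<X>. split_less v a}"
    "openin (split_topology \<tau> c) {v \<in> \<X>. split_less a v}"
    unfolding split_topology_def order_topology_on_def by simp_all
qed

lemma openin_split_imp:
  assumes "openin (split_topology \<tau> c) U" "u \<in> U"
  shows "u \<in> \<X> \<and> locally_in u (\<lambda>v. v \<in> U)"
proof -
  have "generate_topology_on ({\<X>} \<union> {{y \<in> \<X>. split_less y a} | a. a \<in> \<X>} \<union> {{y \<in> \<X>. split_less a y} | a. a \<in> \<X>}) U"
    using assms(1) unfolding split_topology_def openin_order_topology_iff .
  thus ?thesis using assms(2)
  proof (induction arbitrary: u rule: generate_topology_on.induct)
    case Empty
    thus ?case by simp
  next
    case (Int a b)
    thus ?case using locally_in_conj[of u "\<lambda>v. v \<in> a" "\<lambda>v. v \<in> b"] by auto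
  next
    case (UN K)
    then obtain k where "k \<in> K" "u \<in> k" by blast
    have "u \<in> \<X> \<and> locally_in u (\<lambda>v. v \<in> k)" by (rule UN.IH[OF \<open>k \<in> K\<close> \<open>u \<in> k\<close>])
    thus ?case
      using locally_in_mono[of u "\<lambda>v. v \<in> k" "\<lambda>v. v \<in> \<Union>K"] \<open>k \<in> K\<close> by (meson UnionI)
  next
    case (Basis s)
    obtain x b where u: "u = (x, b)" by (cases u)
    consider "s = \<X>" | a where "a \<in> \<X>" "s = {y \<in> \<X>. split_less y a}" | a where "a \<in> \<X>" "s = {y \<in> \<X>. split_less a y}"
      using Basis.hyps by blast
    thus ?case
    proof cases
      case 1
      thus ?thesis using Basis by (auto simp: locally_in_def intro!: near_left_True near_right_True)
    next
      case 2
      obtain y d where a: "a = (y, d)" by (cases a)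
      have uX: "u \<in> \<X>" and less: "x < y \<or> x = y \<and> \<not> b \<and> d"
        using Basis 2 by (auto simp: split_less_def u a)
      have "near_left x (\<lambda>v. v \<in> s)"
        using less unfolding 2(2) by (intro near_left_True) (auto simp: split_less_def a)
      moreover have "near_right x (\<lambda>v. v \<in> s)" if "right_end x b"
      proof -
        \<comment> \<open>Equality would make \<open>u\<close> the lower copy of a split point,
          which is no limit from the right.\<close>
        have "x < y" using less that 2(1) by (auto simp: right_end_def a in_X_iff)
        from near_right_lt[OF this] show ?thesis
          unfolding 2(2) by (rule near_right_mono) (auto simp: split_less_def a)
      qed
      ultimately show ?thesis using uX by (simp add: locally_in_def u)
    next
      case 3
      obtain y d where a: "a = (y, d)" by (cases a)
      have uX: "u \<in> \<X>" and less: "y < x \<or> x = y \<and> b \<and> \<not> d"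
        using Basis 3 by (auto simp: split_less_def u a)
      have "near_right x (\<lambda>v. v \<in> s)"
        using less unfolding 3(2) by (intro near_right_True) (auto simp: split_less_def a)
      moreover have "near_left x (\<lambda>v. v \<in> s)" if "\<not> b"
      proof -
        have "y < x" using less that by auto
        from near_left_gt[OF this] show ?thesis
          unfolding 3(2) by (rule near_left_mono) (auto simp: split_less_def a)
      qed
      ultimately show ?thesis using uX by (simp add: locally_in_def u)
    qed
  qed
qed

text \<open>The neighbourhood is an intersection of a set controlled on the left with one controlled
  on the right. Where nothing accumulates, the ray ending at the other copy of \<open>x\<close>
  separates; elsewhere a ray ending within the one-sided neighbourhood does; beyond 0 and 1 there is
  nothing to control.\<close>

lemma openin_split_if:
  assumes "\<And>u. u \<in> U \<Longrightarrow> u \<in> \<X>" "\<And>u. u \<in> U \<Longrightarrow> locally_in u (\<lambda>v. v \<in> U)"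
  shows "openin (split_topology \<tau> c) U"
proof (subst openin_subopen, intro ballI)
  fix u assume "u \<in> U"
  obtain x b where u: "u = (x, b)" by (cases u)
  have uX: "(x, b) \<in> \<X>" and uU: "(x, b) \<in> U" and loc: "locally_in (x, b) (\<lambda>v. v \<in> U)"
    using assms \<open>u \<in> U\<close> by (auto simp: u)
  have "\<exists>A. openin (split_topology \<tau> c) A \<and> (x, b) \<in> A \<and> (\<forall>v\<in>A. (fst v < x \<longrightarrow> v \<in> U) \<and> (fst v = x \<and> b \<longrightarrow> snd v))"
  proof (cases b)
    case True
    have "(x, False) \<in> \<X>" using uX by (auto simp: in_X_iff)
    from open_rays(2)[OF this] show ?thesis
      by (intro exI[of _ "{v \<in> \<X>. split_less (x, False) v}"]) (use uX True in \<open>auto simp: split_less_def\<close>)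
  next
    case False
    show ?thesis
    proof (cases "x = 0")
      case True
      have "openin (split_topology \<tau> c) \<X>" using openin_topspace[of "split_topology \<tau> c"] by simp
      thus ?thesis using True False uX by (intro exI[of _ \<X>]) (auto dest: X_fst)
    next
      case x: False
      obtain \<delta> where \<delta>: "\<delta> > 0" "\<And>v. v \<in> \<X> \<Longrightarrow> x - \<delta> < fst v \<Longrightarrow> fst v < x \<Longrightarrow> v \<in> U"
        using loc False by (auto simp: locally_in_def near_left_def)
      have "max 0 (x - \<delta>) < x" using \<delta> x uX by (auto simp: in_X_iff)
      then obtain y where y: "max 0 (x - \<delta>) < y" "y < x" using dense by blast
      have "(y, False) \<in> \<X>" using y uX by (auto simp: in_X_iff)
      from open_rays(2)[OF this] show ?thesis
        by (intro exI[of _ "{v \<in> \<X>. split_less (y, False) v}"])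
          (use uX False y \<delta>(2) in \<open>auto simp: split_less_def\<close>)
    qed
  qed
  then obtain A where A: "openin (split_topology \<tau> c) A" "(x, b) \<in> A"
    "\<And>v. v \<in> A \<Longrightarrow> fst v < x \<Longrightarrow> v \<in> U" "\<And>v. v \<in> A \<Longrightarrow> fst v = x \<Longrightarrow> b \<Longrightarrow> snd v" by blast
  have "\<exists>B. openin (split_topology \<tau> c) B \<and> (x, b) \<in> B \<and> (\<forall>v\<in>B. (x < fst v \<longrightarrow> v \<in> U) \<and> (fst v = x \<and> \<not> b \<longrightarrow> \<not> snd v))"
  proof (cases "right_end x b")
    case True
    show ?thesis
    proof (cases "x = 1")
      case x: True
      have "openin (split_topology \<tau> c) \<X>" using openin_topspace[of "split_topology \<tau> c"] by simp
      thus ?thesis using x uX by (intro exI[of _ \<X>]) (auto dest: X_fst simp: in_X_iff)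
    next
      case x: False
      obtain \<delta> where \<delta>: "\<delta> > 0" "\<And>v. v \<in> \<X> \<Longrightarrow> x < fst v \<Longrightarrow> fst v < x + \<delta> \<Longrightarrow> v \<in> U"
        using loc True by (auto simp: locally_in_def near_right_def)
      have "x < min 1 (x + \<delta>)" using \<delta> x uX by (auto simp: in_X_iff)
      then obtain y where y: "y < min 1 (x + \<delta>)" "x < y" using dense by blast
      have "(y, False) \<in> \<X>" using y uX by (auto simp: in_X_iff)
      from open_rays(1)[OF this] show ?thesis
        by (intro exI[of _ "{v \<in> \<X>. split_less v (y, False)}"])
          (use uX True y \<delta>(2) in \<open>auto simp: split_less_def right_end_def in_X_iff\<close>)
    qed
  next
    case False
    show ?thesis
    proof (cases "x = 1")
      case x: True
      have "openin (split_topology \<tau> c) \<X>" using openin_topspace[of "split_topology \<tau> c"] by simp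
      thus ?thesis using x uX by (intro exI[of _ \<X>]) (auto dest: X_fst simp: in_X_iff)
    next
      case x: False
      have "(x, True) \<in> \<X>" using uX x False by (auto simp: in_X_iff right_end_def)
      from open_rays(1)[OF this] show ?thesis
        by (intro exI[of _ "{v \<in> \<X>. split_less v (x, True)}"])
          (use uX False in \<open>auto simp: split_less_def right_end_def\<close>)
    qed
  qed
  then obtain B where B: "openin (split_topology \<tau> c) B" "(x, b) \<in> B"
    "\<And>v. v \<in> B \<Longrightarrow> x < fst v \<Longrightarrow> v \<in> U" "\<And>v. v \<in> B \<Longrightarrow> fst v = x \<Longrightarrow> \<not> b \<Longrightarrow> \<not> snd v" by blast
  have "A \<inter> B \<subseteq> U"
  proof
    fix v assume v: "v \<in> A \<inter> B"
    consider "fst v < x" | "x < fst v" | "fst v = x" by linarith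
    thus "v \<in> U"
    proof cases
      case 3
      hence "snd v = b" using A(4)[of v] B(4)[of v] v by blast
      with 3 have "v = (x, b)" by (cases v) auto
      thus ?thesis using uU by simp
    qed (use A B v in auto)
  qed
  thus "\<exists>T. openin (split_topology \<tau> c) T \<and> u \<in> T \<and> T \<subseteq> U"
    using A B u by (intro exI[of _ "A \<inter> B"]) auto
qed

text \<open>\<open>J\<close> is countable and every point of the split interval is a limit from some
  side, so the unsplit points are dense; this makes a continuous extension unique.\<close>

lemma openin_meets_I0:
  assumes U: "openin (split_topology \<tau> c) U" "u \<in> U"
  shows "\<exists>y. 0 < y \<and> y < 1 \<and> y \<notin> J \<and> (y, False) \<in> U"
proof -
  obtain x b where u: "u = (x, b)" by (cases u)
  have uX: "(x, b) \<in> \<X>" and loc: "locally_in (x, b) (\<lambda>v. v \<in> U)"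
    using openin_split_imp[OF U] by (auto simp: u)
  show ?thesis
  proof (cases "\<not> b \<and> x \<noteq> 0")
    case True
    obtain \<delta> where \<delta>: "\<delta> > 0" "\<And>v. v \<in> \<X> \<Longrightarrow> x - \<delta> < fst v \<Longrightarrow> fst v < x \<Longrightarrow> v \<in> U"
      using loc True by (auto simp: locally_in_def near_left_def)
    have "max 0 (x - \<delta>) < x" using \<delta> True uX by (auto simp: in_X_iff)
    then obtain y where y: "max 0 (x - \<delta>) < y" "y < x" "y \<notin> J" using ex_not_in_J by blast
    hence "(y, False) \<in> U" using uX by (intro \<delta>(2)) (auto simp: in_X_iff)
    thus ?thesis using y uX by (intro exI[of _ y]) (auto simp: in_X_iff)
  next
    case False
    hence "right_end x b" "x < 1" using uX by (auto simp: right_end_def in_X_iff less_le)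
    then obtain \<delta> where \<delta>: "\<delta> > 0" "\<And>v. v \<in> \<X> \<Longrightarrow> x < fst v \<Longrightarrow> fst v < x + \<delta> \<Longrightarrow> v \<in> U"
      using loc by (auto simp: locally_in_def near_right_def)
    have "x < min 1 (x + \<delta>)" using \<delta> \<open>x < 1\<close> by auto
    then obtain y where y: "x < y" "y < min 1 (x + \<delta>)" "y \<notin> J" using ex_not_in_J by blast
    hence "(y, False) \<in> U" using uX by (intro \<delta>(2)) (auto simp: in_X_iff)
    thus ?thesis using y uX by (intro exI[of _ y]) (auto simp: in_X_iff)
  qed
qed

text \<open>Separation by a point in between; if there is none, the two rays are already
  disjoint.\<close>

lemma split_separate:
  assumes "a \<in> \<X>" "b \<in> \<X>" "split_less a b"
  shows "\<exists>A B. openin (split_topology \<tau> c) A \<and> openin (split_topology \<tau> c) B \<and> a \<in> A \<and> b \<in> B \<and> A \<inter> B = {}"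
proof (cases "\<exists>w\<in>\<X>. split_less a w \<and> split_less w b")
  case True
  then obtain w where w: "w \<in> \<X>" "split_less a w" "split_less w b" by blast
  show ?thesis
    by (rule exI[of _ "{v \<in> \<X>. split_less v w}"], rule exI[of _ "{v \<in> \<X>. split_less w v}"])
      (use w assms open_rays[OF w(1)] in \<open>auto simp: split_less_def\<close>)
next
  case False
  show ?thesis
    by (rule exI[of _ "{v \<in> \<X>. split_less v b}"], rule exI[of _ "{v \<in> \<X>. split_less a v}"])
      (use False assms open_rays[OF assms(1)] open_rays[OF assms(2)] in auto)
qed

subsection \<open>The local homeomorphism\<close>

text \<open>The flag records the side from which the image is approached: the increasing branch
  keeps the side, the decreasing branch reverses it. All neighbours of 0 are to its right, so 0 goes
  to the upper copy of \<open>\<tau> 0\<close>; \<open>c\<close> and 1 go to the unsplit points 1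
  and 0.\<close>

definition sg :: "real \<times> bool \<Rightarrow> real \<times> bool" where
  "sg u = (\<tau> (fst u), if fst u < c then snd u \<or> fst u = 0
     else fst u \<in> J \<and> \<not> snd u \<and> fst u \<noteq> c \<and> fst u \<noteq> 1)"

lemma fst_sg [simp]: "fst (sg u) = \<tau> (fst u)"
  by (simp add: sg_def)

lemma sg_X: "u \<in> \<X> \<Longrightarrow> sg u \<in> \<X>"
proof (cases u)
  case (Pair x b)
  assume "u \<in> \<X>"
  hence x: "0 \<le> x" "x \<le> 1" "b \<longrightarrow> x \<in> J" by (auto simp: Pair in_X_iff)
  have flag: "x \<in> J \<and> x \<noteq> c \<and> x \<noteq> 1" if "snd (sg u)"
    using x c_bounds that by (auto simp: sg_def Pair split: if_splits)
  have "\<tau> x \<in> J \<and> \<tau> x \<noteq> 0 \<and> \<tau> x \<noteq> 1" if "snd (sg u)"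
    using J_\<tau>[of x] \<tau>_pos'[of x] \<tau>_lt_1[of x] flag[OF that] x by fastforce
  moreover have "sg u = (\<tau> x, snd (sg u))" by (simp add: sg_def Pair)
  ultimately show ?thesis using range_\<tau>[OF x(1,2)] by (metis in_X_iff)
qed

text \<open>The side of \<open>\<tau> x\<close> on which a point lands depends on the branch.
  Keeping it as a premise covers both branches; monotonicity discharges it later.\<close>

lemma near_left_comp:
  assumes x: "x \<in> I" and N: "near_left (\<tau> x) P"
  shows "near_left x (\<lambda>v. \<tau> (fst v) < \<tau> x \<longrightarrow> P (sg v))" "near_right x (\<lambda>v. \<tau> (fst v) < \<tau> x \<longrightarrow> P (sg v))"
proof -
  obtain \<delta> where \<delta>: "\<delta> > 0" "\<And>v. v \<in> \<X> \<Longrightarrow> \<tau> x - \<delta> < fst v \<Longrightarrow> fst v < \<tau> x \<Longrightarrow> P v"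
    using N unfolding near_left_def by blast
  obtain d where d: "d > 0" "\<And>y. y \<in> I \<Longrightarrow> \<bar>y - x\<bar> < d \<Longrightarrow> \<bar>\<tau> y - \<tau> x\<bar> < \<delta>"
    using cont \<delta>(1) x unfolding continuous_on_iff dist_real_def by metis
  have *: "P (sg v)" if v: "v \<in> \<X>" "\<bar>fst v - x\<bar> < d" "\<tau> (fst v) < \<tau> x" for v
    using \<delta>(2)[OF sg_X[OF v(1)]] d(2)[of "fst v"] X_fst[OF v(1)] v by auto
  show "near_left x (\<lambda>v. \<tau> (fst v) < \<tau> x \<longrightarrow> P (sg v))"
    unfolding near_left_def using d(1) * by (intro exI[of _ d]) auto
  show "near_right x (\<lambda>v. \<tau> (fst v) < \<tau> x \<longrightarrow> P (sg v))"
    unfolding near_right_def using d(1) * by (intro exI[of _ d]) auto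
qed

lemma near_right_comp:
  assumes x: "x \<in> I" and N: "near_right (\<tau> x) P"
  shows "near_left x (\<lambda>v. \<tau> x < \<tau> (fst v) \<longrightarrow> P (sg v))" "near_right x (\<lambda>v. \<tau> x < \<tau> (fst v) \<longrightarrow> P (sg v))"
proof -
  obtain \<delta> where \<delta>: "\<delta> > 0" "\<And>v. v \<in> \<X> \<Longrightarrow> \<tau> x < fst v \<Longrightarrow> fst v < \<tau> x + \<delta> \<Longrightarrow> P v"
    using N unfolding near_right_def by blast
  obtain d where d: "d > 0" "\<And>y. y \<in> I \<Longrightarrow> \<bar>y - x\<bar> < d \<Longrightarrow> \<bar>\<tau> y - \<tau> x\<bar> < \<delta>"
    using cont \<delta>(1) x unfolding continuous_on_iff dist_real_def by metis
  have *: "P (sg v)" if v: "v \<in> \<X>" "\<bar>fst v - x\<bar> < d" "\<tau> x < \<tau> (fst v)" for v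
    using \<delta>(2)[OF sg_X[OF v(1)]] d(2)[of "fst v"] X_fst[OF v(1)] v by auto
  show "near_left x (\<lambda>v. \<tau> x < \<tau> (fst v) \<longrightarrow> P (sg v))"
    unfolding near_left_def using d(1) * by (intro exI[of _ d]) auto
  show "near_right x (\<lambda>v. \<tau> x < \<tau> (fst v) \<longrightarrow> P (sg v))"
    unfolding near_right_def using d(1) * by (intro exI[of _ d]) auto
qed

lemma locally_in_sg:
  assumes u: "u \<in> \<X>" and loc: "locally_in (sg u) P"
  shows "locally_in u (\<lambda>v. P (sg v))"
proof -
  obtain x b where ux: "u = (x, b)" by (cases u)
  have x: "0 \<le> x" "x \<le> 1" "x \<in> I" and b: "b \<Longrightarrow> x \<in> J \<and> x \<noteq> 0 \<and> x \<noteq> 1" using u by (auto simp: ux in_X_iff)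
  have "near_left x (\<lambda>v. P (sg v))" if nb: "\<not> b"
  proof -
    consider "x = 0" | "0 < x" "x \<le> c" | "c < x" using x by linarith
    thus ?thesis
    proof cases
      case 1
      thus ?thesis using near_left_0 by simp
    next
      case 2
      hence "\<not> snd (sg u)" using nb by (auto simp: sg_def ux)
      hence "near_left (\<tau> x) P" using loc by (simp add: locally_in_def ux)
      from near_left_comp(1)[OF x(3) this] show ?thesis
        by (rule near_left_mono) (use 2 x in \<open>auto dest!: X_fst intro!: incr\<close>)
    next
      case 3
      have "right_end (\<tau> x) (snd (sg u))"
        using 3 nb J_iff[OF x(3)] by (auto simp: right_end_def sg_def ux)
      hence "near_right (\<tau> x) P" using loc by (simp add: locally_in_def ux)
      from near_left_conj[OF near_right_comp(1)[OF x(3) this] near_left_gt[OF 3]] show ?thesis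
        by (rule near_left_mono) (use 3 x decr in auto)
    qed
  qed
  moreover have "near_right x (\<lambda>v. P (sg v))" if re: "right_end x b"
  proof -
    consider "x = 1" | "x < c" | "c \<le> x" "x < 1" using x by linarith
    thus ?thesis
    proof cases
      case 1
      thus ?thesis using near_right_1 by simp
    next
      case 2
      have "right_end (\<tau> x) (snd (sg u))"
        using 2 re J_iff[OF x(3)] by (auto simp: right_end_def sg_def ux)
      hence "near_right (\<tau> x) P" using loc by (simp add: locally_in_def ux)
      from near_right_conj[OF near_right_comp(2)[OF x(3) this] near_right_lt[OF 2]] show ?thesis
        by (rule near_right_mono) (use 2 x incr in auto)
    next
      case 3
      hence "\<not> snd (sg u)" using re c_bounds by (auto simp: sg_def ux right_end_def)
      hence "near_left (\<tau> x) P" using loc by (simp add: locally_in_def ux)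
      from near_left_comp(2)[OF x(3) this] show ?thesis
        by (rule near_right_mono) (use 3 x in \<open>auto dest!: X_fst intro!: decr\<close>)
    qed
  qed
  ultimately show ?thesis by (simp add: locally_in_def ux)
qed

lemma sg_continuous: "continuous_map (split_topology \<tau> c) (split_topology \<tau> c) sg"
  unfolding continuous_map_def
proof (intro conjI allI impI)
  show "sg \<in> topspace (split_topology \<tau> c) \<rightarrow> topspace (split_topology \<tau> c)" using sg_X by auto
  fix U assume U: "openin (split_topology \<tau> c) U"
  show "openin (split_topology \<tau> c) {x \<in> topspace (split_topology \<tau> c). sg x \<in> U}"
  proof (rule openin_split_if)
    fix u assume u: "u \<in> {x \<in> topspace (split_topology \<tau> c). sg x \<in> U}"
    thus "u \<in> \<X>" by simp
    have "locally_in u (\<lambda>v. sg v \<in> U)"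
      using u openin_split_imp[OF U, of "sg u"] by (intro locally_in_sg) auto
    thus "locally_in u (\<lambda>v. v \<in> {x \<in> topspace (split_topology \<tau> c). sg x \<in> U})"
      by (rule locally_in_mono) auto
  qed
qed

text \<open>Two continuous maps into a Hausdorff space that agree on a dense set are equal.\<close>

lemma continuous_eq_sg:
  assumes \<sigma>: "continuous_map (split_topology \<tau> c) (split_topology \<tau> c) \<sigma>"
    and eq: "\<And>u. u \<in> \<X> \<Longrightarrow> fst u \<in> I0 \<tau> c \<Longrightarrow> fst (\<sigma> u) = \<tau> (fst u)" and u: "u \<in> \<X>"
  shows "\<sigma> u = sg u"
proof (rule ccontr)
  assume neq: "\<sigma> u \<noteq> sg u"
  have \<sigma>\<X>: "\<sigma> v \<in> \<X>" if "v \<in> \<X>" for v using \<sigma> that unfolding continuous_map_def by auto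
  \<comment> \<open>Only the first coordinate is prescribed, but \<open>\<tau> y\<close> is not
    split, so the flag is forced.\<close>
  have eq': "\<sigma> (y, False) = sg (y, False)" if y: "0 < y" "y < 1" "y \<notin> J" for y
  proof -
    have yX: "(y, False) \<in> \<X>" using y by (auto simp: in_X_iff)
    have "\<tau> y \<notin> J" using y J_iff[of y] by auto
    moreover have "fst (\<sigma> (y, False)) = \<tau> y" using eq[OF yX] y by (auto simp: I0_def)
    moreover have "\<sigma> (y, False) \<in> \<X>" "sg (y, False) \<in> \<X>" using \<sigma>\<X> sg_X yX by auto
    ultimately show ?thesis
      by (cases "\<sigma> (y, False)"; cases "sg (y, False)") (auto simp: in_X_iff sg_def)
  qed
  have "\<exists>A B. openin (split_topology \<tau> c) A \<and> openin (split_topology \<tau> c) B \<and> \<sigma> u \<in> A \<and> sg u \<in> B \<and> A \<inter> B = {}"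
  proof -
    have "split_less (\<sigma> u) (sg u) \<or> split_less (sg u) (\<sigma> u)"
      using neq by (cases "\<sigma> u"; cases "sg u") (auto simp: split_less_def)
    thus ?thesis
      using split_separate[OF \<sigma>\<X>[OF u] sg_X[OF u]] split_separate[OF sg_X[OF u] \<sigma>\<X>[OF u]] by blast
  qed
  then obtain A B where AB: "openin (split_topology \<tau> c) A" "openin (split_topology \<tau> c) B"
    "\<sigma> u \<in> A" "sg u \<in> B" "A \<inter> B = {}" by blast
  have "openin (split_topology \<tau> c) ({x \<in> \<X>. \<sigma> x \<in> A} \<inter> {x \<in> \<X>. sg x \<in> B})"
    using openin_continuous_map_preimage[OF \<sigma> AB(1)] openin_continuous_map_preimage[OF sg_continuous AB(2)]
    by (intro openin_Int) auto
  from openin_meets_I0[OF this, of u] obtain y where "0 < y" "y < 1" "y \<notin> J" "\<sigma> (y, False) \<in> A" "sg (y, False) \<in> B"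
    using u AB by auto
  with eq' AB(5) show False by auto
qed

lemma local_homeo_eq: "local_homeo \<tau> c = restrict sg \<X>"
  unfolding local_homeo_def
proof (rule the_equality)
  have "continuous_map (split_topology \<tau> c) (split_topology \<tau> c) (restrict sg \<X>)"
    by (rule continuous_map_eq[OF sg_continuous]) auto
  thus "continuous_map (split_topology \<tau> c) (split_topology \<tau> c) (restrict sg \<X>) \<and>
    restrict sg \<X> \<in> extensional \<X> \<and> (\<forall>u\<in>\<X>. fst u \<in> I0 \<tau> c \<longrightarrow> fst (restrict sg \<X> u) = \<tau> (fst u))"
    by auto
next
  fix \<sigma> assume \<sigma>: "continuous_map (split_topology \<tau> c) (split_topology \<tau> c) \<sigma> \<and>
    \<sigma> \<in> extensional \<X> \<and> (\<forall>u\<in>\<X>. fst u \<in> I0 \<tau> c \<longrightarrow> fst (\<sigma> u) = \<tau> (fst u))"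
  show "\<sigma> = restrict sg \<X>"
  proof
    fix u
    have "\<sigma> u = sg u" if "u \<in> \<X>"
      by (rule continuous_eq_sg) (use \<sigma> that in blast)+
    moreover have "\<sigma> u = undefined" if "u \<notin> \<X>"
      using \<sigma> that by (meson extensional_arb)
    ultimately show "\<sigma> u = restrict sg \<X> u" by simp
  qed
qed

lemma cont_int_iff:
  "f \<in> cont_int (split_topology \<tau> c) \<longleftrightarrow>
    (\<forall>u. u \<notin> \<X> \<longrightarrow> f u = 0) \<and> (\<forall>u\<in>\<X>. locally_in u (\<lambda>v. f v = f u))"
proof (intro iffI conjI ballI allI impI)
  assume f: "f \<in> cont_int (split_topology \<tau> c)"
  show "f u = 0" if "u \<notin> \<X>" for u
    using f that by (metis (mono_tags, lifting) cont_int_def mem_Collect_eq topspace_split)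
  fix u assume u: "u \<in> \<X>"
  have "continuous_map (split_topology \<tau> c) (discrete_topology UNIV) f" using f by (simp add: cont_int_def)
  from openin_continuous_map_preimage[OF this, of "{f u}"]
  have "openin (split_topology \<tau> c) {x \<in> \<X>. f x = f u}" by simp
  from openin_split_imp[OF this, of u] u show "locally_in u (\<lambda>v. f v = f u)"
    by (auto elim: locally_in_mono)
next
  assume f: "(\<forall>u. u \<notin> \<X> \<longrightarrow> f u = 0) \<and> (\<forall>u\<in>\<X>. locally_in u (\<lambda>v. f v = f u))"
  have "openin (split_topology \<tau> c) {x \<in> \<X>. f x \<in> U}" for U
  proof (rule openin_split_if)
    fix u assume u: "u \<in> {x \<in> \<X>. f x \<in> U}"
    thus "u \<in> \<X>" by simp
    have "locally_in u (\<lambda>v. f v = f u)" using f u by blast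
    thus "locally_in u (\<lambda>v. v \<in> {x \<in> \<X>. f x \<in> U})" by (rule locally_in_mono) (use u in auto)
  qed
  thus "f \<in> cont_int (split_topology \<tau> c)" using f by (auto simp: cont_int_def continuous_map_def)
qed

subsection \<open>The transfer operator\<close>

definition rb :: "real \<Rightarrow> real" where "rb x = (SOME w. c \<le> w \<and> w \<le> 1 \<and> \<tau> w = x)"
definition lb :: "real \<Rightarrow> real" where "lb x = (SOME w. 0 \<le> w \<and> w \<le> c \<and> \<tau> w = x)"

lemma rb: "\<lbrakk>0 \<le> x; x \<le> 1\<rbrakk> \<Longrightarrow> c \<le> rb x \<and> rb x \<le> 1 \<and> \<tau> (rb x) = x"
  unfolding rb_def by (rule someI_ex) (rule right_preimage)

lemma lb: "\<lbrakk>\<tau> 0 \<le> x; x \<le> 1\<rbrakk> \<Longrightarrow> 0 \<le> lb x \<and> lb x \<le> c \<and> \<tau> (lb x) = x"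
  unfolding lb_def by (rule someI_ex) (rule left_preimage)

definition right_inv :: "real \<times> bool \<Rightarrow> real \<times> bool" where
  "right_inv u = (rb (fst u), fst u \<in> J \<and> fst u \<noteq> 0 \<and> \<not> snd u)"

definition left_inv :: "real \<times> bool \<Rightarrow> real \<times> bool" where
  "left_inv u = (lb (fst u), snd u \<and> fst u \<noteq> \<tau> 0)"

text \<open>The left branch covers only what lies above \<open>\<tau> 0\<close>, and of the two
  copies of \<open>\<tau> 0\<close> only the upper one is the image of 0.\<close>

definition has_left :: "real \<times> bool \<Rightarrow> bool" where
  "has_left u \<longleftrightarrow> \<tau> 0 < fst u \<or> fst u = \<tau> 0 \<and> snd u"

text \<open>The lower copy of \<open>c\<close> counts for the left branch and the upper copy for the
  right one. So the branches share no point, and 1 also has two preimages.\<close>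

lemma fiber_eq:
  assumes u: "u \<in> \<X>"
  shows "{v \<in> \<X>. sg v = u} = (if has_left u then {right_inv u, left_inv u} else {right_inv u})"
    and "has_left u \<Longrightarrow> right_inv u \<noteq> left_inv u"
proof -
  obtain x b where ux: "u = (x, b)" by (cases u)
  have x: "0 \<le> x" "x \<le> 1" and b: "b \<Longrightarrow> x \<in> J \<and> x \<noteq> 0 \<and> x \<noteq> 1" using u by (auto simp: ux in_X_iff)
  define w where "w = rb x"
  have w: "c \<le> w" "w \<le> 1" "\<tau> w = x" "0 \<le> w" using rb[OF x] c_bounds by (auto simp: w_def)
  have wJ: "w \<in> J \<longleftrightarrow> x \<in> J" using J_iff[of w] w by simp
  have w1: "w = 1 \<longleftrightarrow> x = 0" using w \<tau>_pos'[of w] by (cases "w = 1") auto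
  have wc: "w = c \<longleftrightarrow> x = 1" using w \<tau>_eq_1_iff[of w] by auto
  have R: "right_inv u = (w, x \<in> J \<and> x \<noteq> 0 \<and> \<not> b)" by (simp add: right_inv_def ux w_def)
  have RX: "right_inv u \<in> \<X>" using w wJ w1 c_bounds by (auto simp: R in_X_iff)
  have sR: "sg (right_inv u) = u"
  proof (rule prod_eqI)
    have "snd (sg (right_inv u)) \<longleftrightarrow> w \<in> J \<and> \<not> (x \<in> J \<and> x \<noteq> 0 \<and> \<not> b) \<and> w \<noteq> c \<and> w \<noteq> 1"
      using w(1) by (simp add: R sg_def)
    also have "\<dots> \<longleftrightarrow> b" unfolding wJ w1 wc using b by blast
    finally show "snd (sg (right_inv u)) = snd u" by (simp add: ux)
    show "fst (sg (right_inv u)) = fst u" unfolding fst_sg R by (simp add: w ux)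
  qed
  have uniqR: "v = right_inv u" if v: "v \<in> \<X>" "sg v = u" "c < fst v \<or> fst v = c \<and> snd v" for v
  proof -
    obtain y d where vy: "v = (y, d)" by (cases v)
    have y: "c \<le> y" "y \<le> 1" "\<tau> y = x" using v by (auto simp: vy sg_def ux in_X_iff)
    hence yw: "y = w" using w inj_onD[OF \<tau>_inj_right, of y w] by auto
    have f: "b \<longleftrightarrow> w \<in> J \<and> \<not> d \<and> w \<noteq> c \<and> w \<noteq> 1"
      using arg_cong[OF v(2), of snd] w(1) by (simp add: vy sg_def ux yw)
    have d1: "d \<Longrightarrow> w \<in> J \<and> w \<noteq> 1" using v(1) by (simp add: vy yw in_X_iff)
    have d2: "w = c \<Longrightarrow> d" using v(3) by (auto simp: vy yw)
    have "d \<longleftrightarrow> x \<in> J \<and> x \<noteq> 0 \<and> \<not> b" using f d1 d2 b unfolding wJ w1 wc by blast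
    thus ?thesis by (simp add: vy R yw)
  qed
  have L: "left_inv u \<in> \<X> \<and> sg (left_inv u) = u \<and> (fst (left_inv u) < c \<or> fst (left_inv u) = c \<and> \<not> snd (left_inv u))"
    and uniqL: "\<And>v. \<lbrakk>v \<in> \<X>; sg v = u; fst v < c \<or> fst v = c \<and> \<not> snd v\<rbrakk> \<Longrightarrow> v = left_inv u" if hl: "has_left u"
  proof -
    define z where "z = lb x"
    have z: "0 \<le> z" "z \<le> c" "\<tau> z = x" using lb[of x] x hl by (auto simp: z_def has_left_def ux)
    have zJ: "z \<in> J \<longleftrightarrow> x \<in> J" using J_iff[of z] z c_bounds by simp
    have z0: "z = 0 \<longleftrightarrow> x = \<tau> 0" using z incr[of 0 z] by (cases "z = 0") auto
    have zc: "z = c \<longleftrightarrow> x = 1" using z \<tau>_eq_1_iff[of z] c_bounds by auto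
    have Lz: "left_inv u = (z, b \<and> x \<noteq> \<tau> 0)" by (simp add: left_inv_def ux z_def)
    have hl': "\<tau> 0 < x \<or> x = \<tau> 0 \<and> b" using hl by (simp add: has_left_def ux)
    have "left_inv u \<in> \<X>" using z zJ z0 b c_bounds by (auto simp: Lz in_X_iff)
    moreover have side: "z < c \<or> z = c \<and> \<not> (b \<and> x \<noteq> \<tau> 0)" using z(2) zc b by (auto simp: less_le)
    moreover have "sg (left_inv u) = u"
    proof (rule prod_eqI)
      show "snd (sg (left_inv u)) = snd u"
      proof (cases "z < c")
        case True
        hence "snd (sg (left_inv u)) \<longleftrightarrow> (b \<and> x \<noteq> \<tau> 0) \<or> z = 0" by (simp add: Lz sg_def)
        also have "\<dots> \<longleftrightarrow> b" unfolding z0 using hl' by auto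
        finally show ?thesis by (simp add: ux)
      next
        case False
        hence "z = c" using z by simp
        hence "\<not> snd (sg (left_inv u))" "\<not> b" using zc b by (auto simp: Lz sg_def)
        thus ?thesis unfolding ux by simp
      qed
      show "fst (sg (left_inv u)) = fst u" unfolding fst_sg Lz by (simp add: z ux)
    qed
    ultimately show "left_inv u \<in> \<X> \<and> sg (left_inv u) = u \<and> (fst (left_inv u) < c \<or> fst (left_inv u) = c \<and> \<not> snd (left_inv u))"
      by (simp add: Lz)
    fix v assume v: "v \<in> \<X>" "sg v = u" "fst v < c \<or> fst v = c \<and> \<not> snd v"
    obtain y d where vy: "v = (y, d)" by (cases v)
    have y: "0 \<le> y" "y \<le> c" "\<tau> y = x" using v by (auto simp: vy sg_def ux in_X_iff)
    hence yz: "y = z" using z inj_onD[OF \<tau>_inj_left, of y z] by auto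
    have d1: "d \<Longrightarrow> z \<noteq> 0" using v(1) by (simp add: vy yz in_X_iff)
    have "d \<longleftrightarrow> b \<and> x \<noteq> \<tau> 0"
    proof (cases "z < c")
      case True
      hence "b \<longleftrightarrow> d \<or> z = 0" using arg_cong[OF v(2), of snd] by (simp add: vy sg_def ux yz)
      thus ?thesis using d1 unfolding z0 by blast
    next
      case False
      hence "z = c" using z by simp
      thus ?thesis using v(3) zc b by (auto simp: vy yz)
    qed
    thus "v = left_inv u" by (simp add: vy Lz yz)
  qed
  have noL: "has_left u" if v: "v \<in> \<X>" "sg v = u" "fst v < c \<or> fst v = c \<and> \<not> snd v" for v
  proof -
    obtain y d where vy: "v = (y, d)" by (cases v)
    have y: "0 \<le> y" "y \<le> c" "\<tau> y = x" using v by (auto simp: vy sg_def ux in_X_iff)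
    show ?thesis
    proof (cases "y = 0")
      case True
      thus ?thesis using v c_bounds by (auto simp: vy sg_def ux has_left_def)
    next
      case False
      thus ?thesis using y incr[of 0 y] by (auto simp: has_left_def ux)
    qed
  qed
  have side: "(fst v < c \<or> fst v = c \<and> \<not> snd v) \<or> (c < fst v \<or> fst v = c \<and> snd v)" for v :: "real \<times> bool"
    by auto
  show "{v \<in> \<X>. sg v = u} = (if has_left u then {right_inv u, left_inv u} else {right_inv u})"
  proof (cases "has_left u")
    case True
    have "{v \<in> \<X>. sg v = u} \<subseteq> {right_inv u, left_inv u}" using uniqR uniqL[OF True] side by blast
    moreover have "{right_inv u, left_inv u} \<subseteq> {v \<in> \<X>. sg v = u}" using RX sR L[OF True] by blast
    ultimately show ?thesis using True by (simp add: subset_antisym)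
  next
    case False
    have "{v \<in> \<X>. sg v = u} \<subseteq> {right_inv u}" using uniqR noL False side by blast
    moreover have "{right_inv u} \<subseteq> {v \<in> \<X>. sg v = u}" using RX sR by blast
    ultimately show ?thesis using False by (simp add: subset_antisym)
  qed
  show "right_inv u \<noteq> left_inv u" if "has_left u"
  proof
    assume eq: "right_inv u = left_inv u"
    have "w = c" "\<not> (x \<in> J \<and> x \<noteq> 0 \<and> \<not> b)" using L[OF that] w unfolding eq[symmetric] by (auto simp: R)
    thus False using wc b by auto
  qed
qed

text \<open>The value type is left open: the classes consist of integer functions, while the
  estimates of mass and variation use real ones.\<close>

definition tr :: "(real \<times> bool \<Rightarrow> 'b) \<Rightarrow> real \<times> bool \<Rightarrow> 'b::comm_monoid_add" where
  "tr f u = (if u \<in> \<X> then f (right_inv u) + (if has_left u then f (left_inv u) else 0) else 0)"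

lemma transfer_eq: "transfer (split_topology \<tau> c) (local_homeo \<tau> c) f = tr f"
proof
  fix u
  have eq: "{y. y \<in> topspace (split_topology \<tau> c) \<and> local_homeo \<tau> c y = u} = {v \<in> \<X>. sg v = u}"
    unfolding local_homeo_eq by auto
  show "transfer (split_topology \<tau> c) (local_homeo \<tau> c) f u = tr f u"
  proof (cases "u \<in> \<X>")
    case True
    show ?thesis unfolding transfer_def eq fiber_eq(1)[OF True] tr_def
      using True fiber_eq(2)[OF True] by auto
  next
    case False
    hence "{v \<in> \<X>. sg v = u} = {}" using sg_X by auto
    thus ?thesis unfolding transfer_def eq tr_def using False by (metis sum.empty)
  qed
qed

lemma inv_X: "u \<in> \<X> \<Longrightarrow> right_inv u \<in> \<X>" "u \<in> \<X> \<Longrightarrow> has_left u \<Longrightarrow> left_inv u \<in> \<X>"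
  using fiber_eq(1)[of u] by (auto split: if_splits)

text \<open>A step between the two copies of \<open>y\<close>. The clause \<open>y = 0\<close> makes
  \<open>gb 0\<close> the constant 1 although 0 has a single copy.\<close>

definition gb :: "real \<Rightarrow> real \<times> bool \<Rightarrow> 'b::zero_neq_one" where
  "gb y u = of_bool (u \<in> \<X> \<and> (y < fst u \<or> y = fst u \<and> (snd u \<or> y = 0)))"

definition turn :: "real \<Rightarrow> 'b::ring_1" where
  "turn y = (if y \<le> c then 1 else - 1)"

lemma gb_0: "u \<in> \<X> \<Longrightarrow> gb 0 u = 1"
  using X_fst[of u] by (auto simp: gb_def)

lemma gb_1: "gb 1 u = 0"
  by (cases u) (auto simp: gb_def in_X_iff)

text \<open>For \<open>y \<le> c\<close> the step contains the whole right branch, which gives 1,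
  and the part of the left branch beyond \<open>y\<close>, which covers the points above
  \<open>\<tau> y\<close>. For \<open>y > c\<close> only the part of the right branch beyond
  \<open>y\<close> remains, and it covers the points below \<open>\<tau> y\<close>.\<close>

lemma tr_gb:
  assumes y: "y \<in> J"
  shows "tr (gb y) u = (gb 0 u + turn y * gb (\<tau> y) u :: 'b::ring_1)"
proof (cases "u \<in> \<X>")
  case False
  thus ?thesis by (simp add: tr_def gb_def)
next
  case u: True
  obtain x b where ux: "u = (x, b)" by (cases u)
  have x: "0 \<le> x" "x \<le> 1" and b: "b \<Longrightarrow> x \<in> J \<and> x \<noteq> 0 \<and> x \<noteq> 1" using u by (auto simp: ux in_X_iff)
  have y01: "0 \<le> y" "y \<le> 1" using J_subset[OF y] by auto
  define w where "w = rb x"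
  have w: "c \<le> w" "w \<le> 1" "\<tau> w = x" using rb[OF x] by (auto simp: w_def)
  have R: "right_inv u = (w, x \<in> J \<and> x \<noteq> 0 \<and> \<not> b)" by (simp add: right_inv_def ux w_def)
  show ?thesis
  proof (cases "y \<le> c")
    case True
    have \<tau>y: "\<tau> 0 \<le> \<tau> y" "0 < \<tau> y" using incr_le[of 0 y] y01 True \<tau>0_pos by auto
    have "gb y (right_inv u) = (1::'b)"
    proof (cases "y < w")
      case False
      hence "y = c" "w = c" using True w by auto
      hence "x = 1" "\<not> b" using w b by auto
      thus ?thesis using inv_X(1)[OF u] \<open>y = c\<close> \<open>w = c\<close> by (simp add: gb_def R)
    qed (use inv_X(1)[OF u] in \<open>simp add: gb_def R\<close>)
    moreover have "(if has_left u then gb y (left_inv u) else 0) = (gb (\<tau> y) u :: 'b)"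
    proof (cases "has_left u")
      case hl: True
      define z where "z = lb x"
      have z: "0 \<le> z" "z \<le> c" "\<tau> z = x" using lb[of x] x hl by (auto simp: z_def has_left_def ux)
      have Lz: "left_inv u = (z, b \<and> x \<noteq> \<tau> 0)" by (simp add: left_inv_def ux z_def)
      have lt: "y < z \<longleftrightarrow> \<tau> y < x" using incr[of y z] incr_le[of z y] y01 z True by fastforce
      have eq: "y = z \<longleftrightarrow> \<tau> y = x" using inj_onD[OF \<tau>_inj_left, of y z] y01 z True by auto
      have z0: "z = 0 \<longleftrightarrow> x = \<tau> 0" using z incr[of 0 z] by (cases "z = 0") auto
      have hl': "\<tau> 0 < x \<or> x = \<tau> 0 \<and> b" using hl by (simp add: has_left_def ux)
      have "(y < z \<or> y = z \<and> ((b \<and> x \<noteq> \<tau> 0) \<or> y = 0)) \<longleftrightarrow> (\<tau> y < x \<or> \<tau> y = x \<and> (b \<or> \<tau> y = 0))"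
      proof (cases "\<tau> y = x")
        case True
        hence "y = z" "y = 0 \<longleftrightarrow> x = \<tau> 0" using eq z0 by auto
        thus ?thesis using True hl' \<tau>y by auto
      next
        case False
        thus ?thesis unfolding lt eq by simp
      qed
      moreover have "gb y (left_inv u) = (of_bool (y < z \<or> y = z \<and> ((b \<and> x \<noteq> \<tau> 0) \<or> y = 0)) :: 'b)"
        using inv_X(2)[OF u hl] unfolding gb_def Lz by simp
      moreover have "gb (\<tau> y) u = (of_bool (\<tau> y < x \<or> \<tau> y = x \<and> (b \<or> \<tau> y = 0)) :: 'b)"
        using u by (simp add: gb_def ux)
      ultimately show ?thesis using hl by simp
    next
      case False
      thus ?thesis using \<tau>y by (auto simp: gb_def ux has_left_def)
    qed
    ultimately show ?thesis using True u by (simp add: tr_def turn_def gb_0)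
  next
    case False
    have "(if has_left u then gb y (left_inv u) else 0) = (0::'b)"
      using False lb[of x] x by (auto simp: gb_def left_inv_def has_left_def ux)
    moreover have "gb y (right_inv u) = (1 - gb (\<tau> y) u :: 'b)"
    proof -
      have lt: "y < w \<longleftrightarrow> x < \<tau> y" using decr[of y w] decr_le[of w y] y01 w False by fastforce
      have eq: "y = w \<longleftrightarrow> \<tau> y = x" using inj_onD[OF \<tau>_inj_right, of y w] y01 w False by auto
      have "y \<noteq> 0" using False c_bounds by auto
      have J: "\<tau> y \<in> J" by (rule J_\<tau>[OF y])
      have "(y < w \<or> y = w \<and> ((x \<in> J \<and> x \<noteq> 0 \<and> \<not> b) \<or> y = 0)) \<longleftrightarrow> \<not> (\<tau> y < x \<or> \<tau> y = x \<and> (b \<or> \<tau> y = 0))"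
      proof (cases "\<tau> y = x")
        case True
        hence "y = w" "x \<in> J" using eq J by auto
        thus ?thesis using True \<open>y \<noteq> 0\<close> by auto
      next
        case False
        thus ?thesis unfolding lt eq by auto
      qed
      moreover have "gb y (right_inv u) = (of_bool (y < w \<or> y = w \<and> ((x \<in> J \<and> x \<noteq> 0 \<and> \<not> b) \<or> y = 0)) :: 'b)"
        using inv_X(1)[OF u] unfolding gb_def R by simp
      moreover have "gb (\<tau> y) u = (of_bool (\<tau> y < x \<or> \<tau> y = x \<and> (b \<or> \<tau> y = 0)) :: 'b)"
        using u by (simp add: gb_def ux)
      ultimately show ?thesis by simp
    qed
    ultimately show ?thesis using False u by (simp add: tr_def turn_def gb_0)
  qed
qed

end

section \<open>Laurent polynomials in an automorphism\<close>

lemma ring_of_type_algebra_simps [simp]: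
  "carrier ring_of_type_algebra = UNIV" "add ring_of_type_algebra x y = x + y" "zero ring_of_type_algebra = 0"
  "mult ring_of_type_algebra x y = x * y" "one ring_of_type_algebra = 1"
  by (auto simp: ring_of_type_algebra_def)

lemma group_laurent: "group laurent_group"
  by (rule abelian_group.a_group) (simp add: ring.is_abelian_group[OF ring_from_type_algebra] ring_from_type_algebra)

lemma group_real: "group real_group"
  by (rule abelian_group.a_group) (simp add: ring.is_abelian_group[OF ring_from_type_algebra] ring_from_type_algebra)

lemma real_group_int_pow: "x [^]\<^bsub>real_group\<^esub> (k::int) = of_int k * x"
proof -
  interpret R: group real_group by (rule group_real)
  have nat: "x [^]\<^bsub>real_group\<^esub> (n::nat) = of_nat n * x" for n
    by (induction n) (auto simp: algebra_simps)
  have inv: "inv\<^bsub>real_group\<^esub> y = - y" for y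
    by (rule R.inv_equality) auto
  show ?thesis
  proof (cases k rule: int_cases2)
    case (nonneg n)
    thus ?thesis by (simp only: int_pow_int nat of_int_of_nat_eq)
  next
    case (nonpos n)
    have "x [^]\<^bsub>real_group\<^esub> (- int n) = inv\<^bsub>real_group\<^esub> (x [^]\<^bsub>real_group\<^esub> n)"
      by (rule R.int_pow_neg_int) simp
    thus ?thesis unfolding nonpos nat inv by simp
  qed
qed

locale group_automorphism = comm_group G for G :: "('a, 'm) monoid_scheme" (structure) +
  fixes \<phi> :: "'a \<Rightarrow> 'a"
  assumes aut: "\<phi> \<in> iso G G"
begin

abbreviation ap :: "int \<Rightarrow> 'a \<Rightarrow> 'a" where "ap \<equiv> aut_power G \<phi>"

abbreviation \<phi>inv :: "'a \<Rightarrow> 'a" where "\<phi>inv \<equiv> inv_into (carrier G) \<phi>"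

lemma \<phi>_bij: "bij_betw \<phi> (carrier G) (carrier G)"
  and \<phi>_closed: "x \<in> carrier G \<Longrightarrow> \<phi> x \<in> carrier G"
  and \<phi>_mult: "\<lbrakk>x \<in> carrier G; y \<in> carrier G\<rbrakk> \<Longrightarrow> \<phi> (x \<otimes> y) = \<phi> x \<otimes> \<phi> y"
  using aut by (auto simp: iso_def hom_def)

lemma \<phi>inv: "x \<in> carrier G \<Longrightarrow> \<phi>inv x \<in> carrier G" "x \<in> carrier G \<Longrightarrow> \<phi> (\<phi>inv x) = x"
    "x \<in> carrier G \<Longrightarrow> \<phi>inv (\<phi> x) = x"
  using \<phi>_bij by (auto simp: bij_betw_def inv_into_into f_inv_into_f)

lemma funpow_closed: "x \<in> carrier G \<Longrightarrow> (\<phi> ^^ n) x \<in> carrier G" "x \<in> carrier G \<Longrightarrow> (\<phi>inv ^^ n) x \<in> carrier G"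
  by (induction n) (auto simp: \<phi>_closed \<phi>inv)

lemma ap_closed: "x \<in> carrier G \<Longrightarrow> ap k x \<in> carrier G"
  by (simp add: aut_power_def funpow_closed)

lemma ap_0 [simp]: "ap 0 x = x"
  by (simp add: aut_power_def)

lemma ap_Suc: assumes "x \<in> carrier G" shows "\<phi> (ap k x) = ap (k + 1) x"
proof (cases "0 \<le> k")
  case True
  hence "nat (k + 1) = Suc (nat k)" by simp
  thus ?thesis using True by (simp add: aut_power_def)
next
  case False
  define m where "m = nat (- (k + 1))"
  have k: "nat (- k) = Suc m" using False by (simp add: m_def)
  have "\<phi> (ap k x) = \<phi> (\<phi>inv ((\<phi>inv ^^ m) x))" using False by (simp add: aut_power_def k)
  also have "\<dots> = (\<phi>inv ^^ m) x" using assms by (intro \<phi>inv funpow_closed)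
  also have "\<dots> = ap (k + 1) x" using False by (cases "k + 1 = 0") (auto simp: aut_power_def m_def)
  finally show ?thesis .
qed

lemma ap_pred: assumes "x \<in> carrier G" shows "\<phi>inv (ap k x) = ap (k - 1) x"
  using ap_Suc[OF assms, of "k - 1"] \<phi>inv(3)[OF ap_closed[OF assms, of "k - 1"]] by simp

lemma funpow_ap: "x \<in> carrier G \<Longrightarrow> (\<phi> ^^ n) (ap k x) = ap (k + int n) x"
  by (induction n) (simp_all add: ap_Suc algebra_simps)

lemma \<phi>inv_mult: "\<lbrakk>x \<in> carrier G; y \<in> carrier G\<rbrakk> \<Longrightarrow> \<phi>inv (x \<otimes> y) = \<phi>inv x \<otimes> \<phi>inv y"
  using \<phi>_mult[of "\<phi>inv x" "\<phi>inv y"] \<phi>inv(3)[of "\<phi>inv x \<otimes> \<phi>inv y"] by (simp add: \<phi>inv)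

lemma \<phi>_hom: "group_hom G G \<phi>"
  using \<phi>_closed \<phi>_mult by unfold_locales (auto simp: hom_def)

lemma \<phi>inv_hom: "group_hom G G \<phi>inv"
  using \<phi>inv \<phi>inv_mult by unfold_locales (auto simp: hom_def)

lemma \<phi>_int_pow: "x \<in> carrier G \<Longrightarrow> \<phi> (x [^] (k::int)) = \<phi> x [^] k"
  and \<phi>inv_int_pow: "x \<in> carrier G \<Longrightarrow> \<phi>inv (x [^] (k::int)) = \<phi>inv x [^] k"
  using group_hom.hom_int_pow[OF \<phi>_hom] group_hom.hom_int_pow[OF \<phi>inv_hom] by auto

abbreviation ev :: "laurent \<Rightarrow> 'a \<Rightarrow> 'a" where "ev p x \<equiv> laurent_apply G \<phi> p x"

lemma ev_superset:
  assumes "x \<in> carrier G" "finite K" "Poly_Mapping.keys p \<subseteq> K"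
  shows "ev p x = finprod G (\<lambda>k. ap k x [^] Poly_Mapping.lookup p k) K"
  unfolding laurent_apply_def
proof (rule finprod_mono_neutral_cong_left)
  fix k assume "k \<in> K - Poly_Mapping.keys p"
  hence "Poly_Mapping.lookup p k = 0" by (simp add: in_keys_iff)
  thus "ap k x [^] Poly_Mapping.lookup p k = \<one>" by simp
qed (use assms ap_closed in auto)

lemma ev_closed: "x \<in> carrier G \<Longrightarrow> ev p x \<in> carrier G"
  unfolding laurent_apply_def by (rule finprod_closed) (auto simp: ap_closed)

lemma ev_add:
  assumes "x \<in> carrier G"
  shows "ev (p + q) x = ev p x \<otimes> ev q x"
proof -
  let ?K = "Poly_Mapping.keys p \<union> Poly_Mapping.keys q"
  have K: "Poly_Mapping.keys (p + q) \<subseteq> ?K" by (rule Poly_Mapping.keys_add)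
  show ?thesis
    using assms K ap_closed[OF assms]
    by (simp add: ev_superset[where K = ?K] lookup_add int_pow_mult finprod_multf)
qed

lemma ev_single: "x \<in> carrier G \<Longrightarrow> ev (Poly_Mapping.single k a) x = ap k x [^] a"
  by (subst ev_superset[where K = "{k}"]) (auto simp: ap_closed)

lemma ev_hom: "x \<in> carrier G \<Longrightarrow> (\<lambda>p. ev p x) \<in> hom laurent_group G"
  by (auto simp: hom_def ev_closed ev_add)

lemma ev_group_hom: "x \<in> carrier G \<Longrightarrow> group_hom laurent_group G (\<lambda>p. ev p x)"
  using ev_hom group_laurent by (simp add: group_hom_def group_hom_axioms_def is_group)

text \<open>Stated for any shift of the exponents, so that it serves the automorphism and its
  inverse.\<close>

lemma ev_shift:
  assumes "x \<in> carrier G" "group_hom G G \<psi>" "\<And>k. \<psi> (ap k x) = ap (k + j) x"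
  shows "\<exists>q. \<psi> (ev p x) = ev q x"
proof -
  interpret \<psi>: group_hom G G \<psi> by fact
  have "\<exists>q. \<psi> (finprod G (\<lambda>k. ap k x [^] a k) K) = ev q x" if "finite K" for K and a :: "int \<Rightarrow> int"
    using that
  proof (induction K)
    case empty
    have "ev 0 x = \<one>" by (simp add: laurent_apply_def)
    thus ?case by (intro exI[of _ 0]) simp
  next
    case (insert k K)
    then obtain q where q: "\<psi> (finprod G (\<lambda>k. ap k x [^] a k) K) = ev q x" by blast
    have "\<psi> (finprod G (\<lambda>k. ap k x [^] a k) (insert k K)) = \<psi> (ap k x [^] a k) \<otimes> ev q x"
      using insert q ap_closed[OF assms(1)] by (subst finprod_insert) auto
    also have "\<psi> (ap k x [^] a k) = ev (Poly_Mapping.single (k + j) (a k)) x"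
      using assms(3) ap_closed[OF assms(1)] by (simp add: ev_single[OF assms(1)] \<psi>.hom_int_pow)
    finally show ?case using ev_add[OF assms(1)] by metis
  qed
  thus ?thesis unfolding laurent_apply_def by simp
qed

lemma ev_image_closed:
  assumes x: "x \<in> carrier G"
  shows "\<phi> (ev p x) \<in> range (\<lambda>p. ev p x)" "\<phi>inv (ev p x) \<in> range (\<lambda>p. ev p x)"
proof -
  have "\<exists>q. \<phi> (ev p x) = ev q x"
    by (rule ev_shift[OF x \<phi>_hom, where j = 1]) (simp add: ap_Suc[OF x])
  thus "\<phi> (ev p x) \<in> range (\<lambda>p. ev p x)" by auto
  have "\<exists>q. \<phi>inv (ev p x) = ev q x"
    by (rule ev_shift[OF x \<phi>inv_hom, where j = "- 1"]) (simp add: ap_pred[OF x])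
  thus "\<phi>inv (ev p x) \<in> range (\<lambda>p. ev p x)" by auto
qed

lemma state_ev:
  assumes \<omega>: "\<omega> \<in> hom G real_group" and x: "x \<in> carrier G" and r: "r \<noteq> 0"
    and scale: "\<And>y. y \<in> carrier G \<Longrightarrow> \<omega> (\<phi> y) = r * \<omega> y"
  shows "\<omega> (ev p x) = laurent_eval r p * \<omega> x"
proof -
  interpret w: group_hom G real_group \<omega>
    using \<omega> group_real by (simp add: group_hom_def group_hom_axioms_def is_group)
  have ap: "\<omega> (ap k x) = r powi k * \<omega> x" for k
  proof (induction k rule: int_induct[where k = 0])
    case (step1 i)
    have "\<omega> (ap (i + 1) x) = r * \<omega> (ap i x)"
      using scale[OF ap_closed[OF x, of i]] by (simp add: ap_Suc[OF x])
    thus ?case using step1 r by (simp add: power_int_add_1')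
  next
    case (step2 i)
    have "\<omega> (ap i x) = r * \<omega> (ap (i - 1) x)"
      using scale[OF ap_closed[OF x, of "i - 1"]] by (simp add: ap_Suc[OF x])
    moreover have "r powi i = r * r powi (i - 1)"
      using r power_int_add_1'[of r "i - 1"] by simp
    ultimately show ?case using step2 r by simp
  qed simp
  have "\<omega> (finprod G (\<lambda>k. ap k x [^] a k) K) = (\<Sum>k\<in>K. of_int (a k) * r powi k) * \<omega> x"
    if "finite K" for K and a :: "int \<Rightarrow> int"
    using that
  proof (induction K)
    case empty
    show ?case using w.hom_one by simp
  next
    case (insert k K)
    have "\<omega> (finprod G (\<lambda>k. ap k x [^] a k) (insert k K))
        = \<omega> (ap k x [^] a k) + \<omega> (finprod G (\<lambda>k. ap k x [^] a k) K)"
      using insert ap_closed[OF x] by (subst finprod_insert) (auto simp: w.hom_mult finprod_closed)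
    also have "\<omega> (ap k x [^] a k) = of_int (a k) * (r powi k * \<omega> x)"
      using w.hom_int_pow[OF ap_closed[OF x]] by (simp only: ap real_group_int_pow)
    finally show ?case using insert by (simp add: algebra_simps)
  qed
  thus ?thesis unfolding laurent_apply_def laurent_eval_def by simp
qed

end

section \<open>The dimension group as a module over the transfer operator\<close>

context nonperiodic_unimodal
begin

abbreviation C :: "(real \<times> bool \<Rightarrow> int) set" where
  "C \<equiv> cont_int (split_topology \<tau> c)"

lemma C_outside: "f \<in> C \<Longrightarrow> u \<notin> \<X> \<Longrightarrow> f u = 0"
  unfolding cont_int_iff by blast

lemma C_local: "f \<in> C \<Longrightarrow> u \<in> \<X> \<Longrightarrow> locally_in u (\<lambda>v. f v = f u)"
  by (simp add: cont_int_iff)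

lemma C_zero: "(\<lambda>u. 0) \<in> C"
  by (auto simp: cont_int_iff locally_in_def intro!: near_left_True near_right_True)

lemma C_lincomb: "f \<in> C \<Longrightarrow> g \<in> C \<Longrightarrow> (\<lambda>u. a * f u + b * g u) \<in> C"
  unfolding cont_int_iff by (auto intro: locally_in_mono[OF locally_in_conj])

lemma C_add: "f \<in> C \<Longrightarrow> g \<in> C \<Longrightarrow> (\<lambda>u. f u + g u) \<in> C"
  using C_lincomb[of f g 1 1] by simp

lemma C_diff: "f \<in> C \<Longrightarrow> g \<in> C \<Longrightarrow> (\<lambda>u. f u - g u) \<in> C"
  using C_lincomb[of f g 1 "- 1"] by simp

lemma C_scale: "f \<in> C \<Longrightarrow> (\<lambda>u. a * f u) \<in> C"
  using C_lincomb[of f f a 0] by simp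

text \<open>The only discontinuity on the line is at \<open>y\<close>, and there the two copies are
  separated.\<close>

lemma C_gb: "y \<in> J \<Longrightarrow> gb y \<in> C"
  unfolding cont_int_iff
proof (intro conjI allI impI ballI)
  assume y: "y \<in> J"
  show "gb y u = 0" if "u \<notin> \<X>" for u using that by (simp add: gb_def)
  fix u assume "u \<in> \<X>"
  obtain x b where ux: "u = (x, b)" by (cases u)
  have u: "(x, b) \<in> \<X>" using \<open>u \<in> \<X>\<close> ux by simp
  have "near_left x (\<lambda>v. gb y v = (gb y (x, b) :: int))" if "\<not> b"
  proof (cases "y < x")
    case True
    from near_left_gt[OF True] show ?thesis
      by (rule near_left_mono) (use True u in \<open>auto simp: gb_def\<close>)
  next
    case False
    show ?thesis
    proof (cases "x = 0")
      case True
      thus ?thesis using near_left_0 by simp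
    next
      case x: False
      show ?thesis by (rule near_left_True) (use False x that in \<open>auto simp: gb_def\<close>)
    qed
  qed
  moreover have "near_right x (\<lambda>v. gb y v = (gb y (x, b) :: int))" if "right_end x b"
  proof (cases "x < y")
    case True
    from near_right_lt[OF True] show ?thesis
      by (rule near_right_mono) (use True u in \<open>auto simp: gb_def\<close>)
  next
    case False
    \<comment> \<open>A right limit point in \<open>J\<close> is an upper copy or 0, and there the
      step has already taken place.\<close>
    have "y < x \<or> y = x \<and> (b \<or> y = 0)" using False y that by (auto simp: right_end_def)
    hence "gb y (x, b) = (1::int)" using u by (simp add: gb_def)
    thus ?thesis using False by (intro near_right_True) (simp add: gb_def)
  qed
  ultimately show "locally_in u (\<lambda>v. gb y v = (gb y u :: int))" by (simp add: locally_in_def ux)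
qed

lemma C_span: "finite S \<Longrightarrow> S \<subseteq> J \<Longrightarrow> (\<lambda>u. \<Sum>y\<in>S. a y * gb y u) \<in> C"
proof (induction S rule: finite_induct)
  case (insert y S)
  thus ?case using C_lincomb[OF C_gb[of y], of "\<lambda>u. \<Sum>y\<in>S. a y * gb y u" "a y" 1] by simp
qed (simp add: C_zero)

section \<open>Jumps of integer functions and the spanning step functions\<close>

definition jump :: "(real \<times> bool \<Rightarrow> 'b::minus) \<Rightarrow> real \<Rightarrow> 'b" where
  "jump f x = f (x, True) - f (x, False)"

abbreviation J0 :: "real set" where "J0 \<equiv> J - {0, 1}"

lemma J0_X: "x \<in> J0 \<Longrightarrow> (x, b) \<in> \<X>"
  using J_subset[of x] by (auto simp: in_X_iff)

lemma jump_gb: "x \<in> J0 \<Longrightarrow> y \<in> J \<Longrightarrow> jump (gb y) x = (of_bool (y = x) :: int)"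
  using J0_X[of x] by (auto simp: jump_def gb_def)

text \<open>The limit from the right is the value at the upper copy if \<open>x\<close> is split and
  at the single copy otherwise; the flag \<open>x \<in> J0\<close> selects the correct one.\<close>

lemma C_locally_constant:
  assumes f: "f \<in> C" and x: "x \<in> I"
  shows "\<exists>d>0. \<forall>v\<in>\<X>. (x - d < fst v \<and> fst v < x \<longrightarrow> f v = f (x, False))
    \<and> (x < fst v \<and> fst v < x + d \<longrightarrow> f v = f (x, x \<in> J0))"
proof -
  have "(x, False) \<in> \<X>" "(x, x \<in> J0) \<in> \<X>" using x by (auto simp: in_X_iff)
  from C_local[OF f this(1)] C_local[OF f this(2)]
  have "near_left x (\<lambda>v. f v = f (x, False))" "right_end x (x \<in> J0) \<Longrightarrow> near_right x (\<lambda>v. f v = f (x, x \<in> J0))"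
    by (auto simp: locally_in_def)
  \<comment> \<open>Only \<open>x = 1\<close> is left, which has no point to its right.\<close>
  moreover have "near_right x (\<lambda>v. f v = f (x, x \<in> J0))" if "\<not> right_end x (x \<in> J0)"
    using that near_right_1 by (auto simp: right_end_def)
  ultimately have L: "near_left x (\<lambda>v. f v = f (x, False))" and R: "near_right x (\<lambda>v. f v = f (x, x \<in> J0))"
    by auto
  obtain d where d: "d > 0" "\<And>v. v \<in> \<X> \<Longrightarrow> x - d < fst v \<Longrightarrow> fst v < x \<Longrightarrow> f v = f (x, False)"
    using L unfolding near_left_def by blast
  obtain e where e: "e > 0" "\<And>v. v \<in> \<X> \<Longrightarrow> x < fst v \<Longrightarrow> fst v < x + e \<Longrightarrow> f v = f (x, x \<in> J0)"
    using R unfolding near_right_def by blast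
  show ?thesis using d e by (intro exI[of _ "min d e"]) auto
qed

text \<open>Compactness in the form of bisection: close to any \<open>x\<close> no other point
  carries a jump.\<close>

lemma finite_jumps:
  assumes f: "f \<in> C"
  shows "finite {x \<in> J0. jump f x \<noteq> 0}"
proof -
  have "finite {x \<in> J0. 0 \<le> x \<and> x \<le> 1 \<and> jump f x \<noteq> 0}"
  proof (rule Bolzano[of 0 1 "\<lambda>a b. finite {x \<in> J0. a \<le> x \<and> x \<le> b \<and> jump f x \<noteq> 0}"])
    fix a b d :: real
    assume "finite {x \<in> J0. a \<le> x \<and> x \<le> b \<and> jump f x \<noteq> 0}" "finite {x \<in> J0. b \<le> x \<and> x \<le> d \<and> jump f x \<noteq> 0}"
    from finite_UnI[OF this] show "finite {x \<in> J0. a \<le> x \<and> x \<le> d \<and> jump f x \<noteq> 0}"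
      by (rule finite_subset[rotated]) auto
  next
    fix x :: real assume "0 \<le> x" "x \<le> 1"
    then obtain d where d: "d > 0" "\<And>v. v \<in> \<X> \<Longrightarrow> x - d < fst v \<Longrightarrow> fst v < x \<Longrightarrow> f v = f (x, False)"
      "\<And>v. v \<in> \<X> \<Longrightarrow> x < fst v \<Longrightarrow> fst v < x + d \<Longrightarrow> f v = f (x, x \<in> J0)"
      using C_locally_constant[OF f, of x] by auto
    have "jump f y = 0" if y: "y \<in> J0" "\<bar>y - x\<bar> < d" "y \<noteq> x" for y
    proof (cases "y < x")
      case True
      thus ?thesis using d(2)[OF J0_X[OF y(1)]] y by (simp add: jump_def)
    next
      case False
      thus ?thesis using d(3)[OF J0_X[OF y(1)]] y by (simp add: jump_def)
    qed
    hence "{y \<in> J0. a \<le> y \<and> y \<le> b \<and> jump f y \<noteq> 0} \<subseteq> {x}" if "a \<le> x \<and> x \<le> b \<and> b - a < d" for a b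
      using that by fastforce
    hence "finite {y \<in> J0. a \<le> y \<and> y \<le> b \<and> jump f y \<noteq> 0}" if "a \<le> x \<and> x \<le> b \<and> b - a < d" for a b
      using that finite_subset by blast
    thus "\<exists>d>0. \<forall>a b. a \<le> x \<and> x \<le> b \<and> b - a < d \<longrightarrow> finite {y \<in> J0. a \<le> y \<and> y \<le> b \<and> jump f y \<noteq> 0}"
      using d(1) by blast
  qed simp
  moreover have "{x \<in> J0. 0 \<le> x \<and> x \<le> 1 \<and> jump f x \<noteq> 0} = {x \<in> J0. jump f x \<noteq> 0}" using J_subset by blast
  ultimately show ?thesis by simp
qed

text \<open>Without jumps the function is constant near each point of the interval, and bisection
  extends this to the whole.\<close>

lemma C_no_jumps:
  assumes f: "f \<in> C" and nj: "\<And>x. x \<in> J0 \<Longrightarrow> jump f x = 0" and uv: "u \<in> \<X>" "v \<in> \<X>"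
  shows "f u = f v"
proof -
  define P where "P a b \<longleftrightarrow> (\<forall>u\<in>\<X>. \<forall>v\<in>\<X>. a \<le> fst u \<and> fst u \<le> b \<and> a \<le> fst v \<and> fst v \<le> b \<longrightarrow> f u = f v)" for a b
  have PD: "f u = f v" if "P a b" "u \<in> \<X>" "v \<in> \<X>" "a \<le> fst u" "fst u \<le> b" "a \<le> fst v" "fst v \<le> b" for a b u v
    using that unfolding P_def by blast
  have "P 0 1"
  proof (rule Bolzano)
    fix a b d :: real assume ab: "P a b" and bd: "P b d" and "a \<le> b" "b \<le> d"
    have key: "f u = f v" if "u \<in> \<X>" "v \<in> \<X>" "a \<le> fst u" "fst u \<le> b" "b \<le> fst v" "fst v \<le> d" for u v
    proof -
      have "(b, False) \<in> \<X>" using X_fst[OF that(1)] X_fst[OF that(2)] that by (auto simp: in_X_iff)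
      note bX = this
      have "f u = f (b, False)"
        by (rule PD[OF ab that(1) bX]) (use that \<open>a \<le> b\<close> \<open>b \<le> d\<close> in simp_all)
      also have "f (b, False) = f v"
        by (rule PD[OF bd bX that(2)]) (use that \<open>a \<le> b\<close> \<open>b \<le> d\<close> in simp_all)
      finally show ?thesis .
    qed
    show "P a d" unfolding P_def
    proof (intro ballI impI)
      fix u v assume uv: "u \<in> \<X>" "v \<in> \<X>" "a \<le> fst u \<and> fst u \<le> d \<and> a \<le> fst v \<and> fst v \<le> d"
      consider "fst u \<le> b" "fst v \<le> b" | "fst u \<le> b" "b \<le> fst v" | "b \<le> fst u" "fst v \<le> b" | "b \<le> fst u" "b \<le> fst v"
        by linarith
      thus "f u = f v"
      proof cases
        case 1 thus ?thesis using ab uv unfolding P_def by blast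
      next
        case 2 thus ?thesis using key[of u v] uv by blast
      next
        case 3 thus ?thesis using key[of v u] uv by auto
      next
        case 4 thus ?thesis using bd uv unfolding P_def by blast
      qed
    qed
  next
    fix x :: real assume x: "0 \<le> x" "x \<le> 1"
    then obtain d where d: "d > 0" "\<And>v. v \<in> \<X> \<Longrightarrow> x - d < fst v \<Longrightarrow> fst v < x \<Longrightarrow> f v = f (x, False)"
      "\<And>v. v \<in> \<X> \<Longrightarrow> x < fst v \<Longrightarrow> fst v < x + d \<Longrightarrow> f v = f (x, x \<in> J0)"
      using C_locally_constant[OF f, of x] by auto
    have eq: "f (x, e) = f (x, False)" if "(x, e) \<in> \<X>" for e
      using nj[of x] that by (cases e) (auto simp: jump_def in_X_iff)
    have "(x, x \<in> J0) \<in> \<X>" using x by (auto simp: in_X_iff)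
    from eq[OF this] have eq': "f (x, x \<in> J0) = f (x, False)" .
    have "f v = f (x, False)" if v: "v \<in> \<X>" "\<bar>fst v - x\<bar> < d" for v
    proof -
      consider "fst v < x" | "x < fst v" | "fst v = x" by linarith
      thus ?thesis
      proof cases
        case 1 thus ?thesis using d(2)[OF v(1)] v by auto
      next
        case 2 thus ?thesis using d(3)[OF v(1)] v eq' by auto
      next
        case 3 thus ?thesis using eq[of "snd v"] v by (metis prod.collapse)
      qed
    qed
    note near = this
    have "P a b" if ab: "a \<le> x \<and> x \<le> b \<and> b - a < d" for a b
      unfolding P_def
    proof (intro ballI impI)
      fix u v assume uv: "u \<in> \<X>" "v \<in> \<X>" "a \<le> fst u \<and> fst u \<le> b \<and> a \<le> fst v \<and> fst v \<le> b"
      have "\<bar>fst u - x\<bar> < d" "\<bar>fst v - x\<bar> < d" using ab uv(3) by linarith+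
      thus "f u = f v" using near[OF uv(1)] near[OF uv(2)] by simp
    qed
    thus "\<exists>d>0. \<forall>a b. a \<le> x \<and> x \<le> b \<and> b - a < d \<longrightarrow> P a b" using d(1) by blast
  qed simp
  thus ?thesis using uv X_fst[OF uv(1)] X_fst[OF uv(2)] unfolding P_def by blast
qed

text \<open>Subtracting the steps with the same jumps leaves a constant, and the coefficient of
  \<open>gb 0\<close> is chosen to make it vanish.\<close>

lemma C_span_ex:
  assumes f: "f \<in> C"
  shows "\<exists>S a. finite S \<and> S \<subseteq> J \<and> f = (\<lambda>u. \<Sum>y\<in>S. a y * gb y u)"
proof -
  define S where "S = {x \<in> J0. jump f x \<noteq> 0}"
  have S: "finite S" "S \<subseteq> J" "0 \<notin> S" using finite_jumps[OF f] by (auto simp: S_def)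
  define a where "a y = (if y = 0 then f (0, False) else jump f y)" for y
  define h where "h u = (\<Sum>y\<in>insert 0 S. a y * gb y u)" for u
  have h: "h \<in> C" unfolding h_def using S by (intro C_span) auto
  have g: "(\<lambda>u. f u - h u) \<in> C" by (rule C_diff[OF f h])
  have "jump (\<lambda>u. f u - h u) x = 0" if x: "x \<in> J0" for x
  proof -
    have "jump h x = (\<Sum>y\<in>insert 0 S. a y * jump (gb y) x)"
      unfolding jump_def h_def by (simp add: sum_subtractf[symmetric] right_diff_distrib)
    also have "\<dots> = (\<Sum>y\<in>insert 0 S. a y * of_bool (y = x))"
      using S x by (intro sum.cong refl) (subst jump_gb, auto)
    also have "\<dots> = (\<Sum>y\<in>insert 0 S. if y = x then a y else 0)" by (intro sum.cong) auto
    also have "\<dots> = (if x \<in> insert 0 S then a x else 0)" using S by (subst sum.delta) auto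
    also have "\<dots> = jump f x" using x by (auto simp: S_def a_def)
    finally show ?thesis by (simp add: jump_def)
  qed
  note nj = this
  have const: "f u - h u = f (0, False) - h (0, False)" if "u \<in> \<X>" for u
    using C_no_jumps[OF g nj that, of "(0, False)"] by (simp add: in_X_iff)
  have "gb y (0, False) = (of_bool (y = 0) :: int)" if "y \<in> insert 0 S" for y
    using that J_subset[of y] S by (auto simp: gb_def in_X_iff)
  hence "h (0, False) = (\<Sum>y\<in>insert 0 S. if y = 0 then a y else 0)"
    unfolding h_def by (intro sum.cong) auto
  also have "\<dots> = f (0, False)" using S by (subst sum.delta) (auto simp: a_def)
  finally have "f u = h u" for u
    using const[of u] C_outside[OF f, of u] C_outside[OF h, of u] by (cases "u \<in> \<X>") auto
  thus ?thesis using S unfolding h_def by (intro exI[of _ "insert 0 S"] exI[of _ a]) auto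
qed

lemma C_induct [consumes 1, case_names zero add]:
  assumes "f \<in> C" and "P (\<lambda>u. 0)"
    and step: "\<And>f y a. f \<in> C \<Longrightarrow> P f \<Longrightarrow> y \<in> J \<Longrightarrow> P (\<lambda>u. f u + a * gb y u)"
  shows "P f"
proof -
  obtain S a where S: "finite S" "S \<subseteq> J" and f: "f = (\<lambda>u. \<Sum>y\<in>S. a y * gb y u)"
    using C_span_ex[OF assms(1)] by blast
  have "P (\<lambda>u. \<Sum>y\<in>S. a y * gb y u)" using S
  proof (induction S rule: finite_induct)
    case (insert y S)
    hence "P (\<lambda>u. (\<Sum>y\<in>S. a y * gb y u) + a y * gb y u)" by (intro step C_span) auto
    thus ?case using insert by (simp add: add.commute)
  qed (simp add: assms(2))
  thus ?thesis by (simp add: f)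
qed

subsection \<open>Linearity and positivity of the transfer operator\<close>

lemma tr_zero [simp]: "tr (\<lambda>u. 0) = (\<lambda>u. 0)"
  by (auto simp: tr_def)

lemma tr_add: "tr (\<lambda>u. f u + g u) = (\<lambda>u. tr f u + tr g u)"
  by (rule ext) (simp add: tr_def ac_simps)

lemma tr_scale: "tr (\<lambda>u. a * f u) = (\<lambda>u. a * tr f u :: 'b::comm_semiring_0)"
  by (rule ext) (simp add: tr_def distrib_left)

lemma tr_mono: "(\<And>u. u \<in> \<X> \<Longrightarrow> f u \<le> g u) \<Longrightarrow> tr f u \<le> (tr g u :: 'b::ordered_comm_monoid_add)"
proof (cases "u \<in> \<X>")
  case True
  assume le: "\<And>u. u \<in> \<X> \<Longrightarrow> f u \<le> g u"
  have "f (right_inv u) \<le> g (right_inv u)" by (intro le inv_X True)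
  moreover have "f (left_inv u) \<le> g (left_inv u)" if "has_left u" by (intro le inv_X True that)
  ultimately show ?thesis by (simp add: tr_def True add_mono)
qed (simp add: tr_def)

lemma trn_add: "(tr ^^ n) (\<lambda>u. f u + g u) = (\<lambda>u. (tr ^^ n) f u + (tr ^^ n) g u)"
  by (induction n) (auto simp: tr_add)

lemma trn_scale: "(tr ^^ n) (\<lambda>u. a * f u) = (\<lambda>u. a * (tr ^^ n) f u :: 'b::comm_semiring_0)"
  by (induction n) (auto simp: tr_scale)

lemma trn_zero: "(tr ^^ n) (\<lambda>u. 0) = (\<lambda>u. 0)"
  by (induction n) auto

lemma trn_lincomb: "(tr ^^ n) (\<lambda>u. a * f u + b * g u) = (\<lambda>u. a * (tr ^^ n) f u + b * (tr ^^ n) g u :: 'b::comm_semiring_0)"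
  by (simp only: trn_add trn_scale)

lemma trn_mono:
  assumes "\<And>u. u \<in> \<X> \<Longrightarrow> f u \<le> (g u :: 'b::ordered_comm_monoid_add)" "u \<in> \<X>"
  shows "(tr ^^ n) f u \<le> (tr ^^ n) g u"
  using assms(2) by (induction n arbitrary: u) (use assms(1) in \<open>auto intro!: tr_mono\<close>)

lemma tr_gb_fun: "y \<in> J \<Longrightarrow> tr (gb y) = (\<lambda>u. gb 0 u + turn y * gb (\<tau> y) u :: 'b::ring_1)"
  by (rule ext) (rule tr_gb)

lemma gb_1_fun: "gb 1 = (\<lambda>u. 0)"
  by (rule ext) (rule gb_1)

lemma C_tr: "f \<in> C \<Longrightarrow> tr f \<in> C"
proof (induction rule: C_induct)
  case zero
  show ?case by (simp add: C_zero)
next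
  case (add f y a)
  have "(\<lambda>u. 1 * gb 0 u + turn y * gb (\<tau> y) u) \<in> C"
    by (rule C_lincomb[OF C_gb C_gb]) (use add J_\<tau> in auto)
  hence "(\<lambda>u. 1 * tr f u + a * (gb 0 u + turn y * gb (\<tau> y) u)) \<in> C"
    using add by (intro C_lincomb) auto
  thus ?case using add by (simp add: tr_add tr_scale tr_gb_fun)
qed

lemma C_trn: "f \<in> C \<Longrightarrow> (tr ^^ n) f \<in> C"
  by (induction n) (auto simp: C_tr)

lemma turn_square: "turn y * turn y = (1 :: 'b::ring_1)"
  by (simp add: turn_def)

lemma tr_gb_c: "tr (gb c) = (gb 0 :: _ \<Rightarrow> 'b::ring_1)"
  by (simp add: tr_gb_fun gb_1_fun)

lemma C_tr_surj: "f \<in> C \<Longrightarrow> \<exists>g\<in>C. tr g = f"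
proof (induction rule: C_induct)
  case zero
  show ?case using C_zero tr_zero by blast
next
  case (add f y a)
  then obtain g where g: "g \<in> C" "tr g = f" by blast
  define y' where "y' = rb y"
  have y': "y' \<in> I" "\<tau> y' = y" using rb[of y] J_subset[OF add(2)] c_bounds by (auto simp: y'_def)
  have y'J: "y' \<in> J" using J_iff[OF y'(1)] y'(2) add(2) by simp
  \<comment> \<open>As \<open>tr (gb c) = gb 0\<close>, subtracting \<open>gb c\<close> cancels the
    constant in the transfer of \<open>gb y'\<close> and leaves \<open>gb y\<close> up to
    sign.\<close>
  define h :: "real \<times> bool \<Rightarrow> int" where "h u = gb y' u + (- 1) * gb c u" for u
  have h: "h \<in> C" unfolding h_def using C_lincomb[OF C_gb[OF y'J] C_gb[of c], of 1 "- 1"] by simp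
  have "tr h = (\<lambda>u. turn y' * gb y u)"
    unfolding h_def by (simp only: tr_add tr_scale tr_gb_fun[OF y'J] tr_gb_c y'(2)) (simp add: fun_eq_iff)
  hence "tr (\<lambda>u. 1 * g u + (a * turn y') * h u) = (\<lambda>u. f u + a * (turn y' * turn y') * gb y u)"
    by (simp only: tr_add tr_scale g) (simp add: fun_eq_iff mult_ac)
  hence "tr (\<lambda>u. 1 * g u + (a * turn y') * h u) = (\<lambda>u. f u + a * gb y u)" by (simp add: turn_square)
  moreover have "(\<lambda>u. 1 * g u + (a * turn y') * h u) \<in> C" by (rule C_lincomb[OF g(1) h])
  ultimately show ?case by blast
qed

subsection \<open>The group structure\<close>

abbreviation D :: "(real \<times> bool \<Rightarrow> int) set unital_ordered_group" where "D \<equiv> DG \<tau> c"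

abbreviation cl :: "(real \<times> bool \<Rightarrow> int) \<Rightarrow> (real \<times> bool \<Rightarrow> int) set" where
  "cl \<equiv> dim_class (split_topology \<tau> c) (local_homeo \<tau> c)"

abbreviation rel :: "((real \<times> bool \<Rightarrow> int) \<times> (real \<times> bool \<Rightarrow> int)) set" where
  "rel \<equiv> dim_rel (split_topology \<tau> c) (local_homeo \<tau> c)"

lemma transfer_fun: "transfer (split_topology \<tau> c) (local_homeo \<tau> c) = tr"
  by (rule ext) (rule transfer_eq)

lemma rel_iff: "(f, g) \<in> rel \<longleftrightarrow> f \<in> C \<and> g \<in> C \<and> (\<exists>n. (tr ^^ n) f = (tr ^^ n) g)"
  by (simp add: dim_rel_def transfer_fun)

lemma trn_eq_later: "(tr ^^ n) f = (tr ^^ n) g \<Longrightarrow> (tr ^^ (m + n)) f = (tr ^^ (m + n)) g"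
  by (simp add: funpow_add)

lemma rel_equiv: "equiv C rel"
proof (rule equivI)
  show "rel \<subseteq> C \<times> C" by (auto simp: rel_iff)
  show "refl_on C rel" by (rule refl_onI) (auto simp: rel_iff)
  show "sym rel" by (rule symI) (auto simp: rel_iff dest: sym)
  show "trans rel"
  proof (rule transI)
    fix f g h assume "(f, g) \<in> rel" "(g, h) \<in> rel"
    then obtain n m where "f \<in> C" "h \<in> C" "(tr ^^ n) f = (tr ^^ n) g" "(tr ^^ m) g = (tr ^^ m) h"
      by (auto simp: rel_iff)
    hence "(tr ^^ (m + n)) f = (tr ^^ (m + n)) h"
      using trn_eq_later[of n f g m] trn_eq_later[of m g h n] by (simp add: add.commute)
    with \<open>f \<in> C\<close> \<open>h \<in> C\<close> show "(f, h) \<in> rel" by (auto simp: rel_iff)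
  qed
qed

lemma cl_eq_iff: "f \<in> C \<Longrightarrow> g \<in> C \<Longrightarrow> cl f = cl g \<longleftrightarrow> (\<exists>n. (tr ^^ n) f = (tr ^^ n) g)"
  unfolding dim_class_def using eq_equiv_class_iff[OF rel_equiv, of f g] by (simp add: rel_iff)

lemma mem_cl: "f \<in> C \<Longrightarrow> g \<in> cl f \<longleftrightarrow> g \<in> C \<and> cl g = cl f"
  using cl_eq_iff[of f g] cl_eq_iff[of g f] unfolding dim_class_def Image_singleton_iff rel_iff by auto

lemma carrier_D: "carrier D = cl ` C"
  unfolding DG_def dim_group_def by (auto simp: quotient_def dim_class_def)

lemma cl_closed: "f \<in> C \<Longrightarrow> cl f \<in> carrier D"
  by (simp add: carrier_D)

lemma cl_add_cong:
  assumes "f \<in> C" "g \<in> C" "f' \<in> C" "g' \<in> C" "cl f = cl f'" "cl g = cl g'"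
  shows "cl (\<lambda>u. f u + g u) = cl (\<lambda>u. f' u + g' u)"
proof -
  obtain n m where n: "(tr ^^ n) f = (tr ^^ n) f'" and m: "(tr ^^ m) g = (tr ^^ m) g'"
    using assms cl_eq_iff by meson
  have "(tr ^^ (m + n)) (\<lambda>u. f u + g u) = (tr ^^ (m + n)) (\<lambda>u. f' u + g' u)"
    using trn_eq_later[OF n, of m] trn_eq_later[OF m, of n] by (simp add: trn_add add.commute[of n m])
  thus ?thesis using assms by (subst cl_eq_iff) (auto intro: C_add)
qed

lemma mult_D: assumes "f \<in> C" "g \<in> C" shows "cl f \<otimes>\<^bsub>D\<^esub> cl g = cl (\<lambda>u. f u + g u)"
proof -
  have "cl f \<otimes>\<^bsub>D\<^esub> cl g = (\<Union>f'\<in>cl f. \<Union>g'\<in>cl g. cl (\<lambda>u. f' u + g' u))"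
    by (simp add: DG_def dim_group_def)
  also have "\<dots> = (\<Union>f'\<in>cl f. \<Union>g'\<in>cl g. cl (\<lambda>u. f u + g u))"
    using assms by (intro SUP_cong refl cl_add_cong) (auto simp: mem_cl)
  also have "\<dots> = cl (\<lambda>u. f u + g u)" using assms mem_cl[of f f] mem_cl[of g g] by auto
  finally show ?thesis .
qed

lemma one_D: "\<one>\<^bsub>D\<^esub> = cl (\<lambda>u. 0)"
  by (simp add: DG_def dim_group_def)

lemma D_comm_group: "comm_group D"
proof (rule comm_groupI)
  fix x assume "x \<in> carrier D"
  then obtain f where f: "f \<in> C" "x = cl f" by (auto simp: carrier_D)
  have "cl (\<lambda>u. (- 1) * f u) \<otimes>\<^bsub>D\<^esub> x = \<one>\<^bsub>D\<^esub>" using f C_scale[OF f(1), of "- 1"] by (simp add: mult_D one_D)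
  thus "\<exists>y\<in>carrier D. y \<otimes>\<^bsub>D\<^esub> x = \<one>\<^bsub>D\<^esub>" using cl_closed[OF C_scale[OF f(1), of "- 1"]] by blast
qed (auto simp: carrier_D mult_D one_D C_zero C_add add.assoc add.commute add.left_commute intro!: imageI)

lemma inv_D: "f \<in> C \<Longrightarrow> inv\<^bsub>D\<^esub> (cl f) = cl (\<lambda>u. - f u)"
proof -
  interpret D: comm_group D by (rule D_comm_group)
  assume f: "f \<in> C"
  have f': "(\<lambda>u. - f u) \<in> C" using C_scale[OF f, of "- 1"] by simp
  show ?thesis by (rule D.inv_equality) (use f f' in \<open>auto simp: mult_D one_D cl_closed\<close>)
qed

lemma nat_pow_D: "f \<in> C \<Longrightarrow> cl f [^]\<^bsub>D\<^esub> (n::nat) = cl (\<lambda>u. int n * f u)"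
proof (induction n)
  case 0
  thus ?case by (simp add: one_D)
next
  case (Suc n)
  have "cl (\<lambda>u. int n * f u) \<otimes>\<^bsub>D\<^esub> cl f = cl (\<lambda>u. int n * f u + f u)"
    by (rule mult_D[OF C_scale[OF Suc.prems] Suc.prems])
  thus ?case using Suc by (simp add: algebra_simps)
qed

lemma int_pow_D: assumes f: "f \<in> C" shows "cl f [^]\<^bsub>D\<^esub> (k::int) = cl (\<lambda>u. k * f u)"
proof -
  interpret D: comm_group D by (rule D_comm_group)
  show ?thesis
  proof (cases k rule: int_cases2)
    case (nonneg n)
    thus ?thesis using f by (simp add: int_pow_int nat_pow_D)
  next
    case (nonpos n)
    have "cl f [^]\<^bsub>D\<^esub> (- int n) = inv\<^bsub>D\<^esub> (cl f [^]\<^bsub>D\<^esub> n)"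
      using D.int_pow_neg_int[OF cl_closed[OF f]] by simp
    thus ?thesis using f nonpos C_scale[OF f, of "int n"] by (simp add: nat_pow_D inv_D)
  qed
qed

lemma Lstar_cl: assumes f: "f \<in> C" shows "Lstar \<tau> c (cl f) = cl (tr f)"
proof -
  have "cl (tr g) = cl (tr f)" if g: "g \<in> cl f" for g
  proof -
    have gC: "g \<in> C" "cl g = cl f" using mem_cl[OF f] g by auto
    then obtain n where "(tr ^^ n) g = (tr ^^ n) f" using cl_eq_iff[OF gC(1) f] by blast
    hence "(tr ^^ n) (tr g) = (tr ^^ n) (tr f)" by (simp add: funpow_swap1[symmetric])
    thus ?thesis using C_tr f gC by (subst cl_eq_iff) auto
  qed
  hence "(\<Union>g\<in>cl f. cl (tr g)) = (\<Union>g\<in>cl f. cl (tr f))" by (intro SUP_cong) auto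
  also have "\<dots> = cl (tr f)" using mem_cl[OF f, of f] f by auto
  finally show ?thesis by (simp add: Lstar_def dim_transfer_def transfer_fun)
qed

text \<open>Injectivity is built into the relation, which ignores finitely many transfers;
  surjectivity comes from \<open>C_tr_surj\<close>.\<close>

lemma Lstar_iso: "Lstar \<tau> c \<in> iso D D"
proof (rule isoI)
  show "Lstar \<tau> c \<in> hom D D"
    by (rule homI) (auto simp: carrier_D mult_D Lstar_cl C_tr C_add tr_add intro!: imageI)
  show "bij_betw (Lstar \<tau> c) (carrier D) (carrier D)"
    unfolding bij_betw_def
  proof
    show "inj_on (Lstar \<tau> c) (carrier D)"
    proof (rule inj_onI)
      fix x y assume "x \<in> carrier D" "y \<in> carrier D" and eq: "Lstar \<tau> c x = Lstar \<tau> c y"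
      then obtain f g where fg: "f \<in> C" "g \<in> C" "x = cl f" "y = cl g" by (auto simp: carrier_D)
      have "cl (tr f) = cl (tr g)" using eq fg by (simp add: Lstar_cl)
      then obtain n where "(tr ^^ n) (tr f) = (tr ^^ n) (tr g)" using fg by (subst (asm) cl_eq_iff) (auto simp: C_tr)
      hence "(tr ^^ Suc n) f = (tr ^^ Suc n) g" by (simp add: funpow_swap1)
      thus "x = y" unfolding fg using cl_eq_iff[OF fg(1,2)] by blast
    qed
    show "Lstar \<tau> c ` carrier D = carrier D"
    proof (intro equalityI subsetI)
      fix x assume "x \<in> Lstar \<tau> c ` carrier D"
      thus "x \<in> carrier D" by (auto simp: carrier_D Lstar_cl C_tr)
    next
      fix x assume "x \<in> carrier D"
      then obtain f where f: "f \<in> C" "x = cl f" by (auto simp: carrier_D)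
      obtain g where "g \<in> C" "tr g = f" using C_tr_surj[OF f(1)] by blast
      thus "x \<in> Lstar \<tau> c ` carrier D" using f Lstar_cl[of g] cl_closed[of g] by (metis imageI)
    qed
  qed
qed

lemma gb_0_eq: "gb 0 = indicator \<X>"
proof
  fix u
  show "gb 0 u = indicator \<X> u" using gb_0[of u] by (cases "u \<in> \<X>") (auto simp: gb_def)
qed

lemma order_unit_D: "order_unit D = cl (gb 0)"
  by (simp add: DG_def dim_group_def gb_0_eq)

lemma tr_nonneg: "(\<And>u. 0 \<le> f u) \<Longrightarrow> 0 \<le> (tr f u :: 'b::ordered_comm_monoid_add)"
  by (auto simp: tr_def)

lemma trn_nonneg: "(\<And>u. 0 \<le> f u) \<Longrightarrow> 0 \<le> ((tr ^^ n) f u :: 'b::ordered_comm_monoid_add)"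
  by (induction n arbitrary: u) (auto intro: tr_nonneg)

text \<open>Positivity is independent of the representative, because further transfers keep a
  function nonnegative.\<close>

lemma Pos_D_iff: assumes f: "f \<in> C" shows "cl f \<in> Pos D \<longleftrightarrow> (\<exists>n. \<forall>u. 0 \<le> (tr ^^ n) f u)"
proof
  assume "cl f \<in> Pos D"
  then obtain g n where g: "g \<in> C" "cl f = cl g" "\<forall>u. 0 \<le> (tr ^^ n) g u"
    by (auto simp: DG_def dim_group_def transfer_fun)
  obtain m where m: "(tr ^^ m) f = (tr ^^ m) g" using cl_eq_iff[OF f g(1)] g(2) by blast
  have "0 \<le> (tr ^^ (m + n)) g u" for u
    unfolding funpow_add comp_apply by (rule trn_nonneg) (use g(3) in blast)
  moreover have "(tr ^^ (m + n)) f = (tr ^^ (m + n)) g" using trn_eq_later[OF m, of n] by (simp add: add.commute)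
  ultimately show "\<exists>n. \<forall>u. 0 \<le> (tr ^^ n) f u" by metis
next
  assume "\<exists>n. \<forall>u. 0 \<le> (tr ^^ n) f u"
  thus "cl f \<in> Pos D" using f by (auto simp: DG_def dim_group_def transfer_fun)
qed

sublocale GA: group_automorphism "DG \<tau> c" "Lstar \<tau> c"
  using D_comm_group Lstar_iso by (simp add: group_automorphism_def group_automorphism_axioms_def)

section \<open>The unit generates the group freely over the Laurent polynomials\<close>

abbreviation ev1 :: "laurent \<Rightarrow> (real \<times> bool \<Rightarrow> int) set" where
  "ev1 p \<equiv> laurent_apply (DG \<tau> c) (Lstar \<tau> c) p (I01 \<tau> c)"

lemma unit_closed: "I01 \<tau> c \<in> carrier D"
  by (simp add: order_unit_D cl_closed C_gb)

lemma ap_unit: "0 \<le> k \<Longrightarrow> GA.ap k (I01 \<tau> c) = cl ((tr ^^ nat k) (gb 0))"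
proof -
  have "(Lstar \<tau> c ^^ n) (I01 \<tau> c) = cl ((tr ^^ n) (gb 0))" for n
    by (induction n) (auto simp: order_unit_D Lstar_cl C_trn C_gb)
  thus "0 \<le> k \<Longrightarrow> ?thesis" by (simp add: aut_power_def)
qed

lemma ev1_surj: "range ev1 = carrier D"
proof (intro equalityI subsetI)
  fix x assume "x \<in> range ev1"
  thus "x \<in> carrier D" using GA.ev_closed[OF unit_closed] by auto
next
  interpret E: group_hom laurent_group D ev1 by (rule GA.ev_group_hom[OF unit_closed])
  have mult: "x \<otimes>\<^bsub>D\<^esub> y \<in> range ev1" if "x \<in> range ev1" "y \<in> range ev1" for x y
    using that GA.ev_add[OF unit_closed, symmetric] by auto
  have pow': "ev1 p [^]\<^bsub>D\<^esub> (k::int) \<in> range ev1" for p k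
  proof (rule range_eqI)
    show "ev1 p [^]\<^bsub>D\<^esub> k = ev1 (p [^]\<^bsub>laurent_group\<^esub> k)"
      by (rule E.hom_int_pow[symmetric]) simp
  qed
  have pow: "x [^]\<^bsub>D\<^esub> (k::int) \<in> range ev1" if "x \<in> range ev1" for x k
    using that by (elim rangeE) (simp only: pow')
  have gb0: "cl (gb 0) \<in> range ev1"
    using GA.ev_single[OF unit_closed, of 0 1] unit_closed
    by (metis GA.ap_0 GA.int_pow_1 order_unit_D rangeI)
  \<comment> \<open>With the unit in the range, the transfer formula expresses each of the two
    classes through the other; the way back from \<open>\<tau> y\<close> to \<open>y\<close> uses
    the inverse automorphism.\<close>
  have step: "cl (gb y) \<in> range ev1 \<longleftrightarrow> cl (gb (\<tau> y)) \<in> range ev1" if y: "y \<in> J" for y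
  proof -
    have yC: "gb y \<in> C" "gb (\<tau> y) \<in> C" "gb 0 \<in> C" using y J_\<tau> by (auto intro: C_gb)
    have L: "Lstar \<tau> c (cl (gb y)) = cl (\<lambda>u. gb 0 u + turn y * gb (\<tau> y) u)"
      by (simp add: Lstar_cl yC tr_gb_fun[OF y])
    also have "\<dots> = cl (gb 0) \<otimes>\<^bsub>D\<^esub> cl (gb (\<tau> y)) [^]\<^bsub>D\<^esub> (turn y :: int)"
      using yC by (simp add: int_pow_D mult_D C_scale)
    finally have L': "Lstar \<tau> c (cl (gb y)) = cl (gb 0) \<otimes>\<^bsub>D\<^esub> cl (gb (\<tau> y)) [^]\<^bsub>D\<^esub> (turn y :: int)" .
    show ?thesis
    proof
      assume "cl (gb y) \<in> range ev1"
      then obtain p where p: "cl (gb y) = ev1 p" by blast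
      have "Lstar \<tau> c (cl (gb y)) \<in> range ev1"
        unfolding p by (rule GA.ev_image_closed(1)[OF unit_closed])
      \<comment> \<open>The transfer formula solved for \<open>gb (\<tau> y)\<close>; the
        orientation sign is its own inverse.\<close>
      hence "Lstar \<tau> c (cl (gb y)) [^]\<^bsub>D\<^esub> (turn y :: int) \<otimes>\<^bsub>D\<^esub> cl (gb 0) [^]\<^bsub>D\<^esub> (- turn y :: int) \<in> range ev1"
        by (intro mult pow gb0 \<open>Lstar \<tau> c (cl (gb y)) \<in> range ev1\<close>)
      moreover have "Lstar \<tau> c (cl (gb y)) [^]\<^bsub>D\<^esub> (turn y :: int) \<otimes>\<^bsub>D\<^esub> cl (gb 0) [^]\<^bsub>D\<^esub> (- turn y :: int)
          = cl (\<lambda>u. turn y * (gb 0 u + turn y * gb (\<tau> y) u) + (- turn y) * gb 0 u)"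
        unfolding L using yC C_lincomb[OF yC(3) yC(2), of 1 "turn y"]
        by (simp add: int_pow_D mult_D C_scale del: mult_minus_left)
      moreover have "(\<lambda>u. turn y * (gb 0 u + turn y * gb (\<tau> y) u) + (- turn y) * gb 0 u) = (gb (\<tau> y) :: _ \<Rightarrow> int)"
        by (rule ext) (simp add: turn_def)
      ultimately show "cl (gb (\<tau> y)) \<in> range ev1" by simp
    next
      assume "cl (gb (\<tau> y)) \<in> range ev1"
      hence "Lstar \<tau> c (cl (gb y)) \<in> range ev1" unfolding L' by (intro mult pow gb0)
      then obtain p where p: "Lstar \<tau> c (cl (gb y)) = ev1 p" by blast
      have "GA.\<phi>inv (Lstar \<tau> c (cl (gb y))) \<in> range ev1"
        unfolding p by (rule GA.ev_image_closed(2)[OF unit_closed])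
      thus "cl (gb y) \<in> range ev1" using GA.\<phi>inv(3)[OF cl_closed[OF yC(1)]] by simp
    qed
  qed
  have step_n: "cl (gb y) \<in> range ev1 \<longleftrightarrow> cl (gb ((\<tau> ^^ n) y)) \<in> range ev1" if y: "y \<in> J" for y n
    using y
  proof (induction n arbitrary: y)
    case (Suc n)
    have "cl (gb y) \<in> range ev1 \<longleftrightarrow> cl (gb (\<tau> y)) \<in> range ev1" by (rule step[OF Suc.prems])
    also have "\<dots> \<longleftrightarrow> cl (gb ((\<tau> ^^ n) (\<tau> y))) \<in> range ev1" by (rule Suc.IH[OF J_\<tau>[OF Suc.prems]])
    finally show ?case by (simp add: funpow_swap1)
  qed simp
  have gb: "cl (gb y) \<in> range ev1" if y: "y \<in> J" for y
  proof -
    obtain m n where mn: "(\<tau> ^^ m) y = (\<tau> ^^ n) c" using y unfolding J_eq by blast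
    have "cl (gb c) \<in> range ev1" using step_n[of c 2] gb0 orbit_2 by simp
    hence "cl (gb ((\<tau> ^^ n) c)) \<in> range ev1" using step_n[of c n] by simp
    thus ?thesis using step_n[OF y, of m] mn by simp
  qed
  have "cl f \<in> range ev1" if "f \<in> C" for f
    using that
  proof (induction rule: C_induct)
    case zero
    have "cl (gb 0) [^]\<^bsub>D\<^esub> (0::int) \<in> range ev1" using pow gb0 by blast
    thus ?case unfolding int_pow_D[OF C_gb[OF J_members(2)]] by simp
  next
    case (add f y a)
    have "cl f \<otimes>\<^bsub>D\<^esub> cl (gb y) [^]\<^bsub>D\<^esub> a \<in> range ev1" by (intro mult pow add gb)
    thus ?case using add C_gb[OF add(2)] by (simp add: int_pow_D mult_D C_scale)
  qed
  thus "x \<in> range ev1" if "x \<in> carrier D" for x using that by (auto simp: carrier_D)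
qed

text \<open>Each transfer moves the leading step one place along the orbit of 0 and multiplies its
  coefficient by an orientation sign. The other steps stay at earlier orbit points, and all
  constants collect at index 0.\<close>

lemma tr_iterates:
  "\<exists>a. (tr ^^ Suc n) (gb 0) = (\<lambda>u. a (Suc n) * gb ((\<tau> ^^ Suc n) 0) u + (\<Sum>j\<le>n. a j * gb ((\<tau> ^^ j) 0) u) :: int)
    \<and> (a (Suc n) = 1 \<or> a (Suc n) = - 1)"
proof -
  define e where "e n = (\<Prod>j<n. turn ((\<tau> ^^ j) 0) :: int)" for n
  have e: "e n = 1 \<or> e n = - 1" for n
    by (induction n) (auto simp: e_def turn_def)
  have ex: "\<exists>b. (tr ^^ n) (gb 0) = (\<lambda>u. e n * gb ((\<tau> ^^ n) 0) u + (\<Sum>j<n. b j * gb ((\<tau> ^^ j) 0) u))" for n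
  proof (induction n)
    case 0
    show ?case by (auto simp: e_def)
  next
    case (Suc n)
    then obtain b where b: "(tr ^^ n) (gb 0) = (\<lambda>u. e n * gb ((\<tau> ^^ n) 0) u + (\<Sum>j<n. b j * gb ((\<tau> ^^ j) 0) u))" by blast
    have trsum: "tr (\<lambda>u. \<Sum>j<m. b j * gb ((\<tau> ^^ j) 0) u)
        = (\<lambda>u. \<Sum>j<m. b j * (gb 0 u + turn ((\<tau> ^^ j) 0) * gb ((\<tau> ^^ Suc j) 0) u))" for m
      by (induction m) (simp_all add: tr_add tr_scale tr_gb_fun)
    define b' where "b' j = (if j = 0 then e n + (\<Sum>j<n. b j) else b (j - 1) * turn ((\<tau> ^^ (j - 1)) 0))" for j
    have "(tr ^^ Suc n) (gb 0) = tr (\<lambda>u. e n * gb ((\<tau> ^^ n) 0) u + (\<Sum>j<n. b j * gb ((\<tau> ^^ j) 0) u))"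
      by (simp add: b)
    also have "\<dots> = (\<lambda>u. e n * (gb 0 u + turn ((\<tau> ^^ n) 0) * gb ((\<tau> ^^ Suc n) 0) u)
        + (\<Sum>j<n. b j * (gb 0 u + turn ((\<tau> ^^ j) 0) * gb ((\<tau> ^^ Suc j) 0) u)))"
      by (simp add: tr_add tr_scale tr_gb_fun trsum)
    also have "\<dots> = (\<lambda>u. e (Suc n) * gb ((\<tau> ^^ Suc n) 0) u + (\<Sum>j<Suc n. b' j * gb ((\<tau> ^^ j) 0) u))"
    proof
      fix u
      have "(\<Sum>j<Suc n. b' j * gb ((\<tau> ^^ j) 0) u) = b' 0 * gb 0 u + (\<Sum>j<n. b' (Suc j) * gb ((\<tau> ^^ Suc j) 0) u)"
        by (subst sum.lessThan_Suc_shift) simp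
      also have "\<dots> = (e n + (\<Sum>j<n. b j)) * gb 0 u + (\<Sum>j<n. b j * turn ((\<tau> ^^ j) 0) * gb ((\<tau> ^^ Suc j) 0) u)"
        by (simp add: b'_def)
      finally have *: "(\<Sum>j<Suc n. b' j * gb ((\<tau> ^^ j) 0) u)
          = (e n + (\<Sum>j<n. b j)) * gb 0 u + (\<Sum>j<n. b j * turn ((\<tau> ^^ j) 0) * gb ((\<tau> ^^ Suc j) 0) u)" .
      show "e n * (gb 0 u + turn ((\<tau> ^^ n) 0) * gb ((\<tau> ^^ Suc n) 0) u)
        + (\<Sum>j<n. b j * (gb 0 u + turn ((\<tau> ^^ j) 0) * gb ((\<tau> ^^ Suc j) 0) u))
        = e (Suc n) * gb ((\<tau> ^^ Suc n) 0) u + (\<Sum>j<Suc n. b' j * gb ((\<tau> ^^ j) 0) u)"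
        unfolding * by (simp add: e_def distrib_left distrib_right sum.distrib sum_distrib_right mult.assoc)
    qed
    finally show ?case by blast
  qed
  obtain b where "(tr ^^ Suc n) (gb 0) = (\<lambda>u. e (Suc n) * gb ((\<tau> ^^ Suc n) 0) u + (\<Sum>j<Suc n. b j * gb ((\<tau> ^^ j) 0) u))"
    using ex by blast
  thus ?thesis using e[of "Suc n"]
    by (intro exI[of _ "\<lambda>j. if j = Suc n then e (Suc n) else b j"]) (auto simp: lessThan_Suc_atMost)
qed

lemma jump_orbit: "0 < n \<Longrightarrow> jump (gb ((\<tau> ^^ j) 0)) ((\<tau> ^^ n) 0) = (of_bool (j = n) :: int)"
  using orbit_0_inj[of j n] orbit_0_neq_0[of n] orbit_0_neq_1[of n] by (subst jump_gb) auto

lemma jump_iterate: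
  assumes "k \<le> n" "0 < n"
  shows "jump ((tr ^^ k) (gb 0)) ((\<tau> ^^ n) 0) = (0::int) \<longleftrightarrow> k < n"
proof (cases k)
  case 0
  thus ?thesis using jump_orbit[OF assms(2), of 0] assms by simp
next
  case (Suc m)
  obtain a where a: "(tr ^^ Suc m) (gb 0) = (\<lambda>u. a (Suc m) * gb ((\<tau> ^^ Suc m) 0) u + (\<Sum>j\<le>m. a j * gb ((\<tau> ^^ j) 0) u) :: int)"
    and am: "a (Suc m) = 1 \<or> a (Suc m) = - 1" using tr_iterates[of m] by blast
  have "jump ((tr ^^ k) (gb 0)) ((\<tau> ^^ n) 0) = a (Suc m) * jump (gb ((\<tau> ^^ Suc m) 0)) ((\<tau> ^^ n) 0)
      + (\<Sum>j\<le>m. a j * jump (gb ((\<tau> ^^ j) 0)) ((\<tau> ^^ n) 0))"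
    unfolding Suc a jump_def by (simp add: sum_subtractf[symmetric] right_diff_distrib)
  also have "\<dots> = a (Suc m) * of_bool (Suc m = n) + (\<Sum>j\<le>m. a j * of_bool (j = n))"
    by (simp only: jump_orbit[OF assms(2)])
  also have "(\<Sum>j\<le>m. a j * of_bool (j = n)) = 0" using assms(1) Suc by (intro sum.neutral) auto
  finally show ?thesis using am assms(1) Suc by auto
qed

lemma ev1_inj:
  assumes "ev1 p = \<one>\<^bsub>D\<^esub>"
  shows "p = 0"
proof (rule ccontr)
  assume p0: "p \<noteq> 0"
  define K where "K = Poly_Mapping.keys p"
  define a where "a k = Poly_Mapping.lookup p k" for k
  have K: "finite K" "K \<noteq> {}" using p0 by (auto simp: K_def)
  define M where "M = Max K"
  have M: "M \<in> K" "\<And>k. k \<in> K \<Longrightarrow> k \<le> M" using K by (auto simp: M_def)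
  \<comment> \<open>This power of the automorphism makes all exponents positive.\<close>
  define N where "N = nat (1 - Min K)"
  have N: "0 < k + int N" if "k \<in> K" for k
    using Min_le[OF K(1) that] unfolding N_def by linarith
  have *: "(Lstar \<tau> c ^^ N) (finprod D (\<lambda>k. GA.ap k (I01 \<tau> c) [^]\<^bsub>D\<^esub> a k) K')
      = cl (\<lambda>u. \<Sum>k\<in>K'. a k * (tr ^^ nat (k + int N)) (gb 0) u) \<and> (\<lambda>u. \<Sum>k\<in>K'. a k * (tr ^^ nat (k + int N)) (gb 0) u) \<in> C"
    if "K' \<subseteq> K" for K'
    using finite_subset[OF that K(1)] that
  proof (induction K' rule: finite_induct)
    case empty
    have "(Lstar \<tau> c ^^ n) (cl (\<lambda>u. 0)) = cl (\<lambda>u. 0)" for n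
      by (induction n) (auto simp: Lstar_cl C_zero)
    thus ?case by (simp add: one_D C_zero)
  next
    case (insert k K')
    have mult: "(Lstar \<tau> c ^^ n) (x \<otimes>\<^bsub>D\<^esub> y) = (Lstar \<tau> c ^^ n) x \<otimes>\<^bsub>D\<^esub> (Lstar \<tau> c ^^ n) y"
      if "x \<in> carrier D" "y \<in> carrier D" for x y n
      using that by (induction n) (auto simp: GA.\<phi>_mult GA.funpow_closed)
    have pow: "(Lstar \<tau> c ^^ n) (x [^]\<^bsub>D\<^esub> i) = (Lstar \<tau> c ^^ n) x [^]\<^bsub>D\<^esub> i"
      if "x \<in> carrier D" for x n and i :: int
      using that by (induction n) (auto simp: GA.\<phi>_int_pow GA.funpow_closed)
    have apc: "GA.ap j (I01 \<tau> c) \<in> carrier D" for j by (rule GA.ap_closed[OF unit_closed])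
    have kN: "0 \<le> k + int N" using N[of k] insert by auto
    have tC: "(tr ^^ nat (k + int N)) (gb 0) \<in> C" by (simp add: C_trn C_gb)
    have ins: "finprod D (\<lambda>k. GA.ap k (I01 \<tau> c) [^]\<^bsub>D\<^esub> a k) (insert k K')
        = GA.ap k (I01 \<tau> c) [^]\<^bsub>D\<^esub> a k \<otimes>\<^bsub>D\<^esub> finprod D (\<lambda>k. GA.ap k (I01 \<tau> c) [^]\<^bsub>D\<^esub> a k) K'"
      by (rule GA.finprod_insert) (use insert apc in auto)
    have "(Lstar \<tau> c ^^ N) (finprod D (\<lambda>k. GA.ap k (I01 \<tau> c) [^]\<^bsub>D\<^esub> a k) (insert k K'))
        = (Lstar \<tau> c ^^ N) (GA.ap k (I01 \<tau> c) [^]\<^bsub>D\<^esub> a k)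
          \<otimes>\<^bsub>D\<^esub> (Lstar \<tau> c ^^ N) (finprod D (\<lambda>k. GA.ap k (I01 \<tau> c) [^]\<^bsub>D\<^esub> a k) K')"
      unfolding ins by (rule mult) (auto intro!: GA.finprod_closed simp: apc)
    also have "(Lstar \<tau> c ^^ N) (GA.ap k (I01 \<tau> c) [^]\<^bsub>D\<^esub> a k) = cl (\<lambda>u. a k * (tr ^^ nat (k + int N)) (gb 0) u)"
      unfolding pow[OF apc] GA.funpow_ap[OF unit_closed] ap_unit[OF kN] by (rule int_pow_D[OF tC])
    finally show ?case using insert C_scale[OF tC, of "a k"] by (auto simp: mult_D C_add)
  qed
  define g where "g u = (\<Sum>k\<in>K. a k * (tr ^^ nat (k + int N)) (gb 0) u)" for u
  have g: "(Lstar \<tau> c ^^ N) (ev1 p) = cl g" "g \<in> C"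
    using *[OF order_refl] unfolding g_def laurent_apply_def K_def a_def by auto
  have "(Lstar \<tau> c ^^ N) (cl (\<lambda>u. 0)) = cl (\<lambda>u. 0)"
    by (induction N) (auto simp: Lstar_cl C_zero)
  hence "cl g = cl (\<lambda>u. 0)" using g(1) assms by (simp add: one_D)
  then obtain n where n: "(tr ^^ n) g = (\<lambda>u. 0)" using cl_eq_iff[OF g(2) C_zero] trn_zero by metis
  have trn_sum: "(tr ^^ n) (\<lambda>u. \<Sum>k\<in>K'. f k u) = (\<lambda>u. \<Sum>k\<in>K'. (tr ^^ n) (f k) u)" if "finite K'"
    for K' :: "int set" and f :: "int \<Rightarrow> real \<times> bool \<Rightarrow> int"
    using that by (induction K' rule: finite_induct) (auto simp: trn_add trn_zero)
  \<comment> \<open>The exponents after \<open>n\<close> more transfers. Only \<open>M\<close>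
    attains the largest one, so the jump at \<open>(\<tau> ^^ d M) 0\<close> isolates the leading
    coefficient; \<open>d M > 0\<close> is needed because 0 is not split.\<close>
  define d where "d k = n + nat (k + int N)" for k
  have tg: "(tr ^^ n) g = (\<lambda>u. \<Sum>k\<in>K. a k * (tr ^^ d k) (gb 0) u)"
    unfolding g_def trn_sum[OF K(1)] trn_scale d_def funpow_add comp_apply ..
  have dM: "0 < d M" using N[OF M(1)] by (simp add: d_def)
  have "0 = jump ((tr ^^ n) g) ((\<tau> ^^ d M) 0)" unfolding n by (simp add: jump_def)
  also have "\<dots> = (\<Sum>k\<in>K. a k * jump ((tr ^^ d k) (gb 0)) ((\<tau> ^^ d M) 0))"
    unfolding tg jump_def by (simp add: sum_subtractf[symmetric] right_diff_distrib)
  also have "\<dots> = (\<Sum>k\<in>K. if k = M then a M * jump ((tr ^^ d M) (gb 0)) ((\<tau> ^^ d M) 0) else 0)"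
  proof (intro sum.cong refl)
    fix k assume k: "k \<in> K"
    have "jump ((tr ^^ d k) (gb 0)) ((\<tau> ^^ d M) 0) = (0::int)" if "k \<noteq> M"
    proof -
      have "d k < d M" using M(2)[OF k] that N[OF k] unfolding d_def by linarith
      thus ?thesis using jump_iterate[of "d k" "d M"] dM by simp
    qed
    thus "a k * jump ((tr ^^ d k) (gb 0)) ((\<tau> ^^ d M) 0)
        = (if k = M then a M * jump ((tr ^^ d M) (gb 0)) ((\<tau> ^^ d M) 0) else 0)" by auto
  qed
  also have "\<dots> = a M * jump ((tr ^^ d M) (gb 0)) ((\<tau> ^^ d M) 0)" using K M by (subst sum.delta) auto
  finally have "a M = 0" using jump_iterate[of "d M" "d M"] dM by simp
  thus False using M(1) by (simp add: a_def K_def in_keys_iff)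
qed

lemma ev1_iso: "ev1 \<in> iso laurent_group D"
proof -
  interpret E: group_hom laurent_group D ev1 by (rule GA.ev_group_hom[OF unit_closed])
  have "carrier D \<subseteq> ev1 ` carrier laurent_group" using ev1_surj by simp
  moreover have "\<forall>p\<in>carrier laurent_group. ev1 p = \<one>\<^bsub>D\<^esub> \<longrightarrow> p = \<one>\<^bsub>laurent_group\<^esub>" using ev1_inj by simp
  ultimately show ?thesis unfolding E.iso_iff by blast
qed

end

section \<open>The scaled measure and eventual positivity\<close>

text \<open>The cells used below are open, so their bounds hold only between the end points; two
  points do not change the integral.\<close>

lemma integral_le_const_interior:
  fixes f :: "real \<Rightarrow> real"
  assumes "a \<le> b" "f integrable_on {a..b}" "\<And>t. a < t \<Longrightarrow> t < b \<Longrightarrow> f t \<le> M"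
  shows "integral {a..b} f \<le> (b - a) * M"
proof -
  define g where "g t = (if t \<in> {a, b} then M else f t)" for t
  have eq: "g t = f t" if "t \<in> {a..b} - {a, b}" for t using that by (simp add: g_def)
  have "(f has_integral integral {a..b} f) {a..b}" using assms(2) by (simp add: integrable_integral)
  hence "(g has_integral integral {a..b} f) {a..b}"
    using eq by (intro has_integral_spike_finite[of "{a, b}" "{a..b}" g f]) auto
  moreover have "((\<lambda>t. M) has_integral (b - a) * M) {a..b}"
    using has_integral_const_real[of M a b] assms(1) by simp
  moreover have "g t \<le> M" if "t \<in> {a..b}" for t using that assms(3)[of t] by (auto simp: g_def)
  ultimately show ?thesis by (rule has_integral_le)
qed

context nonperiodic_unimodal
begin

lemma F_\<tau>0: "F (\<tau> 0) = 2 - slope"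
  using F_\<tau>[of 0] slope_bounds by (simp add: F_c abs_if right_diff_distrib)

text \<open>At slope 2 the conjugacy would send \<open>\<tau> 0\<close> to 0, and at slope
  \<open>sqrt 2\<close> the point \<open>\<tau> 0\<close> would be fixed. In both cases the critical
  orbit would repeat.\<close>

lemma slope_strict: "sqrt 2 < slope" "slope < 2"
proof -
  show "slope < 2"
  proof (rule ccontr)
    assume "\<not> slope < 2"
    hence "F (\<tau> 0) = F 0" using slope_bounds F_\<tau>0 by simp
    thus False using F_eq_iff[of "\<tau> 0" 0] range_\<tau>[of 0] \<tau>0_pos by auto
  qed
  show "sqrt 2 < slope"
  proof (rule ccontr)
    assume "\<not> sqrt 2 < slope"
    hence s: "slope = sqrt 2" using slope_bounds by simp
    have s2: "slope * slope = 2" by (simp add: s)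
    have s1: "1 / slope = slope / 2" using s2 slope_bounds by (simp add: field_simps)
    have "F (\<tau> (\<tau> 0)) = 1 - slope * \<bar>(2 - slope) - (1 - slope / 2)\<bar>"
      using F_\<tau>[of "\<tau> 0"] range_\<tau>[of 0] by (simp add: F_\<tau>0 F_c s1)
    also have "(2 - slope) - (1 - slope / 2) = 1 - slope / 2" by simp
    also have "\<bar>1 - slope / 2\<bar> = 1 - slope / 2" using slope_bounds by simp
    also have "1 - slope * (1 - slope / 2) = 1 - slope + (slope * slope) / 2" by (simp add: algebra_simps)
    also have "\<dots> = F (\<tau> 0)" unfolding s2 F_\<tau>0 by simp
    finally have "\<tau> (\<tau> 0) = \<tau> 0" using F_eq_iff[of "\<tau> (\<tau> 0)" "\<tau> 0"] maps_I[of 0] maps_I[OF maps_I[of 0]] by simp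
    thus False using orbit_0_inj[of 2 1] by (simp add: numeral_2_eq_2)
  qed
qed

lemma slope_sq: "2 < slope\<^sup>2"
proof -
  have "(sqrt 2)\<^sup>2 < slope\<^sup>2" using slope_strict by (intro power_strict_mono) auto
  thus ?thesis by simp
qed

subsection \<open>The scaled measure\<close>

definition Fi :: "real \<Rightarrow> real" where
  "Fi t = (SOME x. x \<in> I \<and> F x = t)"

lemma Fi: "t \<in> I \<Longrightarrow> Fi t \<in> I \<and> F (Fi t) = t"
  unfolding Fi_def by (rule someI_ex) (use F_surj in blast)

lemma Fi_X: "0 \<le> t \<Longrightarrow> t \<le> 1 \<Longrightarrow> (Fi t, False) \<in> \<X>"
  using Fi[of t] by (simp add: in_X_iff)

text \<open>A change to the coordinate \<open>F\<close>, in which the measure is Lebesgue measure.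
  Reading \<open>gb y\<close> at the lower copies matters at one parameter only.\<close>

definition pull :: "(real \<times> bool \<Rightarrow> real) \<Rightarrow> real \<Rightarrow> real" where
  "pull h t = h (Fi t, False)"

definition \<omega> :: "(real \<times> bool \<Rightarrow> real) \<Rightarrow> real" where
  "\<omega> h = integral {0..1} (pull h)"

definition itg :: "(real \<times> bool \<Rightarrow> real) \<Rightarrow> bool" where
  "itg h \<longleftrightarrow> pull h integrable_on {0..1}"

lemma gb_has_integral:
  assumes y: "y \<in> J"
  shows "(pull (gb y) has_integral (1 - F y)) {0..1}"
proof -
  have yI: "y \<in> I" "F y \<in> I" using J_subset[OF y] F_I[of y] by auto
  have 1: "((\<lambda>t. if t \<in> {F y..1} then 1 else 0 :: real) has_integral (1 - F y)) {0..1}"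
    using yI has_integral_const_real[of "1::real" "F y" 1] by (subst has_integral_restrict) auto
  have 2: "pull (gb y) t = (if t \<in> {F y..1} then 1 else 0)" if t: "t \<in> {0..1} - {0, F y}" for t
  proof -
    have t': "t \<in> I" "0 < t" "t \<noteq> F y" using t by auto
    have "Fi t \<noteq> 0" using Fi[OF t'(1)] t' by force
    moreover have "y < Fi t \<longleftrightarrow> F y < t" using F_less_iff[of y "Fi t"] Fi[OF t'(1)] yI by simp
    moreover have "y \<noteq> Fi t" using Fi[OF t'(1)] t' by auto
    ultimately show ?thesis using Fi_X[of t] t' by (auto simp: pull_def gb_def)
  qed
  show ?thesis
    by (rule has_integral_spike_finite[where S = "{0, F y}" and f = "\<lambda>t. if t \<in> {F y..1} then 1 else 0", OF _ _ 1])
      (simp, rule 2)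
qed

lemma itg_gb: "y \<in> J \<Longrightarrow> itg (gb y)"
  using gb_has_integral unfolding itg_def by blast

lemma \<omega>_gb: "y \<in> J \<Longrightarrow> \<omega> (gb y) = 1 - F y"
  unfolding \<omega>_def by (rule integral_unique[OF gb_has_integral])

lemma pull_lincomb: "pull (\<lambda>u. a * h u + b * g u) = (\<lambda>t. a * pull h t + b * pull g t)"
  by (simp add: pull_def fun_eq_iff)

lemma itg_lincomb: "itg h \<Longrightarrow> itg g \<Longrightarrow> itg (\<lambda>u. a * h u + b * g u)"
  unfolding itg_def pull_lincomb by (intro integrable_add integrable_on_mult_right; assumption)

lemma \<omega>_lincomb: "itg h \<Longrightarrow> itg g \<Longrightarrow> \<omega> (\<lambda>u. a * h u + b * g u) = a * \<omega> h + b * \<omega> g"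
proof -
  assume "itg h" "itg g"
  hence hg: "pull h integrable_on {0..1}" "pull g integrable_on {0..1}" by (simp_all add: itg_def)
  from integral_add[OF integrable_on_mult_right[OF hg(1), of a] integrable_on_mult_right[OF hg(2), of b]] show ?thesis unfolding \<omega>_def pull_lincomb by simp
qed

lemma \<omega>_mono:
  assumes "itg h" "itg g" "\<And>u. u \<in> \<X> \<Longrightarrow> h u \<le> g u"
  shows "\<omega> h \<le> \<omega> g"
  using assms unfolding itg_def \<omega>_def by (intro integral_le) (auto simp: pull_def Fi_X)

lemma \<omega>_gb0: "\<omega> (gb 0) = 1"
  by (simp add: \<omega>_gb)

text \<open>\<open>vb h V\<close>: the step function \<open>h\<close> has variation at most \<open>V\<close>.\<close>

inductive vb :: "(real \<times> bool \<Rightarrow> real) \<Rightarrow> real \<Rightarrow> bool" where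
  const: "0 \<le> V \<Longrightarrow> vb (\<lambda>u. a * gb 0 u) V"
| add: "vb h V \<Longrightarrow> y \<in> J0 \<Longrightarrow> V + \<bar>a\<bar> \<le> V' \<Longrightarrow> vb (\<lambda>u. h u + a * gb y u) V'"

lemma vb_mono: "vb h V \<Longrightarrow> V \<le> V' \<Longrightarrow> vb h V'"
proof (induction arbitrary: V' rule: vb.induct)
  case (const V a)
  thus ?case by (intro vb.const) simp
next
  case (add h V y a V' V'')
  thus ?case by (intro vb.add[OF add.hyps(1,2)]) simp
qed

lemma vb_nonneg: "vb h V \<Longrightarrow> 0 \<le> V"
  by (induction rule: vb.induct) auto

lemma itg_vb: "vb h V \<Longrightarrow> itg h"
proof (induction rule: vb.induct)
  case (const V a)
  show ?case using itg_lincomb[OF itg_gb itg_gb, of 0 0 a 0] by simp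
next
  case (add h V y a V')
  thus ?case using itg_lincomb[OF add.IH itg_gb[of y], of 1 a] by simp
qed

lemma vb_add_const: "vb h V \<Longrightarrow> vb (\<lambda>u. h u + b * gb 0 u) V"
proof (induction rule: vb.induct)
  case (const V a)
  hence "vb (\<lambda>u. (a + b) * gb 0 u) V" by (rule vb.const)
  thus ?case by (simp add: distrib_right)
next
  case (add h V y a V')
  have "vb (\<lambda>u. (h u + b * gb 0 u) + a * gb y u) V'" by (rule vb.add[OF add.IH add.hyps(2,3)])
  thus ?case by (simp add: add_ac)
qed

lemma vb_add_fun: "vb g W \<Longrightarrow> vb h V \<Longrightarrow> vb (\<lambda>u. h u + g u) (V + W)"
proof (induction rule: vb.induct)
  case (const W a)
  thus ?case by (intro vb_mono[OF vb_add_const]) auto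
next
  case (add g W y a W')
  have "vb (\<lambda>u. (h u + g u) + a * gb y u) (V + W')"
    using add by (intro vb.add[OF add.IH]) auto
  thus ?case by (simp add: add_ac)
qed

lemma vb_scale: "vb h V \<Longrightarrow> vb (\<lambda>u. b * h u) (\<bar>b\<bar> * V)"
proof (induction rule: vb.induct)
  case (const V a)
  have "vb (\<lambda>u. (b * a) * gb 0 u) (\<bar>b\<bar> * V)" using const by (intro vb.const) simp
  thus ?case by (simp add: mult.assoc)
next
  case (add h V y a V')
  have "\<bar>b\<bar> * V + \<bar>b * a\<bar> = \<bar>b\<bar> * (V + \<bar>a\<bar>)" by (simp add: abs_mult distrib_left)
  also have "\<dots> \<le> \<bar>b\<bar> * V'" using add by (intro mult_left_mono) auto
  finally have "vb (\<lambda>u. b * h u + (b * a) * gb y u) (\<bar>b\<bar> * V')"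
    by (intro vb.add[OF add.IH add.hyps(2)])
  thus ?case by (simp add: distrib_left mult.assoc)
qed

lemma vb_gb: "y \<in> J \<Longrightarrow> vb (gb y) 1"
proof -
  assume y: "y \<in> J"
  consider "y = 0" | "y = 1" | "y \<in> J0" using y by blast
  thus ?thesis
  proof cases
    case 1
    thus ?thesis using vb.const[of 1 1] by simp
  next
    case 2
    thus ?thesis using vb.const[of 1 0] by (simp add: gb_1_fun)
  next
    case 3
    thus ?thesis using vb.add[OF vb.const[of 0 0] 3, of 1 1] by simp
  qed
qed

lemma end_points: "(0, False) \<in> \<X>" "(1, False) \<in> \<X>"
  by (auto simp: in_X_iff)

lemma gb_end_points: "y \<in> J0 \<Longrightarrow> gb y (0, False) = (0::real)" "y \<in> J0 \<Longrightarrow> gb y (1, False) = (1::real)"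
  using J_subset[of y] end_points by (auto simp: gb_def)

lemma gb_bounds: "0 \<le> (gb y u :: real)" "gb y u \<le> (1::real)"
  by (auto simp: gb_def)

lemma \<tau>_J0: "y \<in> J0 \<Longrightarrow> y \<noteq> c \<Longrightarrow> \<tau> y \<in> J0"
  using J_\<tau>[of y] \<tau>_lt_1[of y] \<tau>_pos'[of y] J_subset[of y] by force

text \<open>The eigenvalue equation for the mass \<open>1 - F y\<close> of \<open>gb y\<close>; on
  each branch it is the tent map equation for \<open>F\<close>.\<close>

lemma gb_transfer_scale:
  assumes "y \<in> J"
  shows "1 + turn y * (1 - F (\<tau> y)) = slope * (1 - F y)"
proof -
  have y: "y \<in> I" using J_subset[OF assms] by simp
  have sc: "slope * F c = slope - 1" using slope_bounds by (simp add: F_c right_diff_distrib)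
  show ?thesis
  proof (cases "y \<le> c")
    case True
    hence "F y \<le> F c" using F_mono[of y c] y c_bounds by simp
    hence "F (\<tau> y) = 1 - slope * (F c - F y)" using F_\<tau>[OF y] by (simp add: abs_if)
    thus ?thesis using True sc by (simp add: turn_def right_diff_distrib)
  next
    case False
    hence "F c \<le> F y" using F_mono[of c y] y c_bounds by simp
    hence "F (\<tau> y) = 1 - slope * (F y - F c)" using F_\<tau>[OF y] by simp
    thus ?thesis using False sc by (simp add: turn_def right_diff_distrib)
  qed
qed

text \<open>A jump at \<open>y\<close> moves to \<open>\<tau> y\<close> with the same size, or is
  lost if \<open>y = c\<close>. The constant part, which is the value at 0, creates a jump at
  \<open>\<tau> 0\<close>, because only the points above \<open>\<tau> 0\<close> have a left
  preimage.\<close>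

lemma vb_tr: "vb h V \<Longrightarrow> vb (tr h) (V + \<bar>h (0, False)\<bar>) \<and> \<omega> (tr h) = slope * \<omega> h"
proof (induction rule: vb.induct)
  case (const V a)
  have t0: "\<tau> 0 \<in> J0" using J_\<tau>[of 0] \<tau>0_pos \<tau>0_lt by auto
  have eq: "tr (\<lambda>u. a * gb 0 u) = (\<lambda>u. a * gb 0 u + a * gb (\<tau> 0) u)"
    using c_bounds by (simp add: tr_scale tr_gb_fun turn_def distrib_left)
  have "vb (\<lambda>u. a * gb 0 u + a * gb (\<tau> 0) u) (V + \<bar>a\<bar>)"
    by (rule vb.add[OF vb.const[OF const] t0]) simp
  moreover have "\<omega> (\<lambda>u. a * gb 0 u + a * gb (\<tau> 0) u) = a * 1 + a * (1 - F (\<tau> 0))"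
    using t0 by (subst \<omega>_lincomb) (auto simp: itg_gb \<omega>_gb)
  moreover have "\<omega> (\<lambda>u. a * gb 0 u + 0 * gb 0 u) = a * 1 + 0 * 1"
    by (subst \<omega>_lincomb) (auto simp: itg_gb \<omega>_gb)
  ultimately show ?case using end_points by (simp add: eq gb_0 F_\<tau>0 algebra_simps)
next
  case (add h V y a V')
  have y: "y \<in> J" "\<tau> y \<in> J" using add.hyps J_\<tau> by auto
  have eq: "tr (\<lambda>u. h u + a * gb y u) = (\<lambda>u. (tr h u + a * gb 0 u) + (a * turn y) * gb (\<tau> y) u)"
    by (simp add: tr_add tr_scale tr_gb_fun[OF y(1)] distrib_left add_ac mult.assoc)
  have vh: "vb (tr h) (V + \<bar>h (0, False)\<bar>)" and wh: "\<omega> (tr h) = slope * \<omega> h" using add.IH by auto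
  have v0: "vb (\<lambda>u. tr h u + a * gb 0 u) (V + \<bar>h (0, False)\<bar>)" by (rule vb_add_const[OF vh])
  have at: "\<bar>a * turn y\<bar> = \<bar>a\<bar>" by (simp add: turn_def)
  have v: "vb (tr (\<lambda>u. h u + a * gb y u)) (V' + \<bar>h (0, False)\<bar>)"
  proof (cases "y = c")
    case True
    have "V + \<bar>h (0, False)\<bar> \<le> V' + \<bar>h (0, False)\<bar>" using add.hyps(3) by simp
    from vb_mono[OF v0 this] show ?thesis unfolding eq by (simp add: True gb_1_fun)
  next
    case False
    show ?thesis unfolding eq
      by (rule vb.add[OF v0 \<tau>_J0[OF add.hyps(2) False]]) (use add.hyps(3) at in simp)
  qed
  have e: "h (0, False) + a * gb y (0, False) = h (0, False)"
    using gb_end_points(1)[OF add.hyps(2)] by simp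
  have w: "\<omega> (tr (\<lambda>u. h u + a * gb y u)) = slope * \<omega> (\<lambda>u. h u + a * gb y u)"
  proof -
    have i1: "itg (\<lambda>u. 1 * tr h u + a * gb 0 u)" by (intro itg_lincomb itg_vb[OF vh] itg_gb) simp
    have "\<omega> (\<lambda>u. 1 * (1 * tr h u + a * gb 0 u) + (a * turn y) * gb (\<tau> y) u)
        = 1 * (1 * \<omega> (tr h) + a * \<omega> (gb 0)) + (a * turn y) * \<omega> (gb (\<tau> y))"
      using y by (simp only: \<omega>_lincomb[OF i1 itg_gb[OF y(2)]] \<omega>_lincomb[OF itg_vb[OF vh] itg_gb[OF J_members(2)]])
    also have "\<dots> = slope * \<omega> h + a * (1 + turn y * (1 - F (\<tau> y)))"
      by (simp add: wh \<omega>_gb y algebra_simps)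
    also have "\<dots> = slope * (1 * \<omega> h + a * \<omega> (gb y))"
      unfolding gb_transfer_scale[OF y(1)] \<omega>_gb[OF y(1)] by (simp add: algebra_simps)
    also have "1 * \<omega> h + a * \<omega> (gb y) = \<omega> (\<lambda>u. 1 * h u + a * gb y u)"
      by (rule \<omega>_lincomb[symmetric]) (use itg_vb[OF add.hyps(1)] itg_gb[OF y(1)] in auto)
    finally show ?thesis by (simp add: eq)
  qed
  show ?case unfolding e using v w by blast
qed

lemma vb_diff: "vb h V \<Longrightarrow> u \<in> \<X> \<Longrightarrow> v \<in> \<X> \<Longrightarrow> \<bar>h u - h v\<bar> \<le> V"
proof (induction rule: vb.induct)
  case (const V a)
  thus ?case by (simp add: gb_0)
next
  case (add h V y a V')
  have "\<bar>gb y u - gb y v\<bar> \<le> (1::real)" by (auto simp: gb_def)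
  hence "\<bar>a\<bar> * \<bar>gb y u - gb y v\<bar> \<le> \<bar>a\<bar> * 1" by (intro mult_left_mono) auto
  hence "\<bar>a * gb y u - a * gb y v\<bar> \<le> \<bar>a\<bar>" by (simp add: abs_mult right_diff_distrib[symmetric])
  thus ?case using add by linarith
qed

text \<open>The jumps below \<open>u\<close> account for the difference to the value at 0, those
  above for the difference to the value at 1. No jump is used twice, so a single \<open>V\<close>
  pays for both.\<close>

lemma vb_ends: "vb h V \<Longrightarrow> u \<in> \<X> \<Longrightarrow> h (0, False) + h (1, False) \<le> V + 2 * h u"
proof (induction rule: vb.induct)
  case (const V a)
  thus ?case using end_points by (simp add: gb_0)
next
  case (add h V y a V')
  have "a * gb y (0, False) + a * gb y (1, False) \<le> \<bar>a\<bar> + 2 * (a * gb y u)"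
    unfolding gb_end_points[OF add.hyps(2)] by (cases "gb y u = (0::real)") (auto simp: gb_def)
  thus ?case using add.IH[OF add.prems] add.hyps(3) by (simp add: distrib_left)
qed

lemma \<omega>_ge_const: "vb h V \<Longrightarrow> (\<And>u. u \<in> \<X> \<Longrightarrow> a \<le> h u) \<Longrightarrow> a \<le> \<omega> h"
proof -
  assume h: "vb h V" "\<And>u. u \<in> \<X> \<Longrightarrow> a \<le> h u"
  have "\<omega> (\<lambda>u. a * gb 0 u + 0 * gb 0 u) \<le> \<omega> h"
    using h by (intro \<omega>_mono itg_lincomb itg_gb itg_vb[OF h(1)]) (auto simp: gb_0)
  thus ?thesis by (subst (asm) \<omega>_lincomb) (auto simp: itg_gb \<omega>_gb)
qed

text \<open>Two transfers turn a bound \<open>B\<close> into \<open>2 * B + 2\<close> while the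
  scale grows by \<open>slope\<^sup>2\<close>. The constant satisfies
  \<open>2 * B + 2 \<le> slope\<^sup>2 * B\<close>, and it is at least 2 to cover the first two
  iterates.\<close>

definition Bvar :: real where
  "Bvar = 2 + 2 / (slope\<^sup>2 - 2)"

lemma Bvar: "2 \<le> Bvar" "2 * Bvar + 2 \<le> slope\<^sup>2 * Bvar"
proof -
  show "2 \<le> Bvar" using slope_sq by (simp add: Bvar_def)
  have "k * (2 + 2 / k) = 2 * k + 2" if "k \<noteq> 0" for k :: real using that by (simp add: distrib_left)
  moreover have "slope\<^sup>2 - 2 \<noteq> 0" using slope_sq by linarith
  ultimately have "(slope\<^sup>2 - 2) * Bvar = 2 * (slope\<^sup>2 - 2) + 2"
    unfolding Bvar_def by blast
  thus "2 * Bvar + 2 \<le> slope\<^sup>2 * Bvar" using slope_sq by (simp add: algebra_simps)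
qed

text \<open>Only the variation of two consecutive iterates can be controlled, with the factor
  \<open>2 / slope\<^sup>2\<close>: each application of the operator creates a jump of size \<open>h (0, False)\<close>.
  This is where \<open>slope > sqrt 2\<close> enters.\<close>

lemma vb_iterate_gb:
  assumes y: "y \<in> J"
  shows "vb ((tr ^^ n) (gb y)) (Bvar * slope ^ n)" (is "vb (?q n) _")
    and "\<omega> ((tr ^^ n) (gb y)) = slope ^ n * (1 - F y)"
proof -
  have nonneg: "0 \<le> ?q n u" for n u by (rule trn_nonneg) (rule gb_bounds)
  have \<omega>: "\<omega> (?q n) = slope ^ n * (1 - F y)" if "\<And>k. k < n \<Longrightarrow> \<exists>V. vb (?q k) V" for n
    using that
  proof (induction n)
    case 0
    thus ?case by (simp add: \<omega>_gb y)
  next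
    case (Suc n)
    obtain V where "vb (?q n) V" using Suc.prems[of n] by auto
    thus ?case using vb_tr[of "?q n" V] Suc by simp
  qed
  have Fy: "1 - F y \<le> 1" using F_I[of y] J_subset[OF y] by auto
  have S: "1 < slope" by (rule slope_bounds)
  have vb: "vb (?q n) (Bvar * slope ^ n)" for n
  proof (induction n rule: less_induct)
    case (less n)
    consider "n = 0" | "n = 1" | m where "n = Suc (Suc m)" by (metis One_nat_def not0_implies_Suc)
    thus ?case
    proof cases
      case 1
      thus ?thesis using vb_mono[OF vb_gb[OF y], of Bvar] Bvar by simp
    next
      case 2
      have "vb (tr (gb y)) (1 + \<bar>gb y (0, False)\<bar>)" using vb_tr[OF vb_gb[OF y]] by blast
      moreover have "1 + \<bar>gb y (0, False)\<bar> \<le> Bvar * slope"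
      proof -
        have "2 * 1 \<le> Bvar * slope" using Bvar S by (intro mult_mono) auto
        moreover have "\<bar>gb y (0, False)\<bar> \<le> (1::real)" by (simp add: gb_def)
        ultimately show ?thesis by linarith
      qed
      ultimately show ?thesis unfolding 2 using vb_mono by simp
    next
      case (3 m)
      let ?V = "Bvar * slope ^ m"
      have v0: "vb (?q m) ?V" using less[of m] 3 by simp
      have w0: "\<omega> (?q m) = slope ^ m * (1 - F y)"
        using less 3 by (intro \<omega>) (meson less_SucI)
      have v1: "vb (?q (Suc m)) (?V + ?q m (0, False))"
        using vb_tr[OF v0] nonneg[of m "(0, False)"] by simp
      have v2: "vb (?q (Suc (Suc m))) (?V + ?q m (0, False) + ?q (Suc m) (0, False))"
        using vb_tr[OF v1] nonneg[of "Suc m" "(0, False)"] by simp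
      have "rb 0 = 1" using rb[of 0] \<tau>_pos'[of "rb 0"] c_bounds by force
      \<comment> \<open>The only preimage of 0 is 1, so the second new jump has the size of the
        value at the other end point.\<close>
      hence e1: "?q (Suc m) (0, False) = ?q m (1, False)"
        using end_points \<tau>0_pos by (simp add: tr_def right_inv_def has_left_def)
      \<comment> \<open>By \<open>vb_ends\<close> this constant bounds the iterate from below.
        Integration then bounds the two new jumps together by the old variation plus twice the
        mass.\<close>
      have "(?q m (0, False) + ?q m (1, False) - ?V) / 2 \<le> \<omega> (?q m)"
        by (rule \<omega>_ge_const[OF v0]) (use vb_ends[OF v0] in force)
      also have "\<omega> (?q m) \<le> slope ^ m" unfolding w0 using S Fy by simp
      finally have "?V + ?q m (0, False) + ?q (Suc m) (0, False) \<le> 2 * ?V + 2 * slope ^ m"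
        unfolding e1 by (simp add: field_simps)
      also have "\<dots> = (2 * Bvar + 2) * slope ^ m" by (simp add: algebra_simps)
      also have "\<dots> \<le> (slope\<^sup>2 * Bvar) * slope ^ m" using Bvar S by (intro mult_right_mono) auto
      also have "\<dots> = Bvar * slope ^ n" by (simp add: 3 power2_eq_square mult_ac)
      finally show ?thesis using vb_mono[OF v2] by (simp add: 3)
    qed
  qed
  show "vb (?q n) (Bvar * slope ^ n)" by (rule vb)
  show "\<omega> (?q n) = slope ^ n * (1 - F y)" by (rule \<omega>) (use vb in blast)
qed

abbreviation rl :: "(real \<times> bool \<Rightarrow> int) \<Rightarrow> real \<times> bool \<Rightarrow> real" where
  "rl f \<equiv> \<lambda>u. real_of_int (f u)"

lemma rl_gb: "rl (gb y) = gb y"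
  by (simp add: gb_def fun_eq_iff)

lemma rl_tr: "rl (tr f) = tr (rl f)"
  by (simp add: tr_def fun_eq_iff)

lemma rl_trn: "rl ((tr ^^ n) f) = (tr ^^ n) (rl f)"
proof (induction n)
  case (Suc n)
  thus ?case using rl_tr[of "(tr ^^ n) f"] by simp
qed simp

lemma iterate_bounds:
  "f \<in> C \<Longrightarrow> \<exists>B. \<forall>n. vb ((tr ^^ n) (rl f)) (B * slope ^ n) \<and> \<omega> ((tr ^^ n) (rl f)) = slope ^ n * \<omega> (rl f)"
proof (induction rule: C_induct)
  case zero
  have "vb (\<lambda>u. 0) 0" using vb.const[of 0 0] by simp
  moreover have "\<omega> (\<lambda>u. 0) = 0"
  proof -
    have "pull (\<lambda>u. 0) = (\<lambda>t. 0)" by (simp add: pull_def fun_eq_iff)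
    thus ?thesis by (simp add: \<omega>_def)
  qed
  ultimately show ?case by (intro exI[of _ 0]) (simp add: trn_zero)
next
  case (add f y a)
  then obtain B where B: "\<And>n. vb ((tr ^^ n) (rl f)) (B * slope ^ n)"
    "\<And>n. \<omega> ((tr ^^ n) (rl f)) = slope ^ n * \<omega> (rl f)" by blast
  have y: "y \<in> J" by fact
  have eq: "rl (\<lambda>u. f u + a * gb y u) = (\<lambda>u. 1 * rl f u + of_int a * gb y u)"
    using fun_cong[OF rl_gb[of y]] by (simp add: fun_eq_iff)
  have "vb ((tr ^^ n) (rl (\<lambda>u. f u + a * gb y u))) ((B + \<bar>of_int a\<bar> * Bvar) * slope ^ n)" for n
  proof -
    have "vb (\<lambda>u. (tr ^^ n) (rl f) u + of_int a * (tr ^^ n) (gb y) u) (B * slope ^ n + \<bar>of_int a\<bar> * (Bvar * slope ^ n))"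
      by (intro vb_add_fun vb_scale vb_iterate_gb y B)
    thus ?thesis unfolding eq trn_lincomb by (simp add: distrib_right mult.assoc)
  qed
  moreover have "\<omega> ((tr ^^ n) (rl (\<lambda>u. f u + a * gb y u))) = slope ^ n * \<omega> (rl (\<lambda>u. f u + a * gb y u))" for n
  proof -
    have i: "itg ((tr ^^ n) (rl f))" "itg ((tr ^^ n) (gb y))" for n
      using itg_vb[OF B(1)] itg_vb[OF vb_iterate_gb(1)[OF y]] by auto
    have *: "\<omega> ((tr ^^ n) (rl (\<lambda>u. f u + a * gb y u))) = slope ^ n * (\<omega> (rl f) + of_int a * (1 - F y))" for n
      unfolding eq trn_lincomb \<omega>_lincomb[OF i] B(2) vb_iterate_gb(2)[OF y] by (simp add: algebra_simps)
    from *[of n] *[of 0] show ?thesis by simp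
  qed
  ultimately show ?case by blast
qed

lemma itg_C: "f \<in> C \<Longrightarrow> itg (rl f)"
  using iterate_bounds[of f] itg_vb funpow_0 by metis

lemma \<omega>_trn: "f \<in> C \<Longrightarrow> \<omega> (rl ((tr ^^ n) f)) = slope ^ n * \<omega> (rl f)"
  using iterate_bounds[of f] by (auto simp: rl_trn)

subsection \<open>Density of the split points and exactness\<close>

lemma F_expand_left: "\<lbrakk>0 \<le> a; a \<le> b; b \<le> c\<rbrakk> \<Longrightarrow> F (\<tau> b) - F (\<tau> a) = slope * (F b - F a)"
  using F_left[of a b] slope_bounds by (simp add: radius_slope)

lemma F_expand_right: "\<lbrakk>c \<le> a; a \<le> b; b \<le> 1\<rbrakk> \<Longrightarrow> F (\<tau> a) - F (\<tau> b) = slope * (F b - F a)"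
  using F_right[of a b] slope_bounds by (simp add: radius_slope)

text \<open>An interval without split points does not contain \<open>c\<close>, so it lies on one
  branch. Its image is again free of split points and, in the coordinate \<open>F\<close>, longer by
  the factor \<open>slope\<close>; hence there are no such intervals.\<close>

lemma gap_length:
  "\<lbrakk>0 \<le> a; a < b; b \<le> 1; \<And>z. a < z \<Longrightarrow> z < b \<Longrightarrow> z \<notin> J\<rbrakk> \<Longrightarrow> slope ^ n * (F b - F a) \<le> 1"
proof (induction n arbitrary: a b)
  case 0
  thus ?case using F_I[of a] F_I[of b] by simp
next
  case (Suc n)
  have nc: "\<not> (a < c \<and> c < b)" using Suc.prems(4)[of c] by auto
  have pre: "w \<notin> J" if "a < w" "w < b" for w using Suc.prems(4) that by blast
  have con: "continuous_on {a..b} \<tau>" using Suc.prems by (intro continuous_on_subset[OF cont]) auto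
  show ?case
  proof (cases "b \<le> c")
    case True
    have "z \<notin> J" if z: "\<tau> a < z" "z < \<tau> b" for z
    proof -
      have "\<exists>w\<ge>a. w \<le> b \<and> \<tau> w = z" by (rule IVT') (use z Suc.prems con in auto)
      then obtain w where w: "a \<le> w" "w \<le> b" "\<tau> w = z" by blast
      hence "a < w" "w < b" using z by (auto simp: less_le)
      thus ?thesis using pre[of w] J_iff[of w] w Suc.prems by auto
    qed
    hence "slope ^ n * (F (\<tau> b) - F (\<tau> a)) \<le> 1"
      using Suc.prems True incr[of a b] range_\<tau>[of a] range_\<tau>[of b] by (intro Suc.IH) auto
    thus ?thesis using F_expand_left[of a b] Suc.prems True by (simp add: mult_ac)
  next
    case False
    hence ca: "c \<le> a" using nc by auto
    have "z \<notin> J" if z: "\<tau> b < z" "z < \<tau> a" for z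
    proof -
      have "\<exists>w\<ge>a. w \<le> b \<and> \<tau> w = z" by (rule IVT2') (use z Suc.prems con in auto)
      then obtain w where w: "a \<le> w" "w \<le> b" "\<tau> w = z" by blast
      hence "a < w" "w < b" using z by (auto simp: less_le)
      thus ?thesis using pre[of w] J_iff[of w] w Suc.prems by auto
    qed
    hence "slope ^ n * (F (\<tau> a) - F (\<tau> b)) \<le> 1"
      using Suc.prems ca decr[of a b] range_\<tau>[of a] range_\<tau>[of b] by (intro Suc.IH) auto
    thus ?thesis using F_expand_right[of a b] Suc.prems ca by (simp add: mult_ac)
  qed
qed

lemma ex_in_J:
  assumes "0 \<le> a" "a < b" "b \<le> 1"
  shows "\<exists>z. a < z \<and> z < b \<and> z \<in> J"
proof (rule ccontr)
  assume "\<not> ?thesis"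
  hence le: "slope ^ n * (F b - F a) \<le> 1" for n using assms by (intro gap_length) auto
  have pos: "0 < F b - F a" using F_strict[OF assms] by simp
  obtain n where "1 / (F b - F a) < slope ^ n" using real_arch_pow[OF slope_bounds(3)] by blast
  thus False using le[of n] pos by (simp add: field_simps)
qed

lemma ex_two_in_J:
  assumes "0 \<le> a" "a < b" "b \<le> 1"
  shows "\<exists>y z. a < y \<and> y < z \<and> z < b \<and> y \<in> J \<and> z \<in> J"
proof -
  obtain z where z: "a < z" "z < b" "z \<in> J" using ex_in_J[OF assms] by blast
  obtain y where "a < y" "y < z" "y \<in> J" using ex_in_J[of a z] assms z by auto
  thus ?thesis using z by blast
qed

abbreviation gbd :: "real \<Rightarrow> real \<Rightarrow> real \<times> bool \<Rightarrow> real" where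
  "gbd a b \<equiv> \<lambda>u. 1 * gb a u + (- 1) * gb b u"

lemma gbd_cases:
  assumes "a \<le> b"
  shows "gbd a b u = 0 \<or> gbd a b u = 1 \<and> a \<le> fst u \<and> fst u \<le> b"
  using assms by (auto simp: gb_def)

lemma tr_gbd: "a \<in> J \<Longrightarrow> b \<in> J \<Longrightarrow> tr (gbd a b) = (\<lambda>u. turn a * gb (\<tau> a) u - turn b * gb (\<tau> b) u)"
  by (simp only: tr_add tr_scale tr_gb_fun) (simp add: fun_eq_iff algebra_simps)

lemma tr_gbd_left:
  assumes "a \<in> J" "b \<in> J" "a \<le> b" "b \<le> c"
  shows "tr (gbd a b) = gbd (\<tau> a) (\<tau> b)"
  unfolding tr_gbd[OF assms(1,2)] using assms(3,4) by (simp add: turn_def)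

lemma tr_gbd_right:
  assumes "a \<in> J" "b \<in> J" "c \<le> a" "a < b"
  shows "tr (gbd a b) = gbd (\<tau> b) (\<tau> a)"
  unfolding tr_gbd[OF assms(1,2)] using assms(3,4) by (cases "a = c") (auto simp: turn_def gb_1)

text \<open>On one branch a step multiplies the length in the coordinate \<open>F\<close> by
  \<open>slope\<close>, which is at least \<open>slope\<^sup>2 / 2\<close>. An interval across
  \<open>c\<close> covers at least the image of its longer half, an interval ending at 1; the next
  step either completes the factor \<open>slope\<^sup>2 / 2\<close> or covers everything.\<close>

lemma exactness:
  "\<lbrakk>a \<in> J; b \<in> J; a < b; 1 \<le> (F b - F a) * (slope\<^sup>2 / 2) ^ n\<rbrakk>
    \<Longrightarrow> \<exists>N. \<forall>u\<in>\<X>. 1 \<le> (tr ^^ N) (gbd a b) u"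
proof (induction n arbitrary: a b)
  case 0
  have I: "a \<in> I" "b \<in> I" using 0 J_subset by auto
  have "F a \<le> F 0" "F 1 \<le> F b" using 0(4) F_I[OF I(1)] F_I[OF I(2)] by auto
  hence "a = 0" "b = 1" using F_less_iff[of 0 a] F_less_iff[of b 1] I by auto
  hence "\<forall>u\<in>\<X>. 1 \<le> (tr ^^ 0) (gbd a b) u" by (simp add: gb_0 gb_1)
  thus ?case by blast
next
  case (Suc n)
  let ?\<theta> = "slope\<^sup>2 / 2"
  have I: "a \<in> I" "b \<in> I" and ab: "0 \<le> a" "b \<le> 1" using Suc.prems J_subset by auto
  have \<theta>: "0 < ?\<theta>" "?\<theta> \<le> slope"
    using slope_sq slope_bounds by (auto simp: power2_eq_square)
  have pos: "0 < F b - F a" using F_strict[of a b] ab Suc.prems by simp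
  have grow: "1 \<le> L * ?\<theta> ^ n" if "(F b - F a) * ?\<theta> \<le> L" for L
  proof -
    have "1 \<le> ((F b - F a) * ?\<theta>) * ?\<theta> ^ n" using Suc.prems(4) by (simp add: mult_ac)
    also have "\<dots> \<le> L * ?\<theta> ^ n" using that \<theta> by (intro mult_right_mono) auto
    finally show ?thesis .
  qed
  have slope_ge: "(F b - F a) * ?\<theta> \<le> slope * (F b - F a)" using pos \<theta> by (simp add: mult.commute)
  have shift: "(tr ^^ Suc N) h = (tr ^^ N) (tr h)" for N and h :: "real \<times> bool \<Rightarrow> real"
    by (simp add: funpow_swap1)
  consider "b \<le> c" | "c \<le> a" | "a < c" "c < b" by linarith
  thus ?case
  proof cases
    case 1
    have "\<exists>N. \<forall>u\<in>\<X>. 1 \<le> (tr ^^ N) (gbd (\<tau> a) (\<tau> b)) u"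
      using Suc.prems 1 ab incr[of a b] J_\<tau> F_expand_left[of a b] grow[OF slope_ge] by (intro Suc.IH) auto
    moreover have "tr (gbd a b) = gbd (\<tau> a) (\<tau> b)" using Suc.prems 1 by (intro tr_gbd_left) auto
    ultimately have "\<exists>N. \<forall>u\<in>\<X>. 1 \<le> (tr ^^ N) (tr (gbd a b)) u" by (simp only:)
    thus ?thesis unfolding shift[symmetric] by blast
  next
    case 2
    have "\<exists>N. \<forall>u\<in>\<X>. 1 \<le> (tr ^^ N) (gbd (\<tau> b) (\<tau> a)) u"
      using Suc.prems 2 ab decr[of a b] J_\<tau> F_expand_right[of a b] grow[OF slope_ge] by (intro Suc.IH) auto
    moreover have "tr (gbd a b) = gbd (\<tau> b) (\<tau> a)" using Suc.prems 2 by (intro tr_gbd_right) auto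
    ultimately have "\<exists>N. \<forall>u\<in>\<X>. 1 \<le> (tr ^^ N) (tr (gbd a b)) u" by (simp only:)
    thus ?thesis unfolding shift[symmetric] by blast
  next
    case 3
    \<comment> \<open>The images of both halves end at 1, so the longer one starts at the smaller of
      the two images.\<close>
    define m where "m = min (\<tau> a) (\<tau> b)"
    have m: "m \<in> J" "m < 1" "0 \<le> m"
      using J_\<tau> Suc.prems \<tau>_lt_1[of a] \<tau>_lt_1[of b] 3 ab range_\<tau>[of a] range_\<tau>[of b]
      by (auto simp: m_def min_def)
    have ge: "gbd m 1 u \<le> tr (gbd a b) u" for u
      unfolding tr_gbd[OF Suc.prems(1,2)] using 3 gb_bounds[of "\<tau> a" u] gb_bounds[of "\<tau> b" u]
      by (auto simp: turn_def gb_1 m_def min_def)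
    have "(F b - F a) / 2 \<le> F c - F a \<or> (F b - F a) / 2 \<le> F b - F c" by argo
    hence Fm: "slope * ((F b - F a) / 2) \<le> 1 - F m"
    proof
      assume "(F b - F a) / 2 \<le> F c - F a"
      hence "slope * ((F b - F a) / 2) \<le> slope * (F c - F a)" using slope_bounds by (intro mult_left_mono) auto
      also have "\<dots> = 1 - F (\<tau> a)" using F_expand_left[of a c] 3 ab by simp
      also have "\<dots> \<le> 1 - F m" using F_mono[of m "\<tau> a"] m range_\<tau>[of a] I by (auto simp: m_def)
      finally show ?thesis .
    next
      assume "(F b - F a) / 2 \<le> F b - F c"
      hence "slope * ((F b - F a) / 2) \<le> slope * (F b - F c)" using slope_bounds by (intro mult_left_mono) auto
      also have "\<dots> = 1 - F (\<tau> b)" using F_expand_right[of c b] 3 ab by simp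
      also have "\<dots> \<le> 1 - F m" using F_mono[of m "\<tau> b"] m range_\<tau>[of b] I by (auto simp: m_def)
      finally show ?thesis .
    qed
    have "\<exists>N. \<forall>u\<in>\<X>. 1 \<le> (tr ^^ N) (gbd m 1) u"
    proof (cases "c \<le> m")
      case True
      have "(F b - F a) * ?\<theta> = slope * (slope * ((F b - F a) / 2))" by (simp add: power2_eq_square)
      also have "\<dots> \<le> slope * (1 - F m)" using Fm slope_bounds by (intro mult_left_mono) auto
      also have "\<dots> = F (\<tau> m) - F 0" using F_expand_right[of m 1] True m by simp
      finally have "1 \<le> (F (\<tau> m) - F 0) * ?\<theta> ^ n" by (rule grow)
      hence "\<exists>N. \<forall>u\<in>\<X>. 1 \<le> (tr ^^ N) (gbd 0 (\<tau> m)) u"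
        using m J_\<tau> \<tau>_pos'[of m] by (intro Suc.IH) auto
      moreover have "tr (gbd m 1) = gbd (\<tau> 1) (\<tau> m)" using m True by (intro tr_gbd_right) auto
      ultimately have "\<exists>N. \<forall>u\<in>\<X>. 1 \<le> (tr ^^ N) (tr (gbd m 1)) u" by (simp only: \<tau>_1)
      thus ?thesis unfolding shift[symmetric] by blast
    next
      case False
      \<comment> \<open>For \<open>m < c\<close> the interval contains the whole right branch, which
        covers every point.\<close>
      have "1 \<le> tr (gbd m 1) u" if "u \<in> \<X>" for u
        unfolding tr_gbd[OF m(1) J_members(3)] using False c_bounds gb_bounds[of "\<tau> m" u] that
        by (simp add: turn_def gb_0)
      hence "\<forall>u\<in>\<X>. 1 \<le> (tr ^^ 1) (gbd m 1) u" by simp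
      thus ?thesis by blast
    qed
    then obtain N where N: "\<forall>u\<in>\<X>. 1 \<le> (tr ^^ N) (gbd m 1) u" by blast
    have "1 \<le> (tr ^^ N) (tr (gbd a b)) u" if "u \<in> \<X>" for u
      using N that trn_mono[of "gbd m 1" "tr (gbd a b)" u N] ge by force
    thus ?thesis unfolding shift[symmetric] by blast
  qed
qed

text \<open>Every point has a preimage, so a function that is at least 1 remains so. Validity at all
  late times allows one common time for finitely many intervals.\<close>

lemma exactness_ev:
  assumes "a \<in> J" "b \<in> J" "a < b"
  shows "\<exists>N. \<forall>n\<ge>N. \<forall>u\<in>\<X>. 1 \<le> (tr ^^ n) (gbd a b) u"
proof -
  have pos: "0 < F b - F a" using F_strict[of a b] J_subset assms by auto
  have "1 < slope\<^sup>2 / 2" using slope_sq by simp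
  then obtain n where "1 / (F b - F a) < (slope\<^sup>2 / 2) ^ n" using real_arch_pow by blast
  hence "1 \<le> (F b - F a) * (slope\<^sup>2 / 2) ^ n" using pos by (simp add: divide_less_eq mult.commute)
  note len = this
  define g where "g = gbd a b"
  obtain N where N: "\<forall>u\<in>\<X>. 1 \<le> (tr ^^ N) g u"
    using exactness[OF assms len] unfolding g_def by blast
  have tr1: "1 \<le> tr (gb 0 :: _ \<Rightarrow> real) u" if u: "u \<in> \<X>" for u
  proof -
    have eq: "tr (gb 0) u = (gb 0 u + turn 0 * gb (\<tau> 0) u :: real)" by (rule tr_gb) simp
    have t0: "turn 0 = (1::real)" using c_bounds by (simp add: turn_def)
    show ?thesis unfolding eq t0 gb_0[OF u] using gb_bounds(1)[of "\<tau> 0" u] by linarith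
  qed
  have later: "1 \<le> (tr ^^ (k + N)) g u" if "u \<in> \<X>" for k u
    using that
  proof (induction k arbitrary: u)
    case 0
    thus ?case using N by simp
  next
    case (Suc k)
    have "1 \<le> tr (gb 0 :: _ \<Rightarrow> real) u" by (rule tr1[OF Suc.prems])
    also have "\<dots> \<le> tr ((tr ^^ (k + N)) g) u"
      by (rule tr_mono) (use Suc.IH in \<open>simp add: gb_0\<close>)
    finally show ?case by simp
  qed
  have "1 \<le> (tr ^^ n) g u" if "N \<le> n" "u \<in> \<X>" for n u
    using later[OF that(2), of "n - N"] that(1) by simp
  thus ?thesis unfolding g_def by blast
qed

subsection \<open>Eventual positivity\<close>

text \<open>The cells have equal mass. Being open, none of them sees a jump on a common
  boundary.\<close>

definition piece :: "nat \<Rightarrow> nat \<Rightarrow> real \<times> bool \<Rightarrow> bool" where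
  "piece K i u \<longleftrightarrow> u \<in> \<X> \<and> real i / real K < F (fst u) \<and> F (fst u) < (real i + 1) / real K"

text \<open>A jump lies in at most one cell, so the oscillations over the cells add up to no more
  than the variation.\<close>

lemma vb_pieces:
  assumes K: "0 < K"
  shows "vb h V \<Longrightarrow> \<exists>W. (\<Sum>i<K. W i) \<le> V \<and> (\<forall>i<K. \<forall>u v. piece K i u \<longrightarrow> piece K i v \<longrightarrow> \<bar>h u - h v\<bar> \<le> W i)"
proof (induction rule: vb.induct)
  case (const V a)
  show ?case by (intro exI[of _ "\<lambda>_. 0"]) (use const in \<open>auto simp: piece_def gb_0\<close>)
next
  case (add h V y a V')
  obtain W where W: "(\<Sum>i<K. W i) \<le> V" "\<And>i u v. i < K \<Longrightarrow> piece K i u \<Longrightarrow> piece K i v \<Longrightarrow> \<bar>h u - h v\<bar> \<le> W i"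
    using add.IH by blast
  \<comment> \<open>The only cell that can contain points on both sides of \<open>y\<close>.\<close>
  define i0 where "i0 = nat \<lfloor>real K * F y\<rfloor>"
  define W' where "W' i = W i + (if i = i0 then \<bar>a\<bar> else 0)" for i
  have yI: "y \<in> I" using add.hyps(2) J_subset by auto
  have "(\<Sum>i<K. W' i) = (\<Sum>i<K. W i) + (if i0 \<in> {..<K} then \<bar>a\<bar> else 0)"
    unfolding W'_def sum.distrib by (subst sum.delta) auto
  also have "\<dots> \<le> V'" using W(1) add.hyps(3) by auto
  finally have sum: "(\<Sum>i<K. W' i) \<le> V'" .
  have "\<bar>(h u + a * gb y u) - (h v + a * gb y v)\<bar> \<le> W' i" if i: "i < K" "piece K i u" "piece K i v" for i u v
  proof (cases "gb y u = (gb y v :: real)")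
    case True
    have "0 \<le> (if i = i0 then \<bar>a\<bar> else 0)" by simp
    thus ?thesis using W(2)[OF i] True unfolding W'_def by simp
  next
    case False
    have uI: "fst u \<in> I" "fst v \<in> I" using i X_fst by (auto simp: piece_def)
    have "(y < fst u \<or> y = fst u \<and> (snd u \<or> y = 0)) \<noteq> (y < fst v \<or> y = fst v \<and> (snd v \<or> y = 0))"
    proof
      assume "(y < fst u \<or> y = fst u \<and> (snd u \<or> y = 0)) = (y < fst v \<or> y = fst v \<and> (snd v \<or> y = 0))"
      hence "(u \<in> \<X> \<and> (y < fst u \<or> y = fst u \<and> (snd u \<or> y = 0))) = (v \<in> \<X> \<and> (y < fst v \<or> y = fst v \<and> (snd v \<or> y = 0)))"
        using i unfolding piece_def by blast
      hence "gb y u = (gb y v :: real)" unfolding gb_def by (rule arg_cong)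
      thus False using False by blast
    qed
    hence "y \<le> fst u \<and> fst v \<le> y \<or> y \<le> fst v \<and> fst u \<le> y" by auto
    hence "\<exists>p\<in>{u, v}. y \<le> fst p" "\<exists>p\<in>{u, v}. fst p \<le> y" by auto
    then obtain p p' where p: "p \<in> {u, v}" "y \<le> fst p" "p' \<in> {u, v}" "fst p' \<le> y" by blast
    have "F y \<le> F (fst p)" "F (fst p') \<le> F y" using p uI yI by (auto intro!: F_mono)
    hence "real i / real K < F y" "F y < (real i + 1) / real K" using i p by (auto simp: piece_def)
    hence "real i < real K * F y" "real K * F y < real i + 1" using K by (auto simp: field_simps)
    hence "\<lfloor>real K * F y\<rfloor> = int i" by linarith
    hence "i = i0" by (simp add: i0_def)
    moreover have "\<bar>a * gb y u - a * gb y v\<bar> \<le> \<bar>a\<bar>" by (auto simp: gb_def)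
    ultimately show ?thesis using W(2)[OF i] unfolding W'_def by auto
  qed
  with sum show ?case by blast
qed

text \<open>If \<open>h\<close> dipped below \<open>\<eta> / 2\<close> in every cell, it would
  exceed \<open>\<eta> / 2\<close> there by at most the oscillation. Averaging over the cells gives
  mass at most \<open>\<eta> / 2 + V / K\<close>, which is below \<open>\<eta>\<close>.\<close>

lemma good_piece:
  assumes h: "vb h V" and \<eta>: "0 < \<eta>" "\<eta> \<le> \<omega> h" and K: "0 < K" "2 * V < \<eta> * real K"
  shows "\<exists>i<K. \<forall>u. piece K i u \<longrightarrow> \<eta> / 2 \<le> h u"
proof (rule ccontr)
  assume neg: "\<not> ?thesis"
  obtain W where W: "(\<Sum>i<K. W i) \<le> V"
    "\<And>i u v. i < K \<Longrightarrow> piece K i u \<Longrightarrow> piece K i v \<Longrightarrow> \<bar>h u - h v\<bar> \<le> W i"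
    using vb_pieces[OF K(1) h] by blast
  have up: "h v \<le> \<eta> / 2 + W i" if "i < K" "piece K i v" for i v
  proof -
    have "\<not> (\<forall>u. piece K i u \<longrightarrow> \<eta> / 2 \<le> h u)" using neg that(1) by blast
    then obtain u where "piece K i u" "h u < \<eta> / 2" by (auto simp: not_le)
    thus ?thesis using W(2)[OF that(1), of u v] that(2) by auto
  qed
  have int: "pull h integrable_on {0..1}" using itg_vb[OF h] by (simp add: itg_def)
  have sub: "pull h integrable_on {x..y}" if "0 \<le> x" "y \<le> 1" for x y
    using int by (rule integrable_on_subinterval) (use that in auto)
  have "m \<le> K \<Longrightarrow> integral {0..real m / real K} (pull h) \<le> (\<Sum>i<m. (\<eta> / 2 + W i) / real K)" for m
  proof (induction m)
    case 0
    show ?case by simp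
  next
    case (Suc m)
    let ?x = "real m / real K" and ?y = "real (Suc m) / real K"
    have xy: "0 \<le> ?x" "?x \<le> ?y" "?y \<le> 1" using Suc.prems K by (auto simp: divide_le_eq divide_right_mono)
    have "integral {?x..?y} (pull h) \<le> (?y - ?x) * (\<eta> / 2 + W m)"
    proof (rule integral_le_const_interior[OF xy(2) sub])
      fix t assume t: "?x < t" "t < ?y"
      have tI: "t \<in> I" using t xy unfolding atLeastAtMost_iff by linarith
      have "piece K m (Fi t, False)" using t Fi[OF tI] Fi_X[of t] tI by (simp add: piece_def add.commute)
      thus "pull h t \<le> \<eta> / 2 + W m" using up[of m] Suc.prems by (simp add: pull_def)
    qed (use xy in auto)
    also have "?y - ?x = 1 / real K" by (simp add: diff_divide_distrib[symmetric])
    finally have "integral {?x..?y} (pull h) \<le> (\<eta> / 2 + W m) / real K" by simp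
    moreover have "integral {0..?x} (pull h) + integral {?x..?y} (pull h) = integral {0..?y} (pull h)"
    proof (rule Henstock_Kurzweil_Integration.integral_combine[OF xy(1,2)])
      show "pull h integrable_on {0..?y}" by (rule sub) (use xy in linarith)+
    qed
    ultimately show ?case using Suc by simp
  qed
  from this[of K] have "\<omega> h \<le> (\<Sum>i<K. (\<eta> / 2 + W i) / real K)" using K by (simp add: \<omega>_def)
  also have "\<dots> = \<eta> / 2 + (\<Sum>i<K. W i) / real K"
    using K by (simp add: sum_divide_distrib[symmetric] sum.distrib add_divide_distrib)
  also have "\<dots> \<le> \<eta> / 2 + V / real K" using W(1) K by (simp add: divide_right_mono)
  also have "\<dots> < \<eta>"
  proof -
    have "V / real K < \<eta> / 2" using K by (simp add: pos_divide_less_eq)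
    thus ?thesis by linarith
  qed
  finally show False using \<eta> by simp
qed

text \<open>\<open>B\<close> and \<open>\<eta>\<close> determine the number of cells, and each of
  these finitely many cells contains an interval between split points that spreads over everything.
  So the time does not depend on \<open>h\<close>.\<close>

lemma uniform_positivity:
  assumes \<eta>: "0 < \<eta>"
  shows "\<exists>N. \<forall>h. vb h B \<longrightarrow> (\<forall>u\<in>\<X>. 0 \<le> h u) \<longrightarrow> \<eta> \<le> \<omega> h \<longrightarrow> (\<forall>u\<in>\<X>. \<eta> / 2 \<le> (tr ^^ N) h u)"
proof -
  obtain K0 where K0: "2 * B / \<eta> < real K0" using reals_Archimedean2 by blast
  define K where "K = Suc K0"
  have "2 * B / \<eta> < real K" using K0 by (simp add: K_def)
  hence K: "0 < K" "2 * B < \<eta> * real K" using \<eta> by (auto simp: K_def divide_less_eq mult.commute)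
  have "\<exists>a b N. a \<in> J \<and> b \<in> J \<and> a < b \<and> (\<forall>u\<in>\<X>. a \<le> fst u \<and> fst u \<le> b \<longrightarrow> piece K i u)
      \<and> (\<forall>n\<ge>N. \<forall>u\<in>\<X>. 1 \<le> (tr ^^ n) (gbd a b) u)" if i: "i < K" for i
  proof -
    let ?x = "Fi (real i / real K)" and ?y = "Fi ((real i + 1) / real K)"
    have I: "real i / real K \<in> I" "(real i + 1) / real K \<in> I" using i K by (auto simp: divide_le_eq)
    have xy: "?x \<in> I" "F ?x = real i / real K" "?y \<in> I" "F ?y = (real i + 1) / real K"
      using Fi[OF I(1)] Fi[OF I(2)] by auto
    have "F ?x < F ?y" unfolding xy using K by (intro divide_strict_right_mono) auto
    hence "?x < ?y" using F_less_iff[OF xy(1,3)] by simp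
    then obtain a b where ab: "?x < a" "a < b" "b < ?y" "a \<in> J" "b \<in> J"
      using ex_two_in_J[of ?x ?y] xy by auto
    have "piece K i u" if u: "u \<in> \<X>" "a \<le> fst u \<and> fst u \<le> b" for u
    proof -
      have "fst u \<in> I" using X_fst[OF u(1)] by simp
      hence "F ?x < F (fst u)" "F (fst u) < F ?y"
        using F_less_iff[OF xy(1), of "fst u"] F_less_iff[of "fst u", OF _ xy(3)] ab u by auto
      thus ?thesis using u(1) unfolding xy piece_def by simp
    qed
    thus ?thesis using exactness_ev[OF ab(4,5,2)] ab by blast
  qed
  note ex = this
  define good where "good i p \<longleftrightarrow> fst p \<in> J \<and> fst (snd p) \<in> J \<and> fst p < fst (snd p)
      \<and> (\<forall>u\<in>\<X>. fst p \<le> fst u \<and> fst u \<le> fst (snd p) \<longrightarrow> piece K i u)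
      \<and> (\<forall>n\<ge>snd (snd p). \<forall>u\<in>\<X>. 1 \<le> (tr ^^ n) (gbd (fst p) (fst (snd p))) u)"
    for i and p :: "real \<times> real \<times> nat"
  have "\<forall>i. \<exists>p. i < K \<longrightarrow> good i p"
  proof
    fix i
    show "\<exists>p. i < K \<longrightarrow> good i p"
    proof (cases "i < K")
      case True
      from ex[OF this] obtain a b N where "good i (a, b, N)" unfolding good_def by auto
      thus ?thesis by blast
    qed simp
  qed
  from choice[OF this] obtain T where T: "\<And>i. i < K \<Longrightarrow> good i (T i)" by blast
  define a b N where "a i = fst (T i)" and "b i = fst (snd (T i))" and "N i = snd (snd (T i))" for i
  have abN: "a i \<in> J" "b i \<in> J" "a i < b i"
    "\<And>u. u \<in> \<X> \<Longrightarrow> a i \<le> fst u \<Longrightarrow> fst u \<le> b i \<Longrightarrow> piece K i u"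
    "\<And>n u. N i \<le> n \<Longrightarrow> u \<in> \<X> \<Longrightarrow> 1 \<le> (tr ^^ n) (gbd (a i) (b i)) u" if "i < K" for i
    using T[OF that] unfolding good_def a_def b_def N_def by blast+
  define M where "M = Max (N ` {..<K})"
  have M: "N i \<le> M" if "i < K" for i using that by (simp add: M_def)
  have "\<eta> / 2 \<le> (tr ^^ M) h u" if h: "vb h B" "\<forall>u\<in>\<X>. 0 \<le> h u" "\<eta> \<le> \<omega> h" and u: "u \<in> \<X>" for h u
  proof -
    obtain i where i: "i < K" "\<And>u. piece K i u \<Longrightarrow> \<eta> / 2 \<le> h u" using good_piece[OF h(1) \<eta> h(3) K] by blast
    have "(\<eta> / 2) * gbd (a i) (b i) v \<le> h v" if v: "v \<in> \<X>" for v
      using gbd_cases[OF less_imp_le[OF abN(3)[OF i(1)]], of v]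
    proof
      assume "gbd (a i) (b i) v = 0"
      thus ?thesis using h(2) v by simp
    next
      assume g: "gbd (a i) (b i) v = 1 \<and> a i \<le> fst v \<and> fst v \<le> b i"
      hence "piece K i v" using abN(4)[OF i(1) v] by blast
      thus ?thesis using g i(2) by simp
    qed
    hence "(tr ^^ M) (\<lambda>v. (\<eta> / 2) * gbd (a i) (b i) v) u \<le> (tr ^^ M) h u"
      using u by (intro trn_mono) auto
    moreover have "(\<eta> / 2) * 1 \<le> (\<eta> / 2) * (tr ^^ M) (gbd (a i) (b i)) u"
      using abN(5)[OF i(1) M[OF i(1)] u] \<eta> by (intro mult_left_mono) auto
    ultimately show ?thesis unfolding trn_scale by simp
  qed
  thus ?thesis by blast
qed

text \<open>The best lower bound of \<open>L\<^sup>n f\<close> by multiples of \<open>L\<^sup>n 1\<close> improves by a fixed amount in every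
  \<open>N\<close> steps, until it is nonnegative.\<close>

lemma eventually_nonneg:
  assumes f: "f \<in> C" and pos: "0 < \<omega> (rl f)"
  shows "\<exists>n. \<forall>u. 0 \<le> (tr ^^ n) f u"
proof -
  define \<eta> where "\<eta> = \<omega> (rl f)"
  obtain B where B: "\<And>n. vb ((tr ^^ n) (rl f)) (B * slope ^ n)"
    "\<And>n. \<omega> ((tr ^^ n) (rl f)) = slope ^ n * \<eta>" using iterate_bounds[OF f] unfolding \<eta>_def by blast
  define q where "q n = (tr ^^ n) (gb 0 :: _ \<Rightarrow> real)" for n
  have q: "vb (q n) (Bvar * slope ^ n)" "\<omega> (q n) = slope ^ n" for n
    using vb_iterate_gb[of 0 n] by (auto simp: q_def)
  have q0: "0 \<le> q n u" for n u unfolding q_def by (rule trn_nonneg) (rule gb_bounds)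
  \<comment> \<open>The values of \<open>q n\<close> exceed its mass \<open>slope ^ n\<close> by at
    most its variation.\<close>
  define U where "U = 1 + Bvar"
  have qU: "q n u \<le> U * slope ^ n" if u: "u \<in> \<X>" for n u
  proof -
    have "q n u - Bvar * slope ^ n \<le> \<omega> (q n)"
    proof (rule \<omega>_ge_const[OF q(1)])
      fix v assume "v \<in> \<X>"
      from vb_diff[OF q(1) u this, of n] show "q n u - Bvar * slope ^ n \<le> q n v" by linarith
    qed
    thus ?thesis by (simp add: q U_def distrib_right)
  qed
  have B0: "0 \<le> B" using vb_nonneg[OF B(1)[of 0]] by simp
  define m0 where "m0 = \<bar>rl f (0, False)\<bar> + B"
  have m0: "0 \<le> m0" using B0 by (simp add: m0_def)
  have start: "- m0 * q 0 u \<le> (tr ^^ 0) (rl f) u" if u: "u \<in> \<X>" for u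
    using vb_diff[OF B(1)[of 0] u end_points(1)] u by (simp add: q_def gb_0 m0_def)
  have \<eta>: "0 < \<eta>" using pos by (simp add: \<eta>_def)
  obtain N where N: "\<And>h u. vb h (B + m0 * Bvar) \<Longrightarrow> (\<And>u. u \<in> \<X> \<Longrightarrow> 0 \<le> h u) \<Longrightarrow> \<eta> \<le> \<omega> h \<Longrightarrow> u \<in> \<X>
      \<Longrightarrow> \<eta> / 2 \<le> (tr ^^ N) h u"
    using uniform_positivity[OF \<eta>, of "B + m0 * Bvar"] by blast
  \<comment> \<open>The gain \<open>\<eta> / 2\<close> of one round in units of
    \<open>q (N + n)\<close>, which is at most \<open>U * slope ^ (N + n)\<close>.\<close>
  define \<kappa> where "\<kappa> = \<eta> / (2 * U * slope ^ N)"
  have S: "0 < slope ^ n" for n using slope_bounds by simp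
  have sl: "slope \<noteq> 0" using slope_bounds by simp
  have U: "0 < U" using Bvar by (simp add: U_def)
  have \<kappa>: "0 < \<kappa>" using \<eta> U S by (simp add: \<kappa>_def)
  have step: "- (m - \<kappa>) * q (N + n) u \<le> (tr ^^ (N + n)) (rl f) u"
    if m: "0 \<le> m" "m \<le> m0" and le: "\<And>u. u \<in> \<X> \<Longrightarrow> - m * q n u \<le> (tr ^^ n) (rl f) u" and u: "u \<in> \<X>" for m n u
  proof -
    \<comment> \<open>Normalised so that the variation is bounded independently of \<open>n\<close>
      and the mass is \<open>\<eta> + m\<close>.\<close>
    define h where "h v = (1 / slope ^ n) * (tr ^^ n) (rl f) v + (m / slope ^ n) * q n v" for v
    have "vb h (\<bar>1 / slope ^ n\<bar> * (B * slope ^ n) + \<bar>m / slope ^ n\<bar> * (Bvar * slope ^ n))"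
      unfolding h_def by (intro vb_add_fun vb_scale B q)
    moreover have "\<bar>1 / slope ^ n\<bar> * (B * slope ^ n) + \<bar>m / slope ^ n\<bar> * (Bvar * slope ^ n) = B + m * Bvar"
    proof -
      have "\<bar>1 / slope ^ n\<bar> = 1 / slope ^ n" "\<bar>m / slope ^ n\<bar> = m / slope ^ n"
        using m S[of n] by (simp_all add: abs_of_nonneg less_imp_le del: zero_less_power_eq)
      thus ?thesis using sl by simp
    qed
    moreover have "B + m * Bvar \<le> B + m0 * Bvar" using m Bvar by (intro add_left_mono mult_right_mono) auto
    ultimately have vb: "vb h (B + m0 * Bvar)" using vb_mono by metis
    have h0: "0 \<le> h v" if "v \<in> \<X>" for v
    proof -
      have "0 \<le> (1 / slope ^ n) * ((tr ^^ n) (rl f) v + m * q n v)"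
        using le[OF that] S[of n] by (intro mult_nonneg_nonneg) auto
      thus ?thesis by (simp add: h_def distrib_left)
    qed
    have "\<omega> h = (1 / slope ^ n) * (slope ^ n * \<eta>) + (m / slope ^ n) * slope ^ n"
      unfolding h_def by (subst \<omega>_lincomb[OF itg_vb[OF B(1)] itg_vb[OF q(1)]]) (simp only: B(2) q(2))
    also have "\<dots> = \<eta> + m" using sl by simp
    finally have "\<eta> \<le> \<omega> h" using m by simp
    from N[OF vb h0 this u] have "\<eta> / 2 \<le> (tr ^^ N) h u" .
    also have "(tr ^^ N) h u = (1 / slope ^ n) * (tr ^^ (N + n)) (rl f) u + (m / slope ^ n) * q (N + n) u"
      unfolding h_def trn_lincomb q_def funpow_add comp_apply ..
    also have "\<dots> = ((tr ^^ (N + n)) (rl f) u + m * q (N + n) u) / slope ^ n"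
      by (simp add: add_divide_distrib)
    finally have "\<eta> / 2 * slope ^ n \<le> (tr ^^ (N + n)) (rl f) u + m * q (N + n) u"
      using S[of n] by (simp add: pos_le_divide_eq)
    moreover have "\<kappa> * q (N + n) u \<le> \<kappa> * (U * slope ^ (N + n))" using \<kappa> qU[OF u] by (intro mult_left_mono) auto
    moreover have "\<kappa> * (U * slope ^ (N + n)) = \<eta> / 2 * slope ^ n"
      using U sl by (simp add: \<kappa>_def power_add)
    ultimately show ?thesis by (simp add: algebra_simps)
  qed
  have iter: "\<exists>n m. 0 \<le> m \<and> m \<le> max 0 (m0 - real j * \<kappa>) \<and> (\<forall>u\<in>\<X>. - m * q n u \<le> (tr ^^ n) (rl f) u)" for j
  proof (induction j)
    case 0
    show ?case by (intro exI[of _ 0] exI[of _ m0]) (use m0 start in auto)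
  next
    case (Suc j)
    then obtain n m where nm: "0 \<le> m" "m \<le> max 0 (m0 - real j * \<kappa>)" "\<And>u. u \<in> \<X> \<Longrightarrow> - m * q n u \<le> (tr ^^ n) (rl f) u"
      by blast
    have mm0: "m \<le> m0" using nm(2) m0 \<kappa> by (auto simp: max_def split: if_splits intro: order_trans[of m "m0 - real j * \<kappa>"])
    have "- max 0 (m - \<kappa>) * q (N + n) u \<le> (tr ^^ (N + n)) (rl f) u" if u: "u \<in> \<X>" for u
    proof -
      have "- max 0 (m - \<kappa>) * q (N + n) u \<le> - (m - \<kappa>) * q (N + n) u"
        using q0 by (intro mult_right_mono) auto
      also have "\<dots> \<le> (tr ^^ (N + n)) (rl f) u" by (rule step[OF nm(1) mm0 nm(3) u])
      finally show ?thesis .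
    qed
    moreover have "max 0 (m - \<kappa>) \<le> max 0 (m0 - real (Suc j) * \<kappa>)" using nm(2) \<kappa> by (auto simp: algebra_simps max_def split: if_splits)
    ultimately show ?case by (intro exI[of _ "N + n"] exI[of _ "max 0 (m - \<kappa>)"]) auto
  qed
  obtain j where "m0 / \<kappa> < real j" using reals_Archimedean2 by blast
  hence "m0 - real j * \<kappa> \<le> 0" using \<kappa> by (simp add: divide_less_eq)
  with iter[of j] obtain n where n: "\<forall>u\<in>\<X>. 0 \<le> (tr ^^ n) (rl f) u" by fastforce
  have "0 \<le> (tr ^^ n) f u" for u
  proof (cases "u \<in> \<X>")
    case True
    have "0 \<le> rl ((tr ^^ n) f) u" using n True fun_cong[OF rl_trn[of n f], of u] by simp
    thus ?thesis by simp
  next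
    case False
    thus ?thesis using C_outside[OF C_trn[OF f]] by simp
  qed
  thus ?thesis by blast
qed

text \<open>A nonzero value is at least 1 and persists on a one-sided neighbourhood. This contains
  an interval between split points, whose mass is positive because \<open>F\<close> is strictly
  increasing.\<close>

lemma full_support:
  assumes f: "f \<in> C" "\<And>u. 0 \<le> f u" and w: "f w \<noteq> 0"
  shows "0 < \<omega> (rl f)"
proof -
  have wX: "w \<in> \<X>" using C_outside[OF f(1), of w] w by blast
  obtain x b where wx: "w = (x, b)" by (cases w)
  have x: "x \<in> I" and bx: "b \<Longrightarrow> x \<in> J0" using wX by (auto simp: wx in_X_iff)
  obtain d where d: "d > 0" "\<And>v. v \<in> \<X> \<Longrightarrow> x - d < fst v \<Longrightarrow> fst v < x \<Longrightarrow> f v = f (x, False)"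
    "\<And>v. v \<in> \<X> \<Longrightarrow> x < fst v \<Longrightarrow> fst v < x + d \<Longrightarrow> f v = f (x, x \<in> J0)"
    using C_locally_constant[OF f(1) x] by auto
  have "\<exists>l r. 0 \<le> l \<and> l < r \<and> r \<le> 1 \<and> (\<forall>v\<in>\<X>. l < fst v \<and> fst v < r \<longrightarrow> f v = f w)"
  proof (cases "\<not> b \<and> x \<noteq> 0")
    case True
    have "f v = f w" if "v \<in> \<X>" "max 0 (x - d) < fst v" "fst v < x" for v
      using d(2)[OF that(1)] that True by (simp add: wx)
    thus ?thesis using True x d(1) by (intro exI[of _ "max 0 (x - d)"] exI[of _ x]) auto
  next
    case False
    have x1: "x < 1" using False bx x by (auto simp: less_le)
    have "b = (x \<in> J0)" using False bx by auto
    hence "f v = f w" if "v \<in> \<X>" "x < fst v" "fst v < min 1 (x + d)" for v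
      using d(3)[OF that(1)] that by (simp add: wx)
    thus ?thesis using x x1 d(1) by (intro exI[of _ x] exI[of _ "min 1 (x + d)"]) auto
  qed
  then obtain l r where lr: "0 \<le> l" "l < r" "r \<le> 1" "\<And>v. v \<in> \<X> \<Longrightarrow> l < fst v \<Longrightarrow> fst v < r \<Longrightarrow> f v = f w" by blast
  obtain y z where yz: "l < y" "y < z" "z < r" "y \<in> J" "z \<in> J" using ex_two_in_J[OF lr(1-3)] by blast
  have fw: "1 \<le> f w" using f(2)[of w] w by linarith
  have le: "gbd y z v \<le> rl f v" if v: "v \<in> \<X>" for v
    using gbd_cases[OF less_imp_le[OF yz(2)], of v]
  proof
    assume "gbd y z v = 0"
    thus ?thesis using f(2)[of v] by simp
  next
    assume g: "gbd y z v = 1 \<and> y \<le> fst v \<and> fst v \<le> z"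
    hence "f v = f w" using lr(4)[OF v] yz by auto
    thus ?thesis using g fw by simp
  qed
  have "\<omega> (gbd y z) \<le> \<omega> (rl f)"
    by (intro \<omega>_mono itg_lincomb itg_gb itg_C f yz le)
  moreover have "\<omega> (gbd y z) = F z - F y"
    by (subst \<omega>_lincomb) (use yz in \<open>auto simp: itg_gb \<omega>_gb\<close>)
  moreover have "F y < F z" using F_strict[of y z] yz lr by auto
  ultimately show ?thesis by simp
qed

end

section \<open>States, infinitesimals and the order\<close>

lemma real_group_inv: "inv\<^bsub>real_group\<^esub> y = - y"
proof -
  interpret R: group real_group by (rule group_real)
  show ?thesis by (rule R.inv_equality) auto
qed

lemma ring_real_a_inv: "a_inv (ring_of_type_algebra :: real ring) y = - y"
  unfolding a_inv_def using real_group_inv by simp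

context nonperiodic_unimodal
begin

lemma zero_pos: "cl (\<lambda>u. 0) \<in> Pos D"
  using Pos_D_iff[OF C_zero] by (metis funpow_0 order_refl)

text \<open>A nonnegative iterate is either zero, so that the class is trivial, or has positive mass
  by full support; passing to iterates changes the mass by a power of \<open>slope\<close>
  only.\<close>

lemma Pos_cl_iff:
  assumes f: "f \<in> C"
  shows "cl f \<in> Pos D \<longleftrightarrow> cl f = cl (\<lambda>u. 0) \<or> 0 < \<omega> (rl f)"
proof
  assume "cl f \<in> Pos D"
  then obtain n where n: "\<And>u. 0 \<le> (tr ^^ n) f u" using Pos_D_iff[OF f] by blast
  show "cl f = cl (\<lambda>u. 0) \<or> 0 < \<omega> (rl f)"
  proof (cases "(tr ^^ n) f = (\<lambda>u. 0)")
    case True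
    hence "(tr ^^ n) f = (tr ^^ n) (\<lambda>u. 0)" by (simp add: trn_zero)
    thus ?thesis using cl_eq_iff[OF f C_zero] by blast
  next
    case False
    then obtain w where "(tr ^^ n) f w \<noteq> 0" by (meson ext)
    hence "0 < \<omega> (rl ((tr ^^ n) f))" using n by (intro full_support[OF C_trn[OF f]])
    thus ?thesis using slope_bounds unfolding \<omega>_trn[OF f] by (simp add: zero_less_mult_iff)
  qed
next
  assume "cl f = cl (\<lambda>u. 0) \<or> 0 < \<omega> (rl f)"
  thus "cl f \<in> Pos D"
  proof
    assume "0 < \<omega> (rl f)"
    thus ?thesis using eventually_nonneg[OF f] Pos_D_iff[OF f] by blast
  qed (simp add: zero_pos)
qed

section \<open>The state induced by the measure and its uniqueness\<close>

definition \<Omega> :: "(real \<times> bool \<Rightarrow> int) set \<Rightarrow> real" where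
  "\<Omega> = restrict (\<lambda>x. \<omega> (rl (SOME f. f \<in> C \<and> cl f = x))) (carrier D)"

text \<open>Equivalent functions agree after finitely many transfers, and these multiply both masses
  by the same power of \<open>slope\<close>.\<close>

lemma \<Omega>_cl:
  assumes f: "f \<in> C"
  shows "\<Omega> (cl f) = \<omega> (rl f)"
proof -
  define g where "g = (SOME g. g \<in> C \<and> cl g = cl f)"
  have g: "g \<in> C \<and> cl g = cl f" unfolding g_def by (rule someI[of _ f]) (use f in simp)
  then obtain n where "(tr ^^ n) g = (tr ^^ n) f" using cl_eq_iff[of g f] f by blast
  hence "\<omega> (rl ((tr ^^ n) g)) = \<omega> (rl ((tr ^^ n) f))" by (rule arg_cong)
  moreover have "g \<in> C" using g by blast
  ultimately have "slope ^ n * \<omega> (rl g) = slope ^ n * \<omega> (rl f)" by (simp only: \<omega>_trn f)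
  hence "\<omega> (rl g) = \<omega> (rl f)" using slope_bounds by simp
  thus ?thesis unfolding \<Omega>_def using cl_closed[OF f] by (simp add: g_def)
qed

lemma \<Omega>_mult: "x \<in> carrier D \<Longrightarrow> y \<in> carrier D \<Longrightarrow> \<Omega> (x \<otimes>\<^bsub>D\<^esub> y) = \<Omega> x + \<Omega> y"
proof -
  assume "x \<in> carrier D" "y \<in> carrier D"
  then obtain f g where fg: "f \<in> C" "g \<in> C" "x = cl f" "y = cl g" by (auto simp: carrier_D)
  have "\<omega> (\<lambda>u. 1 * rl f u + 1 * rl g u) = 1 * \<omega> (rl f) + 1 * \<omega> (rl g)"
    by (rule \<omega>_lincomb) (simp_all add: itg_C fg)
  thus ?thesis using fg by (simp add: mult_D \<Omega>_cl C_add)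
qed

lemma \<Omega>_hom: "\<Omega> \<in> hom D real_group"
  by (rule homI) (auto simp: \<Omega>_mult)

lemma \<Omega>_group_hom: "group_hom D real_group \<Omega>"
  using \<Omega>_hom group_real D_comm_group
  by (simp add: group_hom_def group_hom_axioms_def comm_group_def)

lemma \<Omega>_unit: "\<Omega> (I01 \<tau> c) = 1"
  using \<Omega>_cl[OF C_gb[OF J_members(2)]] by (simp add: order_unit_D rl_gb \<omega>_gb0)

lemma \<Omega>_one: "\<Omega> \<one>\<^bsub>D\<^esub> = 0"
  using group_hom.hom_one[OF \<Omega>_group_hom] by simp

lemma \<Omega>_inv: "x \<in> carrier D \<Longrightarrow> \<Omega> (inv\<^bsub>D\<^esub> x) = - \<Omega> x"
  using group_hom.hom_inv[OF \<Omega>_group_hom, of x] real_group_inv by simp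

lemma \<Omega>_int_pow: "x \<in> carrier D \<Longrightarrow> \<Omega> (x [^]\<^bsub>D\<^esub> (k::int)) = of_int k * \<Omega> x"
  using group_hom.hom_int_pow[OF \<Omega>_group_hom, of x k] by (simp only: real_group_int_pow)

lemma \<Omega>_Lstar: "x \<in> carrier D \<Longrightarrow> \<Omega> (Lstar \<tau> c x) = slope * \<Omega> x"
proof -
  assume "x \<in> carrier D"
  then obtain f where f: "f \<in> C" "x = cl f" by (auto simp: carrier_D)
  have "\<omega> (rl (tr f)) = slope * \<omega> (rl f)" using \<omega>_trn[OF f(1), of 1] by simp
  thus ?thesis using f by (simp add: Lstar_cl \<Omega>_cl C_tr)
qed

lemma Pos_iff: "x \<in> carrier D \<Longrightarrow> x \<in> Pos D \<longleftrightarrow> x = \<one>\<^bsub>D\<^esub> \<or> 0 < \<Omega> x"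
  using Pos_cl_iff by (auto simp: carrier_D one_D \<Omega>_cl)

lemma Pos_carrier: "x \<in> Pos D \<Longrightarrow> x \<in> carrier D"
  by (auto simp: DG_def dim_group_def quotient_def dim_class_def)

lemma Pos_imp: "x \<in> Pos D \<Longrightarrow> 0 \<le> \<Omega> x"
  using Pos_iff[OF Pos_carrier, of x] \<Omega>_one by auto

lemma \<Omega>_state: "state D \<Omega>"
  unfolding state_def using \<Omega>_hom Pos_imp \<Omega>_unit by (auto simp: \<Omega>_def)

text \<open>The cone contains every element with positive \<open>\<Omega>\<close>. Comparing
  multiples of \<open>x\<close> with multiples of the unit therefore shows that any state is at
  least \<open>\<Omega>\<close>, and the same for the inverse of \<open>x\<close> gives
  equality.\<close>

lemma state_unique:
  assumes "state D \<omega>'"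
  shows "\<omega>' = \<Omega>"
proof -
  have w: "\<omega>' \<in> hom D real_group" "\<omega>' \<in> extensional (carrier D)" "\<And>x. x \<in> Pos D \<Longrightarrow> 0 \<le> \<omega>' x" "\<omega>' (I01 \<tau> c) = 1"
    using assms unfolding state_def by auto
  interpret w: group_hom D real_group \<omega>'
    using w(1) group_real D_comm_group by (simp add: group_hom_def group_hom_axioms_def comm_group_def)
  have pow: "\<omega>' (x [^]\<^bsub>D\<^esub> (k::int)) = of_int k * \<omega>' x" if "x \<in> carrier D" for x k
    using w.hom_int_pow[OF that, of k] by (simp only: real_group_int_pow)
  have mult: "\<omega>' (x \<otimes>\<^bsub>D\<^esub> y) = \<omega>' x + \<omega>' y" if "x \<in> carrier D" "y \<in> carrier D" for x y
    using w.hom_mult[OF that] by simp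
  have le: "\<Omega> x \<le> \<omega>' x" if x: "x \<in> carrier D" for x
  proof (rule ccontr)
    assume "\<not> \<Omega> x \<le> \<omega>' x"
    then obtain k :: nat where k: "1 < real k * (\<Omega> x - \<omega>' x)"
      using reals_Archimedean3[of "\<Omega> x - \<omega>' x"] by auto
    \<comment> \<open>The largest integer strictly below \<open>real k * \<Omega> x\<close>;
      strictness puts \<open>y\<close> into the cone.\<close>
    define j where "j = \<lceil>real k * \<Omega> x\<rceil> - 1"
    define y where "y = x [^]\<^bsub>D\<^esub> (int k) \<otimes>\<^bsub>D\<^esub> I01 \<tau> c [^]\<^bsub>D\<^esub> (- j)"
    have y: "y \<in> carrier D" "\<Omega> y = real k * \<Omega> x - of_int j" "\<omega>' y = real k * \<omega>' x - of_int j"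
      using x unit_closed by (simp_all add: y_def \<Omega>_mult mult \<Omega>_int_pow pow \<Omega>_unit w(4))
    have "of_int j < real k * \<Omega> x" "real k * \<Omega> x \<le> of_int j + 1" unfolding j_def by linarith+
    hence "y \<in> Pos D" using y Pos_iff by simp
    hence "of_int j \<le> real k * \<omega>' x" using w(3) y by fastforce
    thus False using k \<open>real k * \<Omega> x \<le> of_int j + 1\<close> by (simp add: right_diff_distrib)
  qed
  have "\<omega>' x = \<Omega> x" if x: "x \<in> carrier D" for x
  proof -
    have "\<omega>' (inv\<^bsub>D\<^esub> x) = - \<omega>' x" using w.hom_inv[OF x] real_group_inv by simp
    thus ?thesis using le[OF x] le[of "inv\<^bsub>D\<^esub> x"] \<Omega>_inv[OF x] x by simp
  qed
  thus ?thesis using w(2) by (intro extensionalityI[OF w(2)]) (auto simp: \<Omega>_def)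
qed

lemma scaled_state_iff: "scaled_state \<tau> c \<omega>' \<longleftrightarrow> \<omega>' = \<Omega>"
proof
  show "scaled_state \<tau> c \<omega>' \<Longrightarrow> \<omega>' = \<Omega>" using state_unique by (simp add: scaled_state_def)
  have "0 < slope" using slope_bounds by simp
  thus "\<omega>' = \<Omega> \<Longrightarrow> scaled_state \<tau> c \<omega>'"
    unfolding scaled_state_def using \<Omega>_state \<Omega>_Lstar by blast
qed

lemma \<Omega>_ev1: "\<Omega> (ev1 p) = laurent_eval slope p"
  using GA.state_ev[OF \<Omega>_hom unit_closed, of slope p] slope_bounds \<Omega>_Lstar \<Omega>_unit by simp

lemma ev1_order_iso: "ev1 \<in> order_iso (laurent_strict slope) D"
proof -
  have bij: "bij_betw ev1 UNIV (carrier D)" using ev1_iso by (simp add: iso_def)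
  have hom: "ev1 (p + q) = ev1 p \<otimes>\<^bsub>D\<^esub> ev1 q" for p q by (rule GA.ev_add[OF unit_closed])
  have cl: "ev1 p \<in> carrier D" for p by (rule GA.ev_closed[OF unit_closed])
  have "ev1 \<in> iso (laurent_strict slope) D"
    using bij hom cl by (auto simp: iso_def hom_def laurent_strict_def with_cone_def)
  moreover have "p \<in> Pos (laurent_strict slope) \<longleftrightarrow> ev1 p \<in> Pos D" for p
  proof -
    have "ev1 0 = \<one>\<^bsub>D\<^esub>" by (simp add: laurent_apply_def)
    hence "ev1 p = \<one>\<^bsub>D\<^esub> \<longleftrightarrow> p = 0" using ev1_inj[of p] by auto
    thus ?thesis unfolding Pos_iff[OF cl] \<Omega>_ev1 by (simp add: laurent_strict_def with_cone_def)
  qed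
  ultimately show ?thesis unfolding order_iso_def by blast
qed

subsection \<open>The quotient by the infinitesimals\<close>

abbreviation Inf :: "(real \<times> bool \<Rightarrow> int) set set" where "Inf \<equiv> infinitesimals D"

text \<open>The two order conditions concern elements with \<open>\<Omega>\<close>-values
  \<open>1 \<plusminus> n * \<Omega> x\<close>. Their nonnegativity for all \<open>n\<close> forces
  \<open>\<Omega> x = 0\<close>, and then both values are 1, which is strictly positive.\<close>

lemma Inf_eq: "Inf = {x \<in> carrier D. \<Omega> x = 0}"
proof -
  have leq: "leq D a b \<longleftrightarrow> b \<otimes>\<^bsub>D\<^esub> inv\<^bsub>D\<^esub> a \<in> Pos D" for a b by (simp add: leq_def)
  have val: "\<Omega> (x [^]\<^bsub>D\<^esub> n \<otimes>\<^bsub>D\<^esub> inv\<^bsub>D\<^esub> (inv\<^bsub>D\<^esub> (I01 \<tau> c))) = real n * \<Omega> x + 1"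
    "\<Omega> (I01 \<tau> c \<otimes>\<^bsub>D\<^esub> inv\<^bsub>D\<^esub> (x [^]\<^bsub>D\<^esub> n)) = 1 - real n * \<Omega> x"
    "x [^]\<^bsub>D\<^esub> n \<otimes>\<^bsub>D\<^esub> inv\<^bsub>D\<^esub> (inv\<^bsub>D\<^esub> (I01 \<tau> c)) \<in> carrier D" "I01 \<tau> c \<otimes>\<^bsub>D\<^esub> inv\<^bsub>D\<^esub> (x [^]\<^bsub>D\<^esub> n) \<in> carrier D"
    if x: "x \<in> carrier D" for x and n :: nat
  proof -
    note cl = GA.nat_pow_closed[OF x, of n] unit_closed
    have "\<Omega> (x [^]\<^bsub>D\<^esub> n) = real n * \<Omega> x" using \<Omega>_int_pow[OF x, of "int n"] by (simp add: int_pow_int)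
    thus "\<Omega> (x [^]\<^bsub>D\<^esub> n \<otimes>\<^bsub>D\<^esub> inv\<^bsub>D\<^esub> (inv\<^bsub>D\<^esub> (I01 \<tau> c))) = real n * \<Omega> x + 1"
      "\<Omega> (I01 \<tau> c \<otimes>\<^bsub>D\<^esub> inv\<^bsub>D\<^esub> (x [^]\<^bsub>D\<^esub> n)) = 1 - real n * \<Omega> x"
      using \<Omega>_mult[OF cl(1) GA.inv_closed[OF GA.inv_closed[OF cl(2)]]] \<Omega>_inv[OF GA.inv_closed[OF cl(2)]]
        \<Omega>_inv[OF cl(2)] \<Omega>_mult[OF cl(2) GA.inv_closed[OF cl(1)]] \<Omega>_inv[OF cl(1)] \<Omega>_unit
      by linarith+
  qed (use x unit_closed in simp_all)
  show ?thesis
  proof (intro equalityI subsetI)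
    fix x assume "x \<in> Inf"
    hence x: "x \<in> carrier D"
      and P: "\<And>n::nat. x [^]\<^bsub>D\<^esub> n \<otimes>\<^bsub>D\<^esub> inv\<^bsub>D\<^esub> (inv\<^bsub>D\<^esub> (I01 \<tau> c)) \<in> Pos D"
        "\<And>n::nat. I01 \<tau> c \<otimes>\<^bsub>D\<^esub> inv\<^bsub>D\<^esub> (x [^]\<^bsub>D\<^esub> n) \<in> Pos D"
      unfolding infinitesimals_def leq by auto
    have bd: "real n * \<bar>\<Omega> x\<bar> \<le> 1" for n
      using Pos_imp[OF P(1)[of n]] Pos_imp[OF P(2)[of n]] unfolding val(1,2)[OF x] by (auto simp: abs_if)
    have "\<Omega> x = 0"
    proof (rule ccontr)
      assume "\<Omega> x \<noteq> 0"
      then obtain n :: nat where "1 < real n * \<bar>\<Omega> x\<bar>" using reals_Archimedean3[of "\<bar>\<Omega> x\<bar>"] by auto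
      thus False using bd[of n] by simp
    qed
    thus "x \<in> {x \<in> carrier D. \<Omega> x = 0}" using x by simp
  next
    fix x assume "x \<in> {x \<in> carrier D. \<Omega> x = 0}"
    hence x: "x \<in> carrier D" "\<Omega> x = 0" by auto
    show "x \<in> Inf" unfolding infinitesimals_def leq
      using x by (auto simp: Pos_iff val)
  qed
qed

lemma Inf_kernel: "Inf = kernel D real_group \<Omega>"
  unfolding Inf_eq kernel_def by simp

lemma Inf_normal: "Inf \<lhd> D"
  unfolding Inf_kernel by (rule group_hom.normal_kernel[OF \<Omega>_group_hom])

lemma coset_eq_iff:
  assumes "x \<in> carrier D" "y \<in> carrier D"
  shows "Inf #>\<^bsub>D\<^esub> x = Inf #>\<^bsub>D\<^esub> y \<longleftrightarrow> \<Omega> x = \<Omega> y"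
proof -
  have sub: "subgroup Inf D" using Inf_normal by (rule normal_imp_subgroup)
  have "Inf #>\<^bsub>D\<^esub> x = Inf #>\<^bsub>D\<^esub> y \<longleftrightarrow> y \<in> Inf #>\<^bsub>D\<^esub> x"
    using GA.repr_independence[OF _ assms(1) sub] GA.repr_independenceD[OF sub assms(2)] by blast
  also have "\<dots> \<longleftrightarrow> y \<otimes>\<^bsub>D\<^esub> inv\<^bsub>D\<^esub> x \<in> Inf"
    by (rule subgroup.rcos_module[OF sub GA.is_group assms])
  also have "\<dots> \<longleftrightarrow> \<Omega> x = \<Omega> y"
  proof -
    have "\<Omega> (y \<otimes>\<^bsub>D\<^esub> inv\<^bsub>D\<^esub> x) = \<Omega> y - \<Omega> x"
      using \<Omega>_mult[OF assms(2) GA.inv_closed[OF assms(1)]] \<Omega>_inv[OF assms(1)] by linarith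
    moreover have "y \<otimes>\<^bsub>D\<^esub> inv\<^bsub>D\<^esub> x \<in> carrier D" by (intro GA.m_closed GA.inv_closed assms)
    ultimately show ?thesis unfolding Inf_eq mem_Collect_eq by auto
  qed
  finally show ?thesis .
qed

abbreviation Q :: "(real \<times> bool \<Rightarrow> int) set set ordered_group" where "Q \<equiv> quotient_group D Inf"

lemma carrier_Q: "carrier Q = (\<lambda>x. Inf #>\<^bsub>D\<^esub> x) ` carrier D"
  by (auto simp: quotient_group_def with_cone_def FactGroup_def RCOSETS_def)

lemma mult_Q: "x \<in> carrier D \<Longrightarrow> y \<in> carrier D \<Longrightarrow>
    (Inf #>\<^bsub>D\<^esub> x) \<otimes>\<^bsub>Q\<^esub> (Inf #>\<^bsub>D\<^esub> y) = Inf #>\<^bsub>D\<^esub> (x \<otimes>\<^bsub>D\<^esub> y)"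
  using normal.rcos_sum[OF Inf_normal] by (simp add: quotient_group_def with_cone_def FactGroup_def)

text \<open>In \<open>D\<close> an element with \<open>\<Omega> x = 0\<close> is positive only if it
  is trivial, but its coset also contains the neutral element. So the strict order becomes the weak
  inequality in the quotient.\<close>

lemma Pos_Q_iff:
  assumes x: "x \<in> carrier D"
  shows "Inf #>\<^bsub>D\<^esub> x \<in> Pos Q \<longleftrightarrow> 0 \<le> \<Omega> x"
proof
  assume "Inf #>\<^bsub>D\<^esub> x \<in> Pos Q"
  then obtain y where y: "y \<in> Pos D" "Inf #>\<^bsub>D\<^esub> x = Inf #>\<^bsub>D\<^esub> y"
    by (auto simp: quotient_group_def with_cone_def)
  thus "0 \<le> \<Omega> x" using coset_eq_iff[OF x Pos_carrier[OF y(1)]] Pos_imp by simp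
next
  assume ge: "0 \<le> \<Omega> x"
  have "\<exists>y\<in>Pos D. Inf #>\<^bsub>D\<^esub> x = Inf #>\<^bsub>D\<^esub> y"
  proof (cases "\<Omega> x = 0")
    case True
    have "\<one>\<^bsub>D\<^esub> \<in> Pos D" using zero_pos by (simp add: one_D)
    moreover have "Inf #>\<^bsub>D\<^esub> x = Inf #>\<^bsub>D\<^esub> \<one>\<^bsub>D\<^esub>"
      using coset_eq_iff[OF x GA.one_closed] True \<Omega>_one by simp
    ultimately show ?thesis by blast
  next
    case False
    hence "x \<in> Pos D" using ge Pos_iff[OF x] by simp
    thus ?thesis by blast
  qed
  thus "Inf #>\<^bsub>D\<^esub> x \<in> Pos Q" by (auto simp: quotient_group_def with_cone_def)
qed

text \<open>This map and the next use a chosen representative. By \<open>coset_eq_iff\<close> the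
  choice does not affect the result, for the second map because \<open>Lstar\<close> multiplies
  \<open>\<Omega>\<close> by \<open>slope\<close>.\<close>

definition \<psi> :: "(real \<times> bool \<Rightarrow> int) set set \<Rightarrow> real" where
  "\<psi> A = \<Omega> (SOME x. x \<in> carrier D \<and> A = Inf #>\<^bsub>D\<^esub> x)"

definition \<Lambda> :: "(real \<times> bool \<Rightarrow> int) set set \<Rightarrow> (real \<times> bool \<Rightarrow> int) set set" where
  "\<Lambda> A = Inf #>\<^bsub>D\<^esub> Lstar \<tau> c (SOME x. x \<in> carrier D \<and> A = Inf #>\<^bsub>D\<^esub> x)"

lemma coset_repr:
  assumes "x \<in> carrier D"
  shows "(SOME y. y \<in> carrier D \<and> Inf #>\<^bsub>D\<^esub> x = Inf #>\<^bsub>D\<^esub> y) \<in> carrier D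
    \<and> \<Omega> (SOME y. y \<in> carrier D \<and> Inf #>\<^bsub>D\<^esub> x = Inf #>\<^bsub>D\<^esub> y) = \<Omega> x"
proof -
  define y where "y = (SOME y. y \<in> carrier D \<and> Inf #>\<^bsub>D\<^esub> x = Inf #>\<^bsub>D\<^esub> y)"
  have "y \<in> carrier D \<and> Inf #>\<^bsub>D\<^esub> x = Inf #>\<^bsub>D\<^esub> y"
    unfolding y_def by (rule someI[of _ x]) (use assms in simp)
  hence "y \<in> carrier D \<and> \<Omega> y = \<Omega> x" using coset_eq_iff[OF assms, of y] by simp
  thus ?thesis unfolding y_def .
qed

lemma \<psi>_coset: "x \<in> carrier D \<Longrightarrow> \<psi> (Inf #>\<^bsub>D\<^esub> x) = \<Omega> x"
  using coset_repr by (simp add: \<psi>_def)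

lemma \<Lambda>_coset:
  assumes x: "x \<in> carrier D"
  shows "\<Lambda> (Inf #>\<^bsub>D\<^esub> x) = Inf #>\<^bsub>D\<^esub> Lstar \<tau> c x"
proof -
  let ?y = "SOME y. y \<in> carrier D \<and> Inf #>\<^bsub>D\<^esub> x = Inf #>\<^bsub>D\<^esub> y"
  have y: "?y \<in> carrier D" "\<Omega> ?y = \<Omega> x" using coset_repr[OF x] by auto
  show ?thesis unfolding \<Lambda>_def
    using coset_eq_iff[OF GA.\<phi>_closed[OF y(1)] GA.\<phi>_closed[OF x]] \<Omega>_Lstar[OF y(1)] \<Omega>_Lstar[OF x] y(2) by simp
qed

lemma \<Omega>_image: "\<Omega> ` carrier D = range (laurent_eval slope)"
  unfolding ev1_surj[symmetric] image_image \<Omega>_ev1 ..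

section \<open>The image of the state as a subring of the reals\<close>

abbreviation E :: "real set" where "E \<equiv> \<Omega> ` carrier D"

lemma in_E_I: "x \<in> carrier D \<Longrightarrow> \<Omega> x = a \<Longrightarrow> a \<in> E"
  by blast

lemma E_closed:
  shows "1 \<in> E" "0 \<in> E" "a \<in> E \<Longrightarrow> - a \<in> E" "a \<in> E \<Longrightarrow> b \<in> E \<Longrightarrow> a + b \<in> E"
    "a \<in> E \<Longrightarrow> slope * a \<in> E" "a \<in> E \<Longrightarrow> inverse slope * a \<in> E" "a \<in> E \<Longrightarrow> of_int k * a \<in> E"
proof -
  show "1 \<in> E" by (rule in_E_I[OF unit_closed \<Omega>_unit])
  show "0 \<in> E" by (rule in_E_I[OF GA.one_closed \<Omega>_one])
  show "- a \<in> E" if a: "a \<in> E"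
  proof -
    obtain x where x: "a = \<Omega> x" "x \<in> carrier D" using a by (rule imageE)
    show ?thesis unfolding x(1) by (rule in_E_I[OF GA.inv_closed[OF x(2)] \<Omega>_inv[OF x(2)]])
  qed
  show "a + b \<in> E" if a: "a \<in> E" and b: "b \<in> E"
  proof -
    obtain x where x: "a = \<Omega> x" "x \<in> carrier D" using a by (rule imageE)
    obtain y where y: "b = \<Omega> y" "y \<in> carrier D" using b by (rule imageE)
    show ?thesis unfolding x(1) y(1)
      by (rule in_E_I[OF GA.m_closed[OF x(2) y(2)] \<Omega>_mult[OF x(2) y(2)]])
  qed
  show "slope * a \<in> E" if a: "a \<in> E"
  proof -
    obtain x where x: "a = \<Omega> x" "x \<in> carrier D" using a by (rule imageE)
    show ?thesis unfolding x(1) by (rule in_E_I[OF GA.\<phi>_closed[OF x(2)] \<Omega>_Lstar[OF x(2)]])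
  qed
  show "inverse slope * a \<in> E" if a: "a \<in> E"
  proof -
    obtain x where x: "a = \<Omega> x" "x \<in> carrier D" using a by (rule imageE)
    have "\<Omega> x = slope * \<Omega> (GA.\<phi>inv x)" using \<Omega>_Lstar[OF GA.\<phi>inv(1)[OF x(2)]] GA.\<phi>inv(2)[OF x(2)] by simp
    hence "inverse slope * a = \<Omega> (GA.\<phi>inv x)" using x slope_bounds by (simp add: field_simps)
    thus ?thesis using GA.\<phi>inv(1)[OF x(2)] in_E_I by simp
  qed
  show "of_int k * a \<in> E" if a: "a \<in> E"
  proof -
    obtain x where x: "a = \<Omega> x" "x \<in> carrier D" using a by (rule imageE)
    show ?thesis unfolding x(1) by (rule in_E_I[OF GA.int_pow_closed[OF x(2)] \<Omega>_int_pow[OF x(2)]])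
  qed
qed

lemma E_powi: "a \<in> E \<Longrightarrow> slope powi k * a \<in> E"
proof (induction k rule: int_induct[where k = 0])
  case (step1 i)
  have eq: "slope powi (i + 1) * a = slope * (slope powi i * a)" using slope_bounds by (simp add: power_int_add_1')
  have "slope powi i * a \<in> E" using step1 by blast
  thus ?case unfolding eq by (rule E_closed(5))
next
  case (step2 i)
  have "slope powi i = slope * slope powi (i - 1)"
    using slope_bounds power_int_add_1'[of slope "i - 1"] by simp
  hence eq: "slope powi (i - 1) * a = inverse slope * (slope powi i * a)" using slope_bounds by (simp add: field_simps)
  have "slope powi i * a \<in> E" using step2 by blast
  thus ?case unfolding eq by (rule E_closed(6))
qed simp

text \<open>One factor is a Laurent polynomial in \<open>slope\<close>, and the image is stable
  under multiplication by powers of \<open>slope\<close> and by integers.\<close>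

lemma E_mult:
  assumes a: "a \<in> E" and b: "b \<in> E"
  shows "a * b \<in> E"
proof -
  obtain p where p: "b = laurent_eval slope p" using b unfolding \<Omega>_image by blast
  have "(\<Sum>k\<in>K. of_int (l k) * (slope powi k * a)) \<in> E" if "finite K" for K and l :: "int \<Rightarrow> int"
    using that by (induction K) (auto intro: E_closed E_powi a)
  moreover have "a * b = (\<Sum>k\<in>Poly_Mapping.keys p. of_int (Poly_Mapping.lookup p k) * (slope powi k * a))"
    unfolding p laurent_eval_def sum_distrib_left by (simp add: mult_ac)
  ultimately show ?thesis by simp
qed

lemma generate_ring_eq: "generate_ring (ring_of_type_algebra :: real ring) {slope, inverse slope} = E" (is "?R = E")
proof (intro equalityI subsetI)
  fix a assume "a \<in> ?R"
  thus "a \<in> E"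
  proof (induction rule: generate_ring.induct)
    case one
    show ?case using E_closed(1) by simp
  next
    case (incl h)
    thus ?case using E_closed(5)[OF E_closed(1)] E_closed(6)[OF E_closed(1)] by auto
  next
    case (a_inv h)
    thus ?case using E_closed(3) by (simp add: ring_real_a_inv)
  next
    case (eng_add a b)
    thus ?case using E_closed(4) by simp
  next
    case (eng_mult a b)
    thus ?case using E_mult by simp
  qed
next
  have neg: "- a \<in> ?R" if "a \<in> ?R" for a using generate_ring.a_inv[OF that] by (simp add: ring_real_a_inv)
  have add: "a + b \<in> ?R" if "a \<in> ?R" "b \<in> ?R" for a b using generate_ring.eng_add[OF that] by simp
  have mult: "a * b \<in> ?R" if "a \<in> ?R" "b \<in> ?R" for a b using generate_ring.eng_mult[OF that] by simp
  have one: "1 \<in> ?R" using generate_ring.one[of "ring_of_type_algebra :: real ring"] by simp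
  have zero: "0 \<in> ?R" using add[OF one neg[OF one]] by simp
  have nat: "of_nat n * a \<in> ?R" if "a \<in> ?R" for n a
    by (induction n) (auto simp: zero distrib_right intro: add that)
  have int: "of_int k * a \<in> ?R" if "a \<in> ?R" for k a
    using nat[OF that] neg[OF nat[OF that]] by (cases k rule: int_cases2) auto
  have pow: "b ^ n \<in> ?R" if "b \<in> ?R" for n b
    by (induction n) (auto simp: one intro: mult that)
  have powi: "slope powi k \<in> ?R" for k
    using pow[of slope] pow[of "inverse slope"] by (auto simp: power_int_def intro: generate_ring.incl)
  have "(\<Sum>k\<in>K. of_int (l k) * slope powi k) \<in> ?R" if "finite K" for K and l :: "int \<Rightarrow> int"
    using that by (induction K) (auto intro: zero add int powi)
  hence "laurent_eval slope p \<in> ?R" for p unfolding laurent_eval_def by simp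
  thus "a \<in> ?R" if "a \<in> E" for a using that unfolding \<Omega>_image by blast
qed

lemma \<psi>_order_iso: "\<psi> \<in> order_iso Q (Z_adjoin slope)"
proof -
  have Z: "carrier (Z_adjoin slope) = E" "Pos (Z_adjoin slope) = {x \<in> E. 0 \<le> x}"
    "mult (Z_adjoin slope) = (\<lambda>x y. x + y)"
    unfolding Z_adjoin_def Let_def with_cone_def generate_ring_eq by (simp_all add: fun_eq_iff)
  have "\<psi> \<in> hom Q (Z_adjoin slope)"
    by (rule homI) (auto simp: carrier_Q \<psi>_coset Z mult_Q \<Omega>_mult)
  moreover have "bij_betw \<psi> (carrier Q) (carrier (Z_adjoin slope))"
    unfolding bij_betw_def Z
  proof
    show "inj_on \<psi> (carrier Q)" 
    proof (rule inj_onI)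
      fix A B assume "A \<in> carrier Q" "B \<in> carrier Q" and eq: "\<psi> A = \<psi> B"
      then obtain x y where x: "x \<in> carrier D" "A = Inf #>\<^bsub>D\<^esub> x" and y: "y \<in> carrier D" "B = Inf #>\<^bsub>D\<^esub> y"
        unfolding carrier_Q by blast
      have "\<Omega> x = \<Omega> y" using eq unfolding x(2) y(2) \<psi>_coset[OF x(1)] \<psi>_coset[OF y(1)] .
      thus "A = B" unfolding x(2) y(2) coset_eq_iff[OF x(1) y(1)] .
    qed
    show "\<psi> ` carrier Q = E" by (auto simp: carrier_Q \<psi>_coset image_image)
  qed
  moreover have "y \<in> Pos Q \<longleftrightarrow> \<psi> y \<in> Pos (Z_adjoin slope)" if "y \<in> carrier Q" for y
    using that by (auto simp: carrier_Q \<psi>_coset Z Pos_Q_iff)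
  ultimately show ?thesis unfolding order_iso_def iso_def by blast
qed

lemma \<Lambda>_order_iso: "\<Lambda> \<in> order_iso Q Q"
proof -
  have cl: "Lstar \<tau> c x \<in> carrier D" if "x \<in> carrier D" for x by (rule GA.\<phi>_closed[OF that])
  have S: "slope \<noteq> 0" "0 < slope" using slope_bounds by auto
  have "\<Lambda> \<in> hom Q Q"
    by (rule homI) (auto simp: carrier_Q \<Lambda>_coset mult_Q GA.\<phi>_mult cl intro!: imageI)
  moreover have "bij_betw \<Lambda> (carrier Q) (carrier Q)"
    unfolding bij_betw_def
  proof
    show "inj_on \<Lambda> (carrier Q)"
    proof (rule inj_onI)
      fix A B assume "A \<in> carrier Q" "B \<in> carrier Q" and eq: "\<Lambda> A = \<Lambda> B"
      then obtain x y where x: "x \<in> carrier D" "A = Inf #>\<^bsub>D\<^esub> x" and y: "y \<in> carrier D" "B = Inf #>\<^bsub>D\<^esub> y"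
        unfolding carrier_Q by blast
      have "slope * \<Omega> x = slope * \<Omega> y"
        using eq unfolding x(2) y(2) \<Lambda>_coset[OF x(1)] \<Lambda>_coset[OF y(1)] coset_eq_iff[OF cl[OF x(1)] cl[OF y(1)]]
          \<Omega>_Lstar[OF x(1)] \<Omega>_Lstar[OF y(1)] .
      hence "\<Omega> x = \<Omega> y" using S(1) by simp
      thus "A = B" unfolding x(2) y(2) coset_eq_iff[OF x(1) y(1)] .
    qed
    show "\<Lambda> ` carrier Q = carrier Q"
    proof (intro equalityI subsetI)
      fix A assume "A \<in> \<Lambda> ` carrier Q"
      thus "A \<in> carrier Q" by (auto simp: carrier_Q \<Lambda>_coset cl intro!: imageI)
    next
      fix A assume "A \<in> carrier Q"
      then obtain x where x: "x \<in> carrier D" "A = Inf #>\<^bsub>D\<^esub> x" by (auto simp: carrier_Q)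
      have "A = \<Lambda> (Inf #>\<^bsub>D\<^esub> GA.\<phi>inv x)" using \<Lambda>_coset[OF GA.\<phi>inv(1)[OF x(1)]] GA.\<phi>inv(2)[OF x(1)] x by simp
      thus "A \<in> \<Lambda> ` carrier Q" using GA.\<phi>inv(1)[OF x(1)] by (auto simp: carrier_Q)
    qed
  qed
  moreover have "y \<in> Pos Q \<longleftrightarrow> \<Lambda> y \<in> Pos Q" if "y \<in> carrier Q" for y
    using that S by (auto simp: carrier_Q \<Lambda>_coset Pos_Q_iff cl \<Omega>_Lstar zero_le_mult_iff)
  ultimately show ?thesis unfolding order_iso_def iso_def by blast
qed

lemma \<psi>_\<Lambda>: "y \<in> carrier Q \<Longrightarrow> \<psi> (\<Lambda> y) = slope * \<psi> y"
  by (auto simp: carrier_Q \<Lambda>_coset \<psi>_coset GA.\<phi>_closed \<Omega>_Lstar)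

end

text \<open>Finiteness of the entropy is asserted first, so that \<open>real_of_ereal\<close> does
  not return a default value. The induced automorphism \<open>\<Lambda>\<close> is specified by its
  values on cosets.\<close>

theorem proposition8p2:
  fixes \<tau> :: "real \<Rightarrow> real" and c s :: real
  assumes unimodal: "unimodal \<tau> c"
    and transitive: "transitive (top_of_set I) \<tau>"
    and s: "s = exp (real_of_ereal (topological_entropy (top_of_set I) \<tau>))"
  shows "\<bar>topological_entropy (top_of_set I) \<tau>\<bar> \<noteq> \<infinity>
    \<and> sqrt 2 \<le> s \<and> s \<le> 2
    \<and> conjugate_on I \<tau> (restricted_tent s)
    \<and> (\<not> eventually_periodic \<tau> c \<longrightarrow>
        ((\<lambda>p. laurent_apply (DG \<tau> c) (Lstar \<tau> c) p (I01 \<tau> c)) \<in> iso laurent_group (DG \<tau> c)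
         \<and> (\<exists>!\<omega>. scaled_state \<tau> c \<omega>)
         \<and> (\<forall>\<omega>. scaled_state \<tau> c \<omega> \<longrightarrow>
              (\<forall>p. \<omega> (laurent_apply (DG \<tau> c) (Lstar \<tau> c) p (I01 \<tau> c)) = laurent_eval s p)))
        \<and> (s > sqrt 2 \<longrightarrow>
            (\<lambda>p. laurent_apply (DG \<tau> c) (Lstar \<tau> c) p (I01 \<tau> c))
              \<in> order_iso (laurent_strict s) (DG \<tau> c))
        \<and> (s > sqrt 2 \<longrightarrow>
            (\<exists>!\<omega>. state (DG \<tau> c) \<omega>)
            \<and> (\<forall>\<omega>. state (DG \<tau> c) \<omega> \<longrightarrow>
                 (let N = infinitesimals (DG \<tau> c); Q = quotient_group (DG \<tau> c) N
                  in \<exists>\<psi> \<Lambda>.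
                       (\<forall>x\<in>carrier (DG \<tau> c). \<psi> (N #>\<^bsub>DG \<tau> c\<^esub> x) = \<omega> x)
                     \<and> (\<forall>x\<in>carrier (DG \<tau> c). \<Lambda> (N #>\<^bsub>DG \<tau> c\<^esub> x) = N #>\<^bsub>DG \<tau> c\<^esub> Lstar \<tau> c x)
                     \<and> \<psi> \<in> order_iso Q (Z_adjoin s)
                     \<and> \<Lambda> \<in> order_iso Q Q
                     \<and> (\<forall>y\<in>carrier Q. \<psi> (\<Lambda> y) = s * \<psi> y)))))"
proof -
  interpret T: transitive_unimodal \<tau> c
    using unimodal transitive by unfold_locales
  have ent: "topological_entropy (top_of_set I) \<tau> = ereal (ln T.slope)"
    by (rule T.topological_entropy_eq)
  have s_eq: "s = T.slope" using T.slope_bounds unfolding s ent by simp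
  have part1: "\<bar>topological_entropy (top_of_set I) \<tau>\<bar> \<noteq> \<infinity>" "sqrt 2 \<le> s" "s \<le> 2"
      "conjugate_on I \<tau> (restricted_tent s)"
    using T.slope_bounds T.conjugate_tent by (simp_all add: ent s_eq)
  show ?thesis
  proof (intro conjI part1 impI)
    assume "\<not> eventually_periodic \<tau> c"
    then interpret N: nonperiodic_unimodal \<tau> c by unfold_locales
    show "(\<lambda>p. laurent_apply (DG \<tau> c) (Lstar \<tau> c) p (I01 \<tau> c)) \<in> iso laurent_group (DG \<tau> c)"
      by (rule N.ev1_iso)
    show "\<exists>!\<omega>. scaled_state \<tau> c \<omega>"
      "\<forall>\<omega>. scaled_state \<tau> c \<omega> \<longrightarrow>
        (\<forall>p. \<omega> (laurent_apply (DG \<tau> c) (Lstar \<tau> c) p (I01 \<tau> c)) = laurent_eval s p)"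
      by (auto simp: N.scaled_state_iff N.\<Omega>_ev1 s_eq)
    show "(\<lambda>p. laurent_apply (DG \<tau> c) (Lstar \<tau> c) p (I01 \<tau> c)) \<in> order_iso (laurent_strict s) (DG \<tau> c)"
      unfolding s_eq by (rule N.ev1_order_iso)
    show "\<exists>!\<omega>. state (DG \<tau> c) \<omega>" using N.\<Omega>_state N.state_unique by blast
    show "\<forall>\<omega>. state (DG \<tau> c) \<omega> \<longrightarrow>
                 (let N = infinitesimals (DG \<tau> c); Q = quotient_group (DG \<tau> c) N
                  in \<exists>\<psi> \<Lambda>.
                       (\<forall>x\<in>carrier (DG \<tau> c). \<psi> (N #>\<^bsub>DG \<tau> c\<^esub> x) = \<omega> x)
                     \<and> (\<forall>x\<in>carrier (DG \<tau> c). \<Lambda> (N #>\<^bsub>DG \<tau> c\<^esub> x) = N #>\<^bsub>DG \<tau> c\<^esub> Lstar \<tau> c x)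
                     \<and> \<psi> \<in> order_iso Q (Z_adjoin s)
                     \<and> \<Lambda> \<in> order_iso Q Q
                     \<and> (\<forall>y\<in>carrier Q. \<psi> (\<Lambda> y) = s * \<psi> y))"
    proof (intro allI impI)
      fix \<omega> assume "state (DG \<tau> c) \<omega>"
      hence \<omega>: "\<omega> = N.\<Omega>" by (rule N.state_unique)
      show "let N = infinitesimals (DG \<tau> c); Q = quotient_group (DG \<tau> c) N
                  in \<exists>\<psi> \<Lambda>.
                       (\<forall>x\<in>carrier (DG \<tau> c). \<psi> (N #>\<^bsub>DG \<tau> c\<^esub> x) = \<omega> x)
                     \<and> (\<forall>x\<in>carrier (DG \<tau> c). \<Lambda> (N #>\<^bsub>DG \<tau> c\<^esub> x) = N #>\<^bsub>DG \<tau> c\<^esub> Lstar \<tau> c x)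
                     \<and> \<psi> \<in> order_iso Q (Z_adjoin s)
                     \<and> \<Lambda> \<in> order_iso Q Q
                     \<and> (\<forall>y\<in>carrier Q. \<psi> (\<Lambda> y) = s * \<psi> y)"
        unfolding Let_def \<omega> s_eq
      proof (rule exI[of _ N.\<psi>], rule exI[of _ N.\<Lambda>], intro conjI ballI)
        show "N.\<psi> \<in> order_iso N.Q (Z_adjoin T.slope)" by (rule N.\<psi>_order_iso)
        show "N.\<Lambda> \<in> order_iso N.Q N.Q" by (rule N.\<Lambda>_order_iso)
      qed (simp_all add: N.\<psi>_coset N.\<Lambda>_coset N.\<psi>_\<Lambda>)
    qed
  qed
qed

end
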